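(* Let $A$ be a commutative algebra over $\mathbb{C}$, let $Y$ be a pointed simplicial finite set, let $N\geq 2$ and let $q\in\mathbb{C}$ be a primitive $N$-th root of unity. Let $D=\{D_k\}_{k\geq 0}$ be a normalized higher derivation on $A$. For $k\geq 1$, let $L_{D_k}^Y:{}_qHH_*^Y(A)\longrightarrow{}_qHH_*^Y(A)$ be the action of the element $D_k\in\mathcal{H}=\mathcal{U}(Der(A))$ on the left $\mathcal{H}$-module ${}_qHH_*^Y(A)$, and let $L_D^{Y,k}:{}_qHH_*^Y(A)\longrightarrow{}_qHH_*^Y(A)$ be the morphism induced by the higher derivation $D$ (both as defined in the context). Then, for each $k\geq 1$, $L_{D_k}^Y=L_D^{Y,k}$ as an endomorphism of ${}_qHH_*^Y(A)=\bigoplus_{n=0}^{\infty}{}_qHH_n^Y(A)$.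
   Context: $Vect$ is the category of complex vector spaces; tensor products are over $\mathbb{C}$. A derivation on $A$ is a $\mathbb{C}$-linear map $d:A\to A$ with $d(aa')=d(a)a'+ad(a')$; $Der(A)$ is the Lie algebra of derivations with bracket $[d,d']=d\circ d'-d'\circ d$, and $\mathcal{H}=\mathcal{U}(Der(A))$ is its universal enveloping algebra. A higher (Hasse-Schmidt) derivation on $A$ is a sequence $D=\{D_n\}_{n\geq 0}$ of $\mathbb{C}$-linear maps $D_n:A\to A$ with $D_n(aa')=\sum_{i=0}^n D_i(a)D_{n-i}(a')$ for all $n\geq 0$, $a,a'\in A$; it is normalized if $D_0=1$ (the identity map). Elements $D_k\in\mathcal{H}$. By a theorem of Mirzavaziri, for a normalized higher derivation $D$ there is a sequence of derivations $d_n\in Der(A)$ (those with $n\ge1$ being used) such that for $k\geq 1$ $$D_k=\sum_{i=1}^k\Big(\sum_{r_1+\dots+r_i=k}\Big(\prod_{j=1}^i\frac{1}{r_j+\dots+r_i}\Big)d_{r_1}\cdots d_{r_i}\Big),$$ the inner sum being over $i$-tuples of positive integers; moreover $(M+1)D_{M+1}=\sum_{m=0}^M d_{m+1}D_{M-m}$ for all $M\geq 0$. Through this formula (with the products $d_{r_1}\cdots d_{r_i}$ taken in $\mathcal{H}$), each $D_k$ is regarded as an element of $\mathcal{H}$. $\Gamma$ is the category with objects $[n]=\{0,1,\dots,n\}$, $n\geq 0$, pointed at $0$, and morphisms the maps of sets preserving $0$. The functor $\mathcal{L}(A):\Gamma\to Vect$ sends $[n]$ to $A\otimes A^{\otimes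 n}$, and $\phi:[m]\to[n]$ to $\mathcal{L}(A)(\phi)(a_0\otimes\dots\otimes a_m)=b_0\otimes\dots\otimes b_n$ with $b_j=\prod_{\phi(i)=j}a_i$ (empty product $=1$). It is extended to the category $Fin_*$ of finite pointed sets by $\mathcal{L}(A)(T)=\mathrm{colim}_{\Gamma\ni T'\to T}\,\mathcal{L}(A)(T')$. A pointed simplicial finite set is a functor $Y:\Delta^{op}\to Fin_*$, with $\Delta$ the simplex category; $\mathcal{L}^Y(A)=\mathcal{L}(A)\circ Y:\Delta^{op}\to Vect$ is a simplicial vector space, with $i$-th component $\mathcal{L}^Y(A)_i=\mathcal{L}(A)(Y_i)$ and face maps $d_n^i:\mathcal{L}^Y(A)_n\to\mathcal{L}^Y(A)_{n-1}$, $0\leq i\leq n$. Set $\mathcal{L}^Y(A)_n=0$ for $n<0$ and ${}_qb_n=\sum_{i=0}^n q^i d_n^i:\mathcal{L}^Y(A)_n\to\mathcal{L}^Y(A)_{n-1}$ (with ${}_qb_n=0$ for $n\le 0$). It is known that ${}_qb^N=0$, i.e. $(\mathcal{L}^Y(A),{}_qb)$ is an $N$-complex. For an $N$-complex $(C_*,b)$ the homology object is $H_{\{n\}}(C_*,b)=\bigoplus_{i=1}^{N-1}H_{\{i,n\}}(C_*,b)$, where $H_{\{i,n\}}(C_*,b)=\mathrm{Ker}(b^i:C_n\to C_{n-i})/\mathrm{Im}(b^{N-i}:C_{n+N-i}\to C_n)$. The $q$-Hochschild homology groups of $A$ of order $Y$ are ${}_qHH_n^Y(A)=H_{\{n\}}(\mathcal{L}^Y(A),{}_qb)$,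 $n\geq 0$. The $\mathcal{H}$-module structure. Any $d\in Der(A)$ gives an endomorphism $L_d$ of the functor $\mathcal{L}(A):\Gamma\to Vect$ by $L_d([n])(a_0\otimes\dots\otimes a_n)=\sum_{i=0}^n a_0\otimes\dots\otimes d(a_i)\otimes\dots\otimes a_n$; it extends to $Fin_*$ via the colimits and, by composing with $Y$, gives an endomorphism of the simplicial vector space $\mathcal{L}^Y(A)$, hence maps $L_d^{Y,n}$ on ${}_qHH_n^Y(A)$, $n\geq 0$. These satisfy $[L_d^{Y,n},L_{d'}^{Y,n}]=L_{[d,d']}^{Y,n}$, and so make each ${}_qHH_n^Y(A)$, and ${}_qHH_*^Y(A)$, a left $\mathcal{H}$-module. For $h\in\mathcal{H}$, $L_h^Y$ denotes the action of $h$ on ${}_qHH_*^Y(A)$. The morphisms $L_D^{Y,k}$. For $k\geq 0$, the higher derivation $D$ gives an endomorphism $L_D^k$ of $\mathcal{L}(A):\Gamma\to Vect$ by $L_D^k([n])(a_0\otimes\dots\otimes a_n)=\sum_{p_0+\dots+p_n=k}D_{p_0}(a_0)\otimes\dots\otimes D_{p_n}(a_n)$ (sum over ordered tuples of non-negative integers); it extends to $Fin_*$ via the colimits and, by composing with $Y$, gives an endomorphism of the simplicial vector space $\mathcal{L}^Y(A)$, and $L_D^{Y,k}$ is the map it induces on ${}_qHH_*^Y(A)$. *)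

theory Defs
  imports
    Complex_Main
    "HOL-Library.FuncSet"
    "HOL-Library.Poly_Mapping"
    "HOL-Algebra.Module"
    "HOL-Algebra.QuotRing"
begin

section \<open>Complex vector spaces\<close>

text \<open>
  A complex vector space is a \<open>(complex, 'v) module\<close> record \<open>M\<close> with \<open>module CC M\<close>; the ring
  multiplication and unit fields of the record carry no information for vector spaces.
\<close>

definition CC :: "complex ring" where
  "CC = \<lparr>carrier = UNIV, mult = (*), one = 1, zero = 0, add = (+)\<rparr>"

text \<open>
  The space with basis \<open>X\<close>: the finitely supported functions with support in \<open>X\<close>, the basis vector
  of \<open>x\<close> being \<open>Poly_Mapping.single x 1\<close>.
\<close>

definition free_space :: "'x set \<Rightarrow> (complex, 'x \<Rightarrow>\<^sub>0 complex) module" where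
  "free_space X = \<lparr>carrier = {f. Poly_Mapping.keys f \<subseteq> X}, mult = undefined, one = undefined,
     zero = 0, add = (+), smult = (\<lambda>c. Poly_Mapping.map ((*) c))\<rparr>"

definition free_lift :: "(complex, 'v) module \<Rightarrow> ('x \<Rightarrow> 'v) \<Rightarrow> ('x \<Rightarrow>\<^sub>0 complex) \<Rightarrow> 'v" where
  "free_lift M g f =
     (\<Oplus>\<^bsub>M\<^esub>x\<in>Poly_Mapping.keys f. Poly_Mapping.lookup f x \<odot>\<^bsub>M\<^esub> g x)"

definition lin_span :: "(complex, 'v) module \<Rightarrow> 'v set \<Rightarrow> 'v set" where
  "lin_span M S = \<Inter>{W. submodule W CC M \<and> S \<subseteq> W}"

text \<open>
  The scalar multiple of a coset \<open>X\<close> is the coset containing all \<open>c x\<close> with \<open>x \<in> X\<close>; for \<open>c = 0\<close>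
  this differs from the set of all these \<open>c x\<close>.
\<close>

definition quot_space :: "(complex, 'v) module \<Rightarrow> 'v set \<Rightarrow> (complex, 'v set) module" where
  "quot_space M W = \<lparr>carrier = a_rcosets\<^bsub>M\<^esub> W, mult = undefined, one = undefined,
     zero = W, add = set_add M, smult = (\<lambda>c X. \<Union>x\<in>X. W +>\<^bsub>M\<^esub> (c \<odot>\<^bsub>M\<^esub> x))\<rparr>"

text \<open>The map on a quotient induced by a map \<open>f\<close> that is constant on cosets.\<close>

definition quot_lift :: "('v \<Rightarrow> 'w) \<Rightarrow> 'v set \<Rightarrow> 'w" where
  "quot_lift f X = the_elem (f ` X)"

definition direct_sum :: "'i set \<Rightarrow> ('i \<Rightarrow> (complex, 'v) module) \<Rightarrow> (complex, 'i \<Rightarrow> 'v) module" where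
  "direct_sum I V =
     \<lparr>carrier = {f \<in> \<Pi>\<^sub>E i\<in>I. carrier (V i). finite {i\<in>I. f i \<noteq> \<zero>\<^bsub>V i\<^esub>}},
      mult = undefined, one = undefined,
      zero = (\<lambda>i\<in>I. \<zero>\<^bsub>V i\<^esub>),
      add = (\<lambda>f g. \<lambda>i\<in>I. f i \<oplus>\<^bsub>V i\<^esub> g i),
      smult = (\<lambda>c f. \<lambda>i\<in>I. c \<odot>\<^bsub>V i\<^esub> f i)\<rparr>"

definition sum_incl :: "'i set \<Rightarrow> ('i \<Rightarrow> (complex, 'v) module) \<Rightarrow> 'i \<Rightarrow> 'v \<Rightarrow> 'i \<Rightarrow> 'v" where
  "sum_incl I V i x = (\<lambda>j\<in>I. if j = i then x else \<zero>\<^bsub>V j\<^esub>)"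

definition sum_lift ::
  "'i set \<Rightarrow> ('i \<Rightarrow> (complex, 'v) module) \<Rightarrow> (complex, 'w) module \<Rightarrow> ('i \<Rightarrow> 'v \<Rightarrow> 'w) \<Rightarrow> ('i \<Rightarrow> 'v) \<Rightarrow> 'w" where
  "sum_lift I V M g f = (\<Oplus>\<^bsub>M\<^esub>i\<in>{i\<in>I. f i \<noteq> \<zero>\<^bsub>V i\<^esub>}. g i (f i))"

definition zero_space :: "(complex, 'v) module" where
  "zero_space = \<lparr>carrier = {undefined}, mult = undefined, one = undefined,
     zero = undefined, add = (\<lambda>_ _. undefined), smult = (\<lambda>_ _. undefined)\<rparr>"


section \<open>Algebras, derivations and higher derivations\<close>

text \<open>
  The sort \<open>{comm_ring, comm_monoid_mult}\<close> is that of commutative unital rings; unlike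
  \<open>comm_ring_1\<close> it does not exclude the zero ring.
\<close>

locale complex_comm_algebra = vector_space scale
  for scale :: "complex \<Rightarrow> 'a::{comm_ring, comm_monoid_mult} \<Rightarrow> 'a" +
  assumes scale_mult_left: "scale c x * y = scale c (x * y)"

definition derivation ::
  "(complex \<Rightarrow> 'a::{comm_ring, comm_monoid_mult} \<Rightarrow> 'a) \<Rightarrow> ('a \<Rightarrow> 'a) \<Rightarrow> bool" where
  "derivation scale d \<longleftrightarrow>
     Vector_Spaces.linear scale scale d \<and> (\<forall>a b. d (a * b) = d a * b + a * d b)"

definition Der ::
  "(complex \<Rightarrow> 'a::{comm_ring, comm_monoid_mult} \<Rightarrow> 'a) \<Rightarrow> (complex, 'a \<Rightarrow> 'a) module" where
  "Der scale = \<lparr>carrier = {d. derivation scale d}, mult = undefined, one = undefined,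
     zero = (\<lambda>a. 0), add = (\<lambda>d d' a. d a + d' a), smult = (\<lambda>c d a. scale c (d a))\<rparr>"

definition der_bracket :: "('a::ab_group_add \<Rightarrow> 'a) \<Rightarrow> ('a \<Rightarrow> 'a) \<Rightarrow> 'a \<Rightarrow> 'a" where
  "der_bracket d d' = (\<lambda>a. d (d' a) - d' (d a))"

definition higher_derivation ::
  "(complex \<Rightarrow> 'a::{comm_ring, comm_monoid_mult} \<Rightarrow> 'a) \<Rightarrow> (nat \<Rightarrow> 'a \<Rightarrow> 'a) \<Rightarrow> bool" where
  "higher_derivation scale D \<longleftrightarrow>
     (\<forall>n. Vector_Spaces.linear scale scale (D n)) \<and>
     (\<forall>n a b. D n (a * b) = (\<Sum>i\<le>n. D i a * D (n - i) b))"

definition normalized :: "(nat \<Rightarrow> 'a \<Rightarrow> 'a) \<Rightarrow> bool" where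
  "normalized D \<longleftrightarrow> D 0 = id"


section \<open>Universal enveloping algebras\<close>

text \<open>
  The free associative unital algebra on a set \<open>X\<close>: its basis consists of the words in \<open>X\<close>, which
  are multiplied by concatenation.
\<close>

definition free_algebra :: "'x set \<Rightarrow> (complex, 'x list \<Rightarrow>\<^sub>0 complex) module" where
  "free_algebra X = (free_space (lists X))
     \<lparr>mult := (\<lambda>f g. \<Sum>u\<in>Poly_Mapping.keys f. \<Sum>v\<in>Poly_Mapping.keys g.
        Poly_Mapping.single (u @ v) (Poly_Mapping.lookup f u * Poly_Mapping.lookup g v)),
      one := Poly_Mapping.single [] 1\<rparr>"

text \<open>
  \<open>\<U>(L) = T(L) / (x \<otimes> y - y \<otimes> x - [x, y])\<close> for a Lie algebra \<open>L\<close> with bracket \<open>br\<close>. The first two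
  families of relations present the tensor algebra \<open>T(L)\<close> as a quotient of the free algebra on the
  set \<open>L\<close>.
\<close>

definition uea_rels ::
  "(complex, 'x) module \<Rightarrow> ('x \<Rightarrow> 'x \<Rightarrow> 'x) \<Rightarrow> ('x list \<Rightarrow>\<^sub>0 complex) set" where
  "uea_rels L br =
     {Poly_Mapping.single [x \<oplus>\<^bsub>L\<^esub> y] 1 - Poly_Mapping.single [x] 1 - Poly_Mapping.single [y] 1
       | x y. x \<in> carrier L \<and> y \<in> carrier L} \<union>
     {Poly_Mapping.single [c \<odot>\<^bsub>L\<^esub> x] 1 - Poly_Mapping.single [x] c | c x. x \<in> carrier L} \<union>
     {Poly_Mapping.single [x, y] 1 - Poly_Mapping.single [y, x] 1 - Poly_Mapping.single [br x y] 1
       | x y. x \<in> carrier L \<and> y \<in> carrier L}"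

definition uea_ideal ::
  "(complex, 'x) module \<Rightarrow> ('x \<Rightarrow> 'x \<Rightarrow> 'x) \<Rightarrow> ('x list \<Rightarrow>\<^sub>0 complex) set" where
  "uea_ideal L br = Idl\<^bsub>free_algebra (carrier L)\<^esub> (uea_rels L br)"

definition uea ::
  "(complex, 'x) module \<Rightarrow> ('x \<Rightarrow> 'x \<Rightarrow> 'x) \<Rightarrow> (complex, ('x list \<Rightarrow>\<^sub>0 complex) set) module" where
  "uea L br = (quot_space (free_algebra (carrier L)) (uea_ideal L br))
     \<lparr>mult := mult (free_algebra (carrier L) Quot uea_ideal L br),
      one := one (free_algebra (carrier L) Quot uea_ideal L br)\<rparr>"

definition uea_incl ::
  "(complex, 'x) module \<Rightarrow> ('x \<Rightarrow> 'x \<Rightarrow> 'x) \<Rightarrow> 'x \<Rightarrow> ('x list \<Rightarrow>\<^sub>0 complex) set" where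
  "uea_incl L br x = uea_ideal L br +>\<^bsub>free_algebra (carrier L)\<^esub> Poly_Mapping.single [x] 1"

text \<open>
  The action of the enveloping algebra on a vector space \<open>M\<close> given by a representation
  \<open>\<rho>\<close> of the Lie algebra on \<open>M\<close>: a word \<open>x\<^sub>1 \<dots> x\<^sub>m\<close> acts as \<open>\<rho> x\<^sub>1 \<circ> \<dots> \<circ> \<rho> x\<^sub>m\<close>.
\<close>

definition uea_action ::
  "(complex, 'v) module \<Rightarrow> ('x \<Rightarrow> 'v \<Rightarrow> 'v) \<Rightarrow> ('x list \<Rightarrow>\<^sub>0 complex) set \<Rightarrow> 'v \<Rightarrow> 'v" where
  "uea_action M \<rho> h v = quot_lift (free_lift M (\<lambda>w. foldr \<rho> w v)) h"


section \<open>The element \<open>D\<^sub>k\<close> of the enveloping algebra\<close>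

definition compositions :: "nat \<Rightarrow> nat \<Rightarrow> nat list set" where
  "compositions i k = {rs. length rs = i \<and> sum_list rs = k \<and> (\<forall>r\<in>set rs. 0 < r)}"

definition mirz_coeff :: "nat list \<Rightarrow> complex" where
  "mirz_coeff rs = (\<Prod>j<length rs. 1 / of_nat (sum_list (drop j rs)))"

definition is_mirz_seq ::
  "(complex \<Rightarrow> 'a::{comm_ring, comm_monoid_mult} \<Rightarrow> 'a) \<Rightarrow> (nat \<Rightarrow> 'a \<Rightarrow> 'a) \<Rightarrow> (nat \<Rightarrow> 'a \<Rightarrow> 'a) \<Rightarrow> bool"
  where
  "is_mirz_seq scale D d \<longleftrightarrow>
     (\<forall>n. derivation scale (d n)) \<and>
     (\<forall>k\<ge>1. \<forall>a. D k a =
        (\<Sum>i=1..k. \<Sum>rs\<in>compositions i k. scale (mirz_coeff rs) (foldr d rs a)))"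

text \<open>
  Mirzavaziri's theorem says that such a sequence exists when \<open>D\<close> is a normalized higher
  derivation. Its terms \<open>d n\<close> with \<open>n \<ge> 1\<close> are determined by \<open>D\<close>, and \<open>d 0\<close> is never used.
\<close>

definition mirz_seq ::
  "(complex \<Rightarrow> 'a::{comm_ring, comm_monoid_mult} \<Rightarrow> 'a) \<Rightarrow> (nat \<Rightarrow> 'a \<Rightarrow> 'a) \<Rightarrow> nat \<Rightarrow> 'a \<Rightarrow> 'a" where
  "mirz_seq scale D = (SOME d. is_mirz_seq scale D d)"

abbreviation U_Der ::
  "(complex \<Rightarrow> 'a::{comm_ring, comm_monoid_mult} \<Rightarrow> 'a) \<Rightarrow>
     (complex, (('a \<Rightarrow> 'a) list \<Rightarrow>\<^sub>0 complex) set) module" where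
  "U_Der scale \<equiv> uea (Der scale) der_bracket"

definition hder_elem ::
  "(complex \<Rightarrow> 'a::{comm_ring, comm_monoid_mult} \<Rightarrow> 'a) \<Rightarrow> (nat \<Rightarrow> 'a \<Rightarrow> 'a) \<Rightarrow> nat \<Rightarrow>
     (('a \<Rightarrow> 'a) list \<Rightarrow>\<^sub>0 complex) set" where
  "hder_elem scale D k =
     (\<Oplus>\<^bsub>U_Der scale\<^esub>i\<in>{1..k}. \<Oplus>\<^bsub>U_Der scale\<^esub>rs\<in>compositions i k.
        mirz_coeff rs \<odot>\<^bsub>U_Der scale\<^esub>
          foldr (\<lambda>r u. uea_incl (Der scale) der_bracket (mirz_seq scale D r) \<otimes>\<^bsub>U_Der scale\<^esub> u)
            rs \<one>\<^bsub>U_Der scale\<^esub>)"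


section \<open>Functors on \<open>\<Gamma>\<close> and their extension to finite pointed sets\<close>

text \<open>
  A map between sets is represented by the function that is \<open>undefined\<close> outside its source, so that
  equality of such functions is equality of maps. A functor on \<open>\<Gamma>\<close> is given by its values \<open>Fo n\<close> on
  the objects \<open>{0..n}\<close> (pointed at 0) and \<open>Fm m n \<phi>\<close> on the morphisms \<open>\<phi> \<in> Gamma_hom m n\<close>.
\<close>

definition pointed_maps :: "'x set \<Rightarrow> 'x \<Rightarrow> 'y set \<Rightarrow> 'y \<Rightarrow> ('x \<Rightarrow> 'y) set" where
  "pointed_maps S s T t = {\<phi> \<in> S \<rightarrow>\<^sub>E T. \<phi> s = t}"

definition Gamma_hom :: "nat \<Rightarrow> nat \<Rightarrow> (nat \<Rightarrow> nat) set" where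
  "Gamma_hom m n = pointed_maps {0..m} 0 {0..n} 0"

text \<open>
  The objects \<open>T' \<rightarrow> T\<close> of the category \<open>\<Gamma>/T\<close> over which the colimit is taken; the colimit is
  constructed as the quotient of the direct sum of the \<open>F(T')\<close> that identifies \<open>x\<close> with
  \<open>F(\<theta>)(x)\<close> for every morphism \<open>\<theta>\<close> of \<open>\<Gamma>/T\<close>.
\<close>

definition over :: "'y set \<Rightarrow> 'y \<Rightarrow> (nat \<times> (nat \<Rightarrow> 'y)) set" where
  "over T t = (SIGMA n:UNIV. pointed_maps {0..n} 0 T t)"

definition colim_sum ::
  "(nat \<Rightarrow> (complex, 'v) module) \<Rightarrow> 'y set \<Rightarrow> 'y \<Rightarrow> (complex, nat \<times> (nat \<Rightarrow> 'y) \<Rightarrow> 'v) module" where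
  "colim_sum Fo T t = direct_sum (over T t) (\<lambda>(n, \<phi>). Fo n)"

definition colim_rels ::
  "(nat \<Rightarrow> (complex, 'v) module) \<Rightarrow> (nat \<Rightarrow> nat \<Rightarrow> (nat \<Rightarrow> nat) \<Rightarrow> 'v \<Rightarrow> 'v) \<Rightarrow> 'y set \<Rightarrow> 'y \<Rightarrow>
     (nat \<times> (nat \<Rightarrow> 'y) \<Rightarrow> 'v) set" where
  "colim_rels Fo Fm T t =
     {sum_incl (over T t) (\<lambda>(n, \<phi>). Fo n) (m, compose {0..m} \<psi> \<theta>) x
        \<ominus>\<^bsub>colim_sum Fo T t\<^esub> sum_incl (over T t) (\<lambda>(n, \<phi>). Fo n) (n, \<psi>) (Fm m n \<theta> x)
      | m n \<theta> \<psi> x. (n, \<psi>) \<in> over T t \<and> \<theta> \<in> Gamma_hom m n \<and> x \<in> carrier (Fo m)}"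

definition ext_space ::
  "(nat \<Rightarrow> (complex, 'v) module) \<Rightarrow> (nat \<Rightarrow> nat \<Rightarrow> (nat \<Rightarrow> nat) \<Rightarrow> 'v \<Rightarrow> 'v) \<Rightarrow> 'y set \<Rightarrow> 'y \<Rightarrow>
     (complex, (nat \<times> (nat \<Rightarrow> 'y) \<Rightarrow> 'v) set) module" where
  "ext_space Fo Fm T t =
     quot_space (colim_sum Fo T t) (lin_span (colim_sum Fo T t) (colim_rels Fo Fm T t))"

definition ext_incl ::
  "(nat \<Rightarrow> (complex, 'v) module) \<Rightarrow> (nat \<Rightarrow> nat \<Rightarrow> (nat \<Rightarrow> nat) \<Rightarrow> 'v \<Rightarrow> 'v) \<Rightarrow> 'y set \<Rightarrow> 'y \<Rightarrow>
     nat \<times> (nat \<Rightarrow> 'y) \<Rightarrow> 'v \<Rightarrow> (nat \<times> (nat \<Rightarrow> 'y) \<Rightarrow> 'v) set" where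
  "ext_incl Fo Fm T t i x =
     lin_span (colim_sum Fo T t) (colim_rels Fo Fm T t)
       +>\<^bsub>colim_sum Fo T t\<^esub> sum_incl (over T t) (\<lambda>(n, \<phi>). Fo n) i x"

text \<open>The map out of the colimit given by a cocone \<open>g\<close> with vertex \<open>M\<close>.\<close>

definition ext_lift ::
  "(nat \<Rightarrow> (complex, 'v) module) \<Rightarrow> 'y set \<Rightarrow> 'y \<Rightarrow> (complex, 'w) module \<Rightarrow>
     (nat \<times> (nat \<Rightarrow> 'y) \<Rightarrow> 'v \<Rightarrow> 'w) \<Rightarrow> (nat \<times> (nat \<Rightarrow> 'y) \<Rightarrow> 'v) set \<Rightarrow> 'w" where
  "ext_lift Fo T t M g = quot_lift (sum_lift (over T t) (\<lambda>(n, \<phi>). Fo n) M g)"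

definition ext_map ::
  "(nat \<Rightarrow> (complex, 'v) module) \<Rightarrow> (nat \<Rightarrow> nat \<Rightarrow> (nat \<Rightarrow> nat) \<Rightarrow> 'v \<Rightarrow> 'v) \<Rightarrow>
     'y set \<Rightarrow> 'y \<Rightarrow> 'y set \<Rightarrow> 'y \<Rightarrow> ('y \<Rightarrow> 'y) \<Rightarrow>
     (nat \<times> (nat \<Rightarrow> 'y) \<Rightarrow> 'v) set \<Rightarrow> (nat \<times> (nat \<Rightarrow> 'y) \<Rightarrow> 'v) set" where
  "ext_map Fo Fm T t T' t' f = ext_lift Fo T t (ext_space Fo Fm T' t')
     (\<lambda>(n, \<phi>). ext_incl Fo Fm T' t' (n, compose {0..n} f \<phi>))"

text \<open>The extension to finite pointed sets of an endomorphism \<open>\<alpha>\<close> of a functor on \<open>\<Gamma>\<close>.\<close>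

definition ext_endo ::
  "(nat \<Rightarrow> (complex, 'v) module) \<Rightarrow> (nat \<Rightarrow> nat \<Rightarrow> (nat \<Rightarrow> nat) \<Rightarrow> 'v \<Rightarrow> 'v) \<Rightarrow> 'y set \<Rightarrow> 'y \<Rightarrow>
     (nat \<Rightarrow> 'v \<Rightarrow> 'v) \<Rightarrow> (nat \<times> (nat \<Rightarrow> 'y) \<Rightarrow> 'v) set \<Rightarrow> (nat \<times> (nat \<Rightarrow> 'y) \<Rightarrow> 'v) set" where
  "ext_endo Fo Fm T t \<alpha> = ext_lift Fo T t (ext_space Fo Fm T t)
     (\<lambda>(n, \<phi>) x. ext_incl Fo Fm T t (n, \<phi>) (\<alpha> n x))"


section \<open>The functor \<open>\<L>(A)\<close>\<close>

text \<open>
  \<open>A \<otimes> A\<^sup>\<otimes>\<^sup>n\<close> is the space with basis \<open>A\<^sup>n\<^sup>+\<^sup>1\<close> (lists of length \<open>n + 1\<close>) modulo the relations of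
  multilinearity.
\<close>

definition tensor_rels ::
  "(complex \<Rightarrow> 'a::ab_group_add \<Rightarrow> 'a) \<Rightarrow> nat \<Rightarrow> ('a list \<Rightarrow>\<^sub>0 complex) set" where
  "tensor_rels scale n =
     {Poly_Mapping.single (as[i := x + y]) 1
        - Poly_Mapping.single (as[i := x]) 1 - Poly_Mapping.single (as[i := y]) 1
      | as i x y. length as = Suc n \<and> i \<le> n} \<union>
     {Poly_Mapping.single (as[i := scale c x]) 1 - Poly_Mapping.single (as[i := x]) c
      | as i c x. length as = Suc n \<and> i \<le> n}"

definition tensor_subspace ::
  "(complex \<Rightarrow> 'a::ab_group_add \<Rightarrow> 'a) \<Rightarrow> nat \<Rightarrow> ('a list \<Rightarrow>\<^sub>0 complex) set" where
  "tensor_subspace scale n = lin_span (free_space {as. length as = Suc n}) (tensor_rels scale n)"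

definition L_obj ::
  "(complex \<Rightarrow> 'a::ab_group_add \<Rightarrow> 'a) \<Rightarrow> nat \<Rightarrow> (complex, ('a list \<Rightarrow>\<^sub>0 complex) set) module" where
  "L_obj scale n = quot_space (free_space {as. length as = Suc n}) (tensor_subspace scale n)"

definition pure_tensor ::
  "(complex \<Rightarrow> 'a::ab_group_add \<Rightarrow> 'a) \<Rightarrow> nat \<Rightarrow> 'a list \<Rightarrow> ('a list \<Rightarrow>\<^sub>0 complex) set" where
  "pure_tensor scale n as =
     tensor_subspace scale n +>\<^bsub>free_space {as. length as = Suc n}\<^esub> Poly_Mapping.single as 1"

text \<open>The linear map \<open>A \<otimes> A\<^sup>\<otimes>\<^sup>n \<rightarrow> M\<close> with given (multilinear) values on the pure tensors.\<close>

definition tensor_lift ::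
  "(complex, 'v) module \<Rightarrow> ('a list \<Rightarrow> 'v) \<Rightarrow> ('a list \<Rightarrow>\<^sub>0 complex) set \<Rightarrow> 'v" where
  "tensor_lift M g = quot_lift (free_lift M g)"

definition L_map ::
  "(complex \<Rightarrow> 'a::{comm_ring, comm_monoid_mult} \<Rightarrow> 'a) \<Rightarrow> nat \<Rightarrow> nat \<Rightarrow> (nat \<Rightarrow> nat) \<Rightarrow>
     ('a list \<Rightarrow>\<^sub>0 complex) set \<Rightarrow> ('a list \<Rightarrow>\<^sub>0 complex) set" where
  "L_map scale m n \<phi> = tensor_lift (L_obj scale n)
     (\<lambda>as. pure_tensor scale n (map (\<lambda>j. \<Prod>i | i \<le> m \<and> \<phi> i = j. as ! i) [0..<Suc n]))"

definition L_der ::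
  "(complex \<Rightarrow> 'a::{comm_ring, comm_monoid_mult} \<Rightarrow> 'a) \<Rightarrow> ('a \<Rightarrow> 'a) \<Rightarrow> nat \<Rightarrow>
     ('a list \<Rightarrow>\<^sub>0 complex) set \<Rightarrow> ('a list \<Rightarrow>\<^sub>0 complex) set" where
  "L_der scale d n = tensor_lift (L_obj scale n)
     (\<lambda>as. \<Oplus>\<^bsub>L_obj scale n\<^esub>i\<in>{0..n}. pure_tensor scale n (as[i := d (as ! i)]))"

definition L_hder ::
  "(complex \<Rightarrow> 'a::{comm_ring, comm_monoid_mult} \<Rightarrow> 'a) \<Rightarrow> (nat \<Rightarrow> 'a \<Rightarrow> 'a) \<Rightarrow> nat \<Rightarrow> nat \<Rightarrow>
     ('a list \<Rightarrow>\<^sub>0 complex) set \<Rightarrow> ('a list \<Rightarrow>\<^sub>0 complex) set" where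
  "L_hder scale D k n = tensor_lift (L_obj scale n)
     (\<lambda>as. \<Oplus>\<^bsub>L_obj scale n\<^esub>ps\<in>{ps. length ps = Suc n \<and> sum_list ps = k}.
        pure_tensor scale n (map2 D ps as))"


section \<open>Pointed simplicial finite sets\<close>

definition Delta_hom :: "nat \<Rightarrow> nat \<Rightarrow> (nat \<Rightarrow> nat) set" where
  "Delta_hom m n = {\<theta> \<in> {0..m} \<rightarrow>\<^sub>E {0..n}. mono_on {0..m} \<theta>}"

text \<open>\<open>opmap Y m n \<theta>\<close> is the map \<open>Y\<^sub>n \<rightarrow> Y\<^sub>m\<close> assigned to \<open>\<theta> : [m] \<rightarrow> [n]\<close>.\<close>

record 'y simplicial_pset =
  cells :: "nat \<Rightarrow> 'y set"
  basept :: "nat \<Rightarrow> 'y"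
  opmap :: "nat \<Rightarrow> nat \<Rightarrow> (nat \<Rightarrow> nat) \<Rightarrow> 'y \<Rightarrow> 'y"

definition pointed_simplicial_finite_set :: "'y simplicial_pset \<Rightarrow> bool" where
  "pointed_simplicial_finite_set Y \<longleftrightarrow>
     (\<forall>n. finite (cells Y n) \<and> basept Y n \<in> cells Y n) \<and>
     (\<forall>m n. \<forall>\<theta>\<in>Delta_hom m n.
        opmap Y m n \<theta> \<in> pointed_maps (cells Y n) (basept Y n) (cells Y m) (basept Y m)) \<and>
     (\<forall>n. opmap Y n n (\<lambda>i\<in>{0..n}. i) = (\<lambda>y\<in>cells Y n. y)) \<and>
     (\<forall>l m n. \<forall>\<eta>\<in>Delta_hom l m. \<forall>\<theta>\<in>Delta_hom m n.
        opmap Y l n (compose {0..l} \<theta> \<eta>) = compose (cells Y n) (opmap Y l m \<eta>) (opmap Y m n \<theta>))"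

text \<open>The injective monotone map \<open>[n - 1] \<rightarrow> [n]\<close> (for \<open>n \<ge> 1\<close>) whose image omits \<open>i\<close>.\<close>

definition coface :: "nat \<Rightarrow> nat \<Rightarrow> nat \<Rightarrow> nat" where
  "coface n i = (\<lambda>j\<in>{0..n - 1}. if j < i then j else Suc j)"


section \<open>\<open>N\<close>-complexes and their homology\<close>

text \<open>\<open>b n\<close> is the map \<open>C\<^sub>n \<rightarrow> C\<^sub>n\<^sub>-\<^sub>1\<close>, and \<open>bpow b i n\<close> is \<open>b\<^sup>i : C\<^sub>n \<rightarrow> C\<^sub>n\<^sub>-\<^sub>i\<close>.\<close>

primrec bpow :: "(int \<Rightarrow> 'v \<Rightarrow> 'v) \<Rightarrow> nat \<Rightarrow> int \<Rightarrow> 'v \<Rightarrow> 'v" where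
  "bpow b 0 n x = x"
| "bpow b (Suc i) n x = bpow b i (n - 1) (b n x)"

definition N_ker :: "(int \<Rightarrow> (complex, 'v) module) \<Rightarrow> (int \<Rightarrow> 'v \<Rightarrow> 'v) \<Rightarrow> nat \<Rightarrow> int \<Rightarrow> 'v set" where
  "N_ker C b i n = {x \<in> carrier (C n). bpow b i n x = \<zero>\<^bsub>C (n - int i)\<^esub>}"

definition N_im :: "(int \<Rightarrow> (complex, 'v) module) \<Rightarrow> (int \<Rightarrow> 'v \<Rightarrow> 'v) \<Rightarrow> nat \<Rightarrow> int \<Rightarrow> 'v set" where
  "N_im C b j n = bpow b j (n + int j) ` carrier (C (n + int j))"

definition N_homology_part ::
  "(int \<Rightarrow> (complex, 'v) module) \<Rightarrow> (int \<Rightarrow> 'v \<Rightarrow> 'v) \<Rightarrow> nat \<Rightarrow> nat \<Rightarrow> int \<Rightarrow> (complex, 'v set) module" where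
  "N_homology_part C b N i n =
     quot_space ((C n)\<lparr>carrier := N_ker C b i n\<rparr>) (N_im C b (N - i) n)"

definition N_homology ::
  "(int \<Rightarrow> (complex, 'v) module) \<Rightarrow> (int \<Rightarrow> 'v \<Rightarrow> 'v) \<Rightarrow> nat \<Rightarrow> int \<Rightarrow> (complex, nat \<Rightarrow> 'v set) module" where
  "N_homology C b N n = direct_sum {1..N - 1} (\<lambda>i. N_homology_part C b N i n)"

text \<open>The map on homology in degree \<open>n\<close> induced by a chain map with component \<open>f\<close> in degree \<open>n\<close>.\<close>

definition N_homology_map ::
  "(int \<Rightarrow> (complex, 'v) module) \<Rightarrow> (int \<Rightarrow> 'v \<Rightarrow> 'v) \<Rightarrow> nat \<Rightarrow> int \<Rightarrow> ('v \<Rightarrow> 'v) \<Rightarrow>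
     (nat \<Rightarrow> 'v set) \<Rightarrow> nat \<Rightarrow> 'v set" where
  "N_homology_map C b N n f z =
     (\<lambda>i\<in>{1..N - 1}. quot_lift (\<lambda>x. N_im C b (N - i) n +>\<^bsub>C n\<^esub> f x) (z i))"


section \<open>The \<open>q\<close>-Hochschild homology of order \<open>Y\<close>\<close>

definition primitive_root_of_unity :: "nat \<Rightarrow> complex \<Rightarrow> bool" where
  "primitive_root_of_unity N q \<longleftrightarrow> 0 < N \<and> q ^ N = 1 \<and> (\<forall>j. 0 < j \<and> j < N \<longrightarrow> q ^ j \<noteq> 1)"

type_synonym ('a, 'y) LY_elem = "(nat \<times> (nat \<Rightarrow> 'y) \<Rightarrow> ('a list \<Rightarrow>\<^sub>0 complex) set) set"

type_synonym ('a, 'y) qHH_elem = "nat \<Rightarrow> nat \<Rightarrow> ('a, 'y) LY_elem set"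

definition LY ::
  "(complex \<Rightarrow> 'a::{comm_ring, comm_monoid_mult} \<Rightarrow> 'a) \<Rightarrow> 'y simplicial_pset \<Rightarrow> int \<Rightarrow>
     (complex, ('a, 'y) LY_elem) module" where
  "LY scale Y n =
     (if n < 0 then zero_space
      else ext_space (L_obj scale) (L_map scale) (cells Y (nat n)) (basept Y (nat n)))"

definition LY_face ::
  "(complex \<Rightarrow> 'a::{comm_ring, comm_monoid_mult} \<Rightarrow> 'a) \<Rightarrow> 'y simplicial_pset \<Rightarrow> nat \<Rightarrow> nat \<Rightarrow>
     ('a, 'y) LY_elem \<Rightarrow> ('a, 'y) LY_elem" where
  "LY_face scale Y n i = ext_map (L_obj scale) (L_map scale)
     (cells Y n) (basept Y n) (cells Y (n - 1)) (basept Y (n - 1)) (opmap Y (n - 1) n (coface n i))"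

definition qb ::
  "(complex \<Rightarrow> 'a::{comm_ring, comm_monoid_mult} \<Rightarrow> 'a) \<Rightarrow> 'y simplicial_pset \<Rightarrow> complex \<Rightarrow> int \<Rightarrow>
     ('a, 'y) LY_elem \<Rightarrow> ('a, 'y) LY_elem" where
  "qb scale Y q n x =
     (if n \<le> 0 then \<zero>\<^bsub>LY scale Y (n - 1)\<^esub>
      else (\<Oplus>\<^bsub>LY scale Y (n - 1)\<^esub>i\<in>{0..nat n}.
              q ^ i \<odot>\<^bsub>LY scale Y (n - 1)\<^esub> LY_face scale Y (nat n) i x))"

definition qHH ::
  "(complex \<Rightarrow> 'a::{comm_ring, comm_monoid_mult} \<Rightarrow> 'a) \<Rightarrow> 'y simplicial_pset \<Rightarrow> nat \<Rightarrow> complex \<Rightarrow> nat \<Rightarrow>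
     (complex, nat \<Rightarrow> ('a, 'y) LY_elem set) module" where
  "qHH scale Y N q n = N_homology (LY scale Y) (qb scale Y q) N (int n)"

definition qHH_total ::
  "(complex \<Rightarrow> 'a::{comm_ring, comm_monoid_mult} \<Rightarrow> 'a) \<Rightarrow> 'y simplicial_pset \<Rightarrow> nat \<Rightarrow> complex \<Rightarrow>
     (complex, ('a, 'y) qHH_elem) module" where
  "qHH_total scale Y N q = direct_sum UNIV (qHH scale Y N q)"

text \<open>The endomorphism of the total homology induced by an endomorphism \<open>\<alpha>\<close> of \<open>\<L>(A) : \<Gamma> \<rightarrow> Vect\<close>.\<close>

definition qHH_endo ::
  "(complex \<Rightarrow> 'a::{comm_ring, comm_monoid_mult} \<Rightarrow> 'a) \<Rightarrow> 'y simplicial_pset \<Rightarrow> nat \<Rightarrow> complex \<Rightarrow>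
     (nat \<Rightarrow> ('a list \<Rightarrow>\<^sub>0 complex) set \<Rightarrow> ('a list \<Rightarrow>\<^sub>0 complex) set) \<Rightarrow>
     ('a, 'y) qHH_elem \<Rightarrow> ('a, 'y) qHH_elem" where
  "qHH_endo scale Y N q \<alpha> z =
     (\<lambda>n. N_homology_map (LY scale Y) (qb scale Y q) N (int n)
        (ext_endo (L_obj scale) (L_map scale) (cells Y n) (basept Y n) \<alpha>) (z n))"

definition der_act ::
  "(complex \<Rightarrow> 'a::{comm_ring, comm_monoid_mult} \<Rightarrow> 'a) \<Rightarrow> 'y simplicial_pset \<Rightarrow> nat \<Rightarrow> complex \<Rightarrow>
     ('a \<Rightarrow> 'a) \<Rightarrow> ('a, 'y) qHH_elem \<Rightarrow> ('a, 'y) qHH_elem" where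
  "der_act scale Y N q d = qHH_endo scale Y N q (L_der scale d)"

definition U_act ::
  "(complex \<Rightarrow> 'a::{comm_ring, comm_monoid_mult} \<Rightarrow> 'a) \<Rightarrow> 'y simplicial_pset \<Rightarrow> nat \<Rightarrow> complex \<Rightarrow>
     (('a \<Rightarrow> 'a) list \<Rightarrow>\<^sub>0 complex) set \<Rightarrow> ('a, 'y) qHH_elem \<Rightarrow> ('a, 'y) qHH_elem" where
  "U_act scale Y N q = uea_action (qHH_total scale Y N q) (der_act scale Y N q)"

definition hder_act ::
  "(complex \<Rightarrow> 'a::{comm_ring, comm_monoid_mult} \<Rightarrow> 'a) \<Rightarrow> 'y simplicial_pset \<Rightarrow> nat \<Rightarrow> complex \<Rightarrow>
     (nat \<Rightarrow> 'a \<Rightarrow> 'a) \<Rightarrow> nat \<Rightarrow> ('a, 'y) qHH_elem \<Rightarrow> ('a, 'y) qHH_elem" where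
  "hder_act scale Y N q D k = qHH_endo scale Y N q (L_hder scale D k)"

end

theory Submission
  imports Defs
begin

text \<open>
  Both families of operators on homology are determined by the same recursion. Let \<open>d\<^sub>r\<close> be the
  derivations attached to the normalized higher derivation \<open>D\<close> by Mirzavaziri's formula. Since
  \<open>1 / (r\<^sub>1 + \<dots> + r\<^sub>i)\<close> is the first factor of the coefficient of \<open>d\<^bsub>r\<^sub>1\<^esub> \<cdots> d\<^bsub>r\<^sub>i\<^esub>\<close>, splitting off
  the first letter of every word turns the formula into \<open>k D\<^sub>k = \<Sum>\<^sub>r d\<^sub>r D\<^sub>k\<^sub>-\<^sub>r\<close> (\<open>1 \<le> r \<le> k\<close>). This
  holds in the enveloping algebra (\<open>mirz_word_rec\<close>), and after letting the algebra act it holds for the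
  action of \<open>D\<^sub>k\<close> (\<open>act_mirz_word_rec\<close>). Read on \<open>A\<close> itself (\<open>mirz_sum_rec\<close>, \<open>log_der_rec\<close>), it can be
  solved for \<open>d\<^sub>k\<close>, and the solutions are derivations by induction (\<open>derivation_log_der\<close>); this is the
  existence part of Mirzavaziri's theorem, without which the sequence selected in the definition of
  \<open>hder_elem\<close> would be arbitrary.

  On the other side, the operators \<open>L\<^sub>D\<^sup>k\<close> on \<open>A\<^sup>\<otimes>\<^sup>n\<^sup>+\<^sup>1\<close> satisfy \<open>k L\<^sub>D\<^sup>k = \<Sum>\<^sub>r L\<^bsub>d\<^sub>r\<^esub> L\<^sub>D\<^sup>k\<^sup>-\<^sup>r\<close>
  (\<open>tens_hder_words_rec\<close>, \<open>L_hder_rec\<close>): a summand \<open>D\<^bsub>p\<^sub>0\<^esub>(a\<^sub>0) \<otimes> \<cdots> \<otimes> D\<^bsub>p\<^sub>n\<^esub>(a\<^sub>n)\<close> is multiplied by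
  \<open>k = p\<^sub>0 + \<dots> + p\<^sub>n\<close>, and each \<open>p\<^sub>i D\<^bsub>p\<^sub>i\<^esub>(a\<^sub>i)\<close> is expanded by the recursion on \<open>A\<close>. By induction \<open>L\<^sub>D\<^sup>k\<close>
  is a linear combination of composites of operators \<open>L\<^sub>d\<close>, so its linearity and its naturality over
  \<open>\<Gamma>\<close> follow from those of the \<open>L\<^sub>d\<close>.

  The passage from endomorphisms of \<open>\<L>(A)\<close> to operators on homology preserves identities of the
  form \<open>\<alpha> = \<Sum>\<^sub>s c\<^sub>s \<beta>\<^sub>s \<gamma>\<^sub>s\<close> (\<open>\<Phi>_lincomb\<close>). It transports the recursion for \<open>L\<^sub>D\<^sup>k\<close>, and also the relations
  showing that the \<open>L\<^sub>d\<close> represent the Lie algebra of derivations, so that the enveloping algebra acts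
  (\<open>act_ideal\<close>, \<open>uea_action_coset\<close>). As both sides are the identity for \<open>k = 0\<close>, induction on \<open>k\<close>
  gives their equality.

  A large part of the text establishes that the vector spaces and maps involved, which are built
  from cosets, finitely supported functions and representatives, are vector spaces and linear maps
  with the expected universal properties.
\<close>

section \<open>Linear maps of complex vector spaces\<close>

lemma CC_simps [simp]:
  "carrier CC = UNIV" "mult CC = (*)" "one CC = 1" "zero CC = 0" "add CC = (+)"
  by (simp_all add: CC_def)

lemma CC_cring: "cring CC"
proof (rule cringI)
  show "abelian_group CC"
    by (rule abelian_groupI) (auto intro: exI[of _ "- x" for x] ab_left_minus)
  show "Group.comm_monoid CC"
    by (rule comm_monoidI) auto
qed (auto simp: algebra_simps)

lemma CC_a_inv [simp]: "\<ominus>\<^bsub>CC\<^esub> x = - x"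
proof -
  interpret cring CC by (rule CC_cring)
  show ?thesis by (rule sum_zero_eq_neg[symmetric]) auto
qed

text \<open>
  Complex-linear maps between spaces given as records. Only the values on the carrier matter.
\<close>

definition lin_map :: "(complex, 'v) module \<Rightarrow> (complex, 'w) module \<Rightarrow> ('v \<Rightarrow> 'w) \<Rightarrow> bool" where
  "lin_map M M' f \<longleftrightarrow> f \<in> carrier M \<rightarrow> carrier M' \<and>
     (\<forall>x\<in>carrier M. \<forall>y\<in>carrier M. f (x \<oplus>\<^bsub>M\<^esub> y) = f x \<oplus>\<^bsub>M'\<^esub> f y) \<and>
     (\<forall>c. \<forall>x\<in>carrier M. f (c \<odot>\<^bsub>M\<^esub> x) = c \<odot>\<^bsub>M'\<^esub> f x)"

lemma lin_mapI:
  assumes "\<And>x. x \<in> carrier M \<Longrightarrow> f x \<in> carrier M'"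
    and "\<And>x y. x \<in> carrier M \<Longrightarrow> y \<in> carrier M \<Longrightarrow> f (x \<oplus>\<^bsub>M\<^esub> y) = f x \<oplus>\<^bsub>M'\<^esub> f y"
    and "\<And>c x. x \<in> carrier M \<Longrightarrow> f (c \<odot>\<^bsub>M\<^esub> x) = c \<odot>\<^bsub>M'\<^esub> f x"
  shows "lin_map M M' f"
  using assms by (auto simp: lin_map_def)

lemma lin_map_closed: "lin_map M M' f \<Longrightarrow> x \<in> carrier M \<Longrightarrow> f x \<in> carrier M'"
  by (auto simp: lin_map_def)

lemma lin_map_add:
  "lin_map M M' f \<Longrightarrow> x \<in> carrier M \<Longrightarrow> y \<in> carrier M \<Longrightarrow> f (x \<oplus>\<^bsub>M\<^esub> y) = f x \<oplus>\<^bsub>M'\<^esub> f y"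
  by (auto simp: lin_map_def)

lemma lin_map_smult: "lin_map M M' f \<Longrightarrow> x \<in> carrier M \<Longrightarrow> f (c \<odot>\<^bsub>M\<^esub> x) = c \<odot>\<^bsub>M'\<^esub> f x"
  by (auto simp: lin_map_def)

lemma lin_map_ident: "lin_map M M (\<lambda>x. x)"
  by (auto simp: lin_map_def)

lemma lin_map_comp: "lin_map M M' f \<Longrightarrow> lin_map M' M'' g \<Longrightarrow> lin_map M M'' (\<lambda>x. g (f x))"
  by (auto simp: lin_map_def Pi_iff)

lemma lin_map_cong:
  assumes "module CC M" "lin_map M M' f" "\<And>x. x \<in> carrier M \<Longrightarrow> f x = g x"
  shows "lin_map M M' g"
proof -
  interpret M: module CC M by fact
  show ?thesis using assms(2,3) by (auto simp: lin_map_def Pi_iff M.smult_closed)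
qed

lemma lin_map_zero:
  assumes "module CC M" "module CC M'" "lin_map M M' f"
  shows "f \<zero>\<^bsub>M\<^esub> = \<zero>\<^bsub>M'\<^esub>"
proof -
  interpret M: module CC M by fact
  interpret M': module CC M' by fact
  have "f \<zero>\<^bsub>M\<^esub> = f (0 \<odot>\<^bsub>M\<^esub> \<zero>\<^bsub>M\<^esub>)" using M.smult_l_null[of "\<zero>\<^bsub>M\<^esub>"] by simp
  also have "\<dots> = \<zero>\<^bsub>M'\<^esub>"
    using lin_map_smult[OF assms(3), of "\<zero>\<^bsub>M\<^esub>" 0] M'.smult_l_null lin_map_closed[OF assms(3)] by simp
  finally show ?thesis .
qed

lemma module_minus_eq_smult:
  assumes "module CC M" "x \<in> carrier M"
  shows "\<ominus>\<^bsub>M\<^esub> x = (-1) \<odot>\<^bsub>M\<^esub> x"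
proof -
  interpret M: module CC M by fact
  show ?thesis using M.smult_l_minus[of 1 x] assms(2) M.smult_one[of x] by simp
qed

lemma lin_map_minus:
  assumes "module CC M" "module CC M'" "lin_map M M' f" "x \<in> carrier M" "y \<in> carrier M"
  shows "f (x \<ominus>\<^bsub>M\<^esub> y) = f x \<ominus>\<^bsub>M'\<^esub> f y"
proof -
  interpret M: module CC M by fact
  interpret M': module CC M' by fact
  have "f (\<ominus>\<^bsub>M\<^esub> y) = \<ominus>\<^bsub>M'\<^esub> f y"
    using assms by (simp add: module_minus_eq_smult lin_map_smult lin_map_closed)
  then show ?thesis using assms by (simp add: a_minus_def lin_map_add)
qed

lemma lin_map_finsum:
  assumes "module CC M" "module CC M'" "lin_map M M' f" "finite I" "\<And>i. i \<in> I \<Longrightarrow> g i \<in> carrier M"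
  shows "f (\<Oplus>\<^bsub>M\<^esub>i\<in>I. g i) = (\<Oplus>\<^bsub>M'\<^esub>i\<in>I. f (g i))"
proof -
  interpret M: module CC M by fact
  interpret M': module CC M' by fact
  show ?thesis using assms(4,5)
  proof (induct I)
    case empty
    then show ?case by (simp add: lin_map_zero[OF assms(1-3)])
  next
    case (insert i I)
    then have "g \<in> I \<rightarrow> carrier M" "(\<lambda>i. f (g i)) \<in> I \<rightarrow> carrier M'"
      using lin_map_closed[OF assms(3)] by auto
    with insert show ?case
      by (simp add: M.finsum_insert M'.finsum_insert lin_map_add[OF assms(3)] M.finsum_closed
          lin_map_closed[OF assms(3)])
  qed
qed

lemma lin_map_lincomb:
  assumes "module CC M'" "finite I" "\<And>i. i \<in> I \<Longrightarrow> lin_map M M' (g i)"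
    and "module CC M"
  shows "lin_map M M' (\<lambda>x. \<Oplus>\<^bsub>M'\<^esub>i\<in>I. c i \<odot>\<^bsub>M'\<^esub> g i x)"
proof -
  interpret M: module CC M by fact
  interpret M': module CC M' by fact
  have cl: "c i \<odot>\<^bsub>M'\<^esub> g i x \<in> carrier M'" if "i \<in> I" "x \<in> carrier M" for i x
    using lin_map_closed[OF assms(3)[OF that(1)] that(2)] M'.smult_closed by simp
  show ?thesis
  proof (rule lin_mapI)
    fix x assume x: "x \<in> carrier M"
    then show "(\<Oplus>\<^bsub>M'\<^esub>i\<in>I. c i \<odot>\<^bsub>M'\<^esub> g i x) \<in> carrier M'" by (intro M'.finsum_closed) (auto simp: cl)
    fix y assume y: "y \<in> carrier M"
    have "(\<Oplus>\<^bsub>M'\<^esub>i\<in>I. c i \<odot>\<^bsub>M'\<^esub> g i (x \<oplus>\<^bsub>M\<^esub> y)) = (\<Oplus>\<^bsub>M'\<^esub>i\<in>I. c i \<odot>\<^bsub>M'\<^esub> g i x \<oplus>\<^bsub>M'\<^esub> c i \<odot>\<^bsub>M'\<^esub> g i y)"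
      using x y cl by (intro M'.finsum_cong')
        (auto simp: lin_map_add[OF assms(3)] M'.smult_r_distr lin_map_closed[OF assms(3)])
    also have "\<dots> = (\<Oplus>\<^bsub>M'\<^esub>i\<in>I. c i \<odot>\<^bsub>M'\<^esub> g i x) \<oplus>\<^bsub>M'\<^esub> (\<Oplus>\<^bsub>M'\<^esub>i\<in>I. c i \<odot>\<^bsub>M'\<^esub> g i y)"
      using x y cl by (intro M'.finsum_addf) auto
    finally show "(\<Oplus>\<^bsub>M'\<^esub>i\<in>I. c i \<odot>\<^bsub>M'\<^esub> g i (x \<oplus>\<^bsub>M\<^esub> y)) = \<dots>" .
  next
    fix a x assume x: "x \<in> carrier M"
    have "a \<odot>\<^bsub>M'\<^esub> (\<Oplus>\<^bsub>M'\<^esub>i\<in>I. c i \<odot>\<^bsub>M'\<^esub> g i x) = (\<Oplus>\<^bsub>M'\<^esub>i\<in>I. a \<odot>\<^bsub>M'\<^esub> (c i \<odot>\<^bsub>M'\<^esub> g i x))"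
      using x cl assms(2) by (intro M'.finsum_smult_ldistr) auto
    also have "\<dots> = (\<Oplus>\<^bsub>M'\<^esub>i\<in>I. c i \<odot>\<^bsub>M'\<^esub> g i (a \<odot>\<^bsub>M\<^esub> x))"
      using x M'.smult_assoc1[symmetric] M'.smult_closed
      by (intro M'.finsum_cong')
        (auto simp: lin_map_smult[OF assms(3)] lin_map_closed[OF assms(3)] mult.commute)
    finally show "(\<Oplus>\<^bsub>M'\<^esub>i\<in>I. c i \<odot>\<^bsub>M'\<^esub> g i (a \<odot>\<^bsub>M\<^esub> x)) = a \<odot>\<^bsub>M'\<^esub> (\<Oplus>\<^bsub>M'\<^esub>i\<in>I. c i \<odot>\<^bsub>M'\<^esub> g i x)" by simp
  qed
qed

lemma lin_map_const_zero:
  assumes "module CC M'"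
  shows "lin_map M M' (\<lambda>x. \<zero>\<^bsub>M'\<^esub>)"
proof -
  interpret M': module CC M' by fact
  show ?thesis by (rule lin_mapI) (auto simp: M'.smult_r_null)
qed

lemma module_finsum_smult:
  assumes "module CC M" "finite I" "\<And>i. i \<in> I \<Longrightarrow> g i \<in> carrier M"
  shows "c \<odot>\<^bsub>M\<^esub> (\<Oplus>\<^bsub>M\<^esub>i\<in>I. g i) = (\<Oplus>\<^bsub>M\<^esub>i\<in>I. c \<odot>\<^bsub>M\<^esub> g i)"
proof -
  interpret M: module CC M by fact
  show ?thesis using assms by (intro M.finsum_smult_ldistr) auto
qed

section \<open>Subspaces and spans\<close>

lemma submoduleD:
  assumes "module CC M" "submodule W CC M"
  shows "W \<subseteq> carrier M" "\<zero>\<^bsub>M\<^esub> \<in> W" "x \<in> W \<Longrightarrow> y \<in> W \<Longrightarrow> x \<oplus>\<^bsub>M\<^esub> y \<in> W" "x \<in> W \<Longrightarrow> c \<odot>\<^bsub>M\<^esub> x \<in> W"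
    "x \<in> W \<Longrightarrow> \<ominus>\<^bsub>M\<^esub> x \<in> W" "x \<in> W \<Longrightarrow> y \<in> W \<Longrightarrow> x \<ominus>\<^bsub>M\<^esub> y \<in> W" "abelian_subgroup W M"
proof -
  interpret M: module CC M by fact
  interpret W: subgroup W "add_monoid M" using assms(2) by (rule submodule.axioms)
  show "W \<subseteq> carrier M" "x \<in> W \<Longrightarrow> y \<in> W \<Longrightarrow> x \<oplus>\<^bsub>M\<^esub> y \<in> W" "x \<in> W \<Longrightarrow> c \<odot>\<^bsub>M\<^esub> x \<in> W" "x \<in> W \<Longrightarrow> \<ominus>\<^bsub>M\<^esub> x \<in> W"
    using M.submoduleE[OF assms(2)] by auto
  then show "x \<in> W \<Longrightarrow> y \<in> W \<Longrightarrow> x \<ominus>\<^bsub>M\<^esub> y \<in> W"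
    using M.submoduleE[OF assms(2)] by (auto simp: a_minus_def)
  show "\<zero>\<^bsub>M\<^esub> \<in> W" using W.one_closed by simp
  show "abelian_subgroup W M"
    by (rule abelian_subgroupI3) (auto simp: additive_subgroup_def W.subgroup_axioms M.abelian_group_axioms)
qed

lemma submoduleI':
  assumes "module CC M" "W \<subseteq> carrier M" "\<zero>\<^bsub>M\<^esub> \<in> W" "\<And>x y. x \<in> W \<Longrightarrow> y \<in> W \<Longrightarrow> x \<oplus>\<^bsub>M\<^esub> y \<in> W"
    "\<And>c x. x \<in> W \<Longrightarrow> c \<odot>\<^bsub>M\<^esub> x \<in> W"
  shows "submodule W CC M"
proof -
  interpret M: module CC M by fact
  show ?thesis using assms by (intro M.submoduleI) (auto simp: module_minus_eq_smult subset_iff)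
qed

lemma submodule_kernel:
  assumes "module CC M" "module CC M'" "lin_map M M' f"
  shows "submodule {x \<in> carrier M. f x = \<zero>\<^bsub>M'\<^esub>} CC M"
proof -
  interpret M: module CC M by fact
  interpret M': module CC M' by fact
  show ?thesis using assms
    by (intro submoduleI') (auto simp: lin_map_add lin_map_smult lin_map_zero M'.smult_r_null)
qed

lemma submodule_vimage:
  assumes "module CC M" "module CC M'" "lin_map M M' f" "submodule T CC M'"
  shows "submodule {x \<in> carrier M. f x \<in> T} CC M"
proof -
  interpret M: module CC M by fact
  show ?thesis using submoduleD[OF assms(2,4)] assms
    by (intro submoduleI') (auto simp: lin_map_add lin_map_smult lin_map_zero)
qed

lemma submodule_image:
  assumes "module CC M" "module CC M'" "lin_map M M' f"
  shows "submodule (f ` carrier M) CC M'"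
proof -
  interpret M: module CC M by fact
  interpret M': module CC M' by fact
  show ?thesis
  proof (rule submoduleI')
    show "\<zero>\<^bsub>M'\<^esub> \<in> f ` carrier M" using lin_map_zero[OF assms] by force
    show "x \<oplus>\<^bsub>M'\<^esub> y \<in> f ` carrier M" if "x \<in> f ` carrier M" "y \<in> f ` carrier M" for x y
      using that lin_map_add[OF assms(3), symmetric] by auto
    show "c \<odot>\<^bsub>M'\<^esub> x \<in> f ` carrier M" if "x \<in> f ` carrier M" for c x
      using that lin_map_smult[OF assms(3), symmetric] M.smult_closed by auto
  qed (use assms lin_map_closed in auto)
qed

lemma submodule_equalizer:
  assumes "module CC M" "module CC M'" "lin_map M M' f" "lin_map M M' g"
  shows "submodule {x \<in> carrier M. f x = g x} CC M"
proof -
  interpret M: module CC M by fact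
  interpret M': module CC M' by fact
  show ?thesis using assms
    by (intro submoduleI') (auto simp: lin_map_add lin_map_smult lin_map_zero)
qed

lemma submodule_carrier: "module CC M \<Longrightarrow> submodule (carrier M) CC M"
  by (rule module.carrier_is_submodule)

lemma lin_span_incl: "S \<subseteq> lin_span M S"
  by (auto simp: lin_span_def)

lemma lin_span_least: "submodule W CC M \<Longrightarrow> S \<subseteq> W \<Longrightarrow> lin_span M S \<subseteq> W"
  by (auto simp: lin_span_def)

lemma submodule_lin_span:
  assumes "module CC M" "S \<subseteq> carrier M"
  shows "submodule (lin_span M S) CC M"
proof -
  interpret M: module CC M by fact
  have "submodule (carrier M) CC M" by (rule submodule_carrier) fact
  then have "lin_span M S \<subseteq> carrier M" by (rule lin_span_least) fact
  moreover have "\<zero>\<^bsub>M\<^esub> \<in> lin_span M S"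
    unfolding lin_span_def by (blast intro: submoduleD(2)[OF assms(1)])
  moreover have "x \<oplus>\<^bsub>M\<^esub> y \<in> lin_span M S" if "x \<in> lin_span M S" "y \<in> lin_span M S" for x y
    using that unfolding lin_span_def by (blast intro: submoduleD(3)[OF assms(1)])
  moreover have "c \<odot>\<^bsub>M\<^esub> x \<in> lin_span M S" if "x \<in> lin_span M S" for c x
    using that unfolding lin_span_def by (blast intro: submoduleD(4)[OF assms(1)])
  ultimately show ?thesis by (intro submoduleI'[OF assms(1)])
qed

text \<open>
  The uniqueness principle behind all identities between linear maps below: they are checked on a
  spanning set.
\<close>

lemma lin_map_eq_on_span:
  assumes "module CC M" "module CC M'" "lin_map M M' f" "lin_map M M' g"
    and "carrier M \<subseteq> lin_span M S" "\<And>s. s \<in> S \<Longrightarrow> s \<in> carrier M \<and> f s = g s" and x: "x \<in> carrier M"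
  shows "f x = g x"
  using lin_span_least[OF submodule_equalizer[OF assms(1-4)], of S] assms(5-7) by auto

section \<open>Quotients\<close>

lemma coset_eqI:
  assumes "module CC M" "submodule W CC M" "x \<in> carrier M" "y \<in> carrier M" "x \<ominus>\<^bsub>M\<^esub> y \<in> W"
  shows "W +>\<^bsub>M\<^esub> x = W +>\<^bsub>M\<^esub> y"
proof -
  interpret M: module CC M by fact
  interpret W: abelian_subgroup W M using assms(1,2) by (rule submoduleD)
  have "x = (x \<ominus>\<^bsub>M\<^esub> y) \<oplus>\<^bsub>M\<^esub> y" using assms by (simp add: a_minus_def M.a_assoc M.l_neg)
  then have "x \<in> W +>\<^bsub>M\<^esub> y" using assms(5) by (force simp: a_r_coset_def')
  then show ?thesis using M.a_repr_independence[of x W y] assms(4) W.a_subgroup by simp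
qed

lemma coset_memE:
  assumes "X = W +>\<^bsub>M\<^esub> x" "y \<in> X"
  obtains w where "w \<in> W" "y = w \<oplus>\<^bsub>M\<^esub> x"
  using assms by (auto simp: a_r_coset_def')

lemma coset_self:
  assumes "module CC M" "submodule W CC M" "x \<in> carrier M"
  shows "x \<in> W +>\<^bsub>M\<^esub> x"
  using abelian_subgroup.a_rcos_self[OF submoduleD(7)[OF assms(1,2)] assms(3)] .

lemma coset_add:
  assumes "module CC M" "submodule W CC M" "x \<in> carrier M" "y \<in> carrier M"
  shows "set_add M (W +>\<^bsub>M\<^esub> x) (W +>\<^bsub>M\<^esub> y) = W +>\<^bsub>M\<^esub> (x \<oplus>\<^bsub>M\<^esub> y)"
  using abelian_subgroup.a_rcos_sum[OF submoduleD(7)[OF assms(1,2)] assms(3,4)] .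

lemma coset_smult:
  assumes "module CC M" "submodule W CC M" "x \<in> carrier M"
  shows "(\<Union>y\<in>W +>\<^bsub>M\<^esub> x. W +>\<^bsub>M\<^esub> (c \<odot>\<^bsub>M\<^esub> y)) = W +>\<^bsub>M\<^esub> (c \<odot>\<^bsub>M\<^esub> x)"
proof -
  interpret M: module CC M by fact
  note W = submoduleD[OF assms(1,2)]
  have "W +>\<^bsub>M\<^esub> (c \<odot>\<^bsub>M\<^esub> y) = W +>\<^bsub>M\<^esub> (c \<odot>\<^bsub>M\<^esub> x)" if y: "y \<in> W +>\<^bsub>M\<^esub> x" for y
  proof -
    obtain w where w: "w \<in> W" "y = w \<oplus>\<^bsub>M\<^esub> x" using coset_memE[OF refl y] .
    have wc: "w \<in> carrier M" using W(1) w by auto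
    have "c \<odot>\<^bsub>M\<^esub> y \<ominus>\<^bsub>M\<^esub> c \<odot>\<^bsub>M\<^esub> x = c \<odot>\<^bsub>M\<^esub> w"
      using w wc assms(3) by (simp add: M.smult_r_distr a_minus_def M.a_assoc M.r_neg)
    then show ?thesis
      using w wc assms W(4)[of w c] by (intro coset_eqI) auto
  qed
  then show ?thesis using coset_self[OF assms] by blast
qed

text \<open>
  The numerator \<open>K\<close> need not contain the denominator \<open>W\<close>: the cosets \<open>W + x\<close> with \<open>x \<in> K\<close> are the
  subspace \<open>(K + W) / W\<close> of \<open>M / W\<close>.
\<close>

lemma quot_sub_simps:
  "carrier (quot_space (M\<lparr>carrier := K\<rparr>) W) = (\<lambda>x. W +>\<^bsub>M\<^esub> x) ` K"
  "add (quot_space (M\<lparr>carrier := K\<rparr>) W) = set_add M"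
  "zero (quot_space (M\<lparr>carrier := K\<rparr>) W) = W"
  "smult (quot_space (M\<lparr>carrier := K\<rparr>) W) c X = (\<Union>y\<in>X. W +>\<^bsub>M\<^esub> (c \<odot>\<^bsub>M\<^esub> y))"
  by (auto simp: quot_space_def A_RCOSETS_def RCOSETS_def a_r_coset_def r_coset_def set_add_def
      set_mult_def fun_eq_iff)

lemma module_quot_sub:
  assumes "module CC M" "submodule K CC M" "submodule W CC M"
  shows "module CC (quot_space (M\<lparr>carrier := K\<rparr>) W)"
    and "lin_map (M\<lparr>carrier := K\<rparr>) (quot_space (M\<lparr>carrier := K\<rparr>) W) (\<lambda>x. W +>\<^bsub>M\<^esub> x)"
proof -
  interpret M: module CC M by fact
  note K = submoduleD[OF assms(1,2)] and W = submoduleD[OF assms(1,3)]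
  have Kc: "x \<in> carrier M" if "x \<in> K" for x using K(1) that by auto
  define Q where "Q = quot_space (M\<lparr>carrier := K\<rparr>) W"
  have car: "carrier Q = (\<lambda>x. W +>\<^bsub>M\<^esub> x) ` K" by (simp add: Q_def quot_sub_simps)
  have ze: "\<zero>\<^bsub>Q\<^esub> = W +>\<^bsub>M\<^esub> \<zero>\<^bsub>M\<^esub>" using W(1) by (simp add: Q_def quot_sub_simps)
  have ad: "(W +>\<^bsub>M\<^esub> x) \<oplus>\<^bsub>Q\<^esub> (W +>\<^bsub>M\<^esub> y) = W +>\<^bsub>M\<^esub> (x \<oplus>\<^bsub>M\<^esub> y)" if "x \<in> K" "y \<in> K" for x y
    using that Kc coset_add[OF assms(1,3)] by (simp add: Q_def quot_sub_simps)
  have sm: "c \<odot>\<^bsub>Q\<^esub> (W +>\<^bsub>M\<^esub> x) = W +>\<^bsub>M\<^esub> (c \<odot>\<^bsub>M\<^esub> x)" if "x \<in> K" for c x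
    using that Kc coset_smult[OF assms(1,3)] by (simp add: Q_def quot_sub_simps del: UN_simps)
  have "abelian_group Q"
  proof (rule abelian_groupI)
    show "\<zero>\<^bsub>Q\<^esub> \<in> carrier Q" using K(2) by (simp add: car ze)
    show "\<exists>Y\<in>carrier Q. Y \<oplus>\<^bsub>Q\<^esub> X = \<zero>\<^bsub>Q\<^esub>" if X: "X \<in> carrier Q" for X
    proof -
      obtain x where x: "x \<in> K" "X = W +>\<^bsub>M\<^esub> x" using X by (auto simp: car)
      then show ?thesis using Kc[of x] K(5)[of x]
        by (intro bexI[of _ "W +>\<^bsub>M\<^esub> (\<ominus>\<^bsub>M\<^esub> x)"]) (simp_all add: car ad ze M.l_neg)
    qed
  qed (auto simp: car ad ze K(2,3) Kc M.a_ac)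
  then show "module CC (quot_space (M\<lparr>carrier := K\<rparr>) W)" unfolding Q_def[symmetric]
    by (intro moduleI) (auto simp: CC_cring car ad sm K(3,4) Kc M.smult_l_distr[simplified]
        M.smult_r_distr[simplified] M.smult_assoc1[simplified] M.smult_one[simplified])
  show "lin_map (M\<lparr>carrier := K\<rparr>) (quot_space (M\<lparr>carrier := K\<rparr>) W) (\<lambda>x. W +>\<^bsub>M\<^esub> x)"
    unfolding Q_def[symmetric] by (rule lin_mapI) (auto simp: car ad sm)
qed

lemma quot_simps:
  "carrier (quot_space M W) = (\<lambda>x. W +>\<^bsub>M\<^esub> x) ` carrier M"
  "zero (quot_space M W) = W"
  using quot_sub_simps[where M = M and K = "carrier M" and W = W] by simp_all

lemma module_quot:
  assumes "module CC M" "submodule W CC M"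
  shows "module CC (quot_space M W)"
    and "lin_map M (quot_space M W) (\<lambda>x. W +>\<^bsub>M\<^esub> x)"
  using module_quot_sub[OF assms(1) submodule_carrier[OF assms(1)] assms(2)] by simp_all

text \<open>
  A linear map that vanishes on \<open>W\<close> is constant on the cosets of \<open>W\<close>, so that \<open>quot_lift\<close> really
  evaluates it on a representative.
\<close>

lemma quot_lift_coset:
  assumes "module CC M" "module CC M'" "submodule W CC M" "lin_map M M' f" "\<And>w. w \<in> W \<Longrightarrow> f w = \<zero>\<^bsub>M'\<^esub>"
    and x: "x \<in> carrier M"
  shows "quot_lift f (W +>\<^bsub>M\<^esub> x) = f x"
proof -
  interpret M': module CC M' by fact
  note W = submoduleD[OF assms(1,3)]
  have "f y = f x" if y: "y \<in> W +>\<^bsub>M\<^esub> x" for y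
  proof -
    obtain w where w: "w \<in> W" "y = w \<oplus>\<^bsub>M\<^esub> x" using coset_memE[OF refl y] .
    then have "f y = f w \<oplus>\<^bsub>M'\<^esub> f x" using lin_map_add[OF assms(4), of w x] W(1) x by blast
    then show ?thesis using assms(5)[OF w(1)] lin_map_closed[OF assms(4) x] by simp
  qed
  then have "f ` (W +>\<^bsub>M\<^esub> x) = {f x}" using coset_self[OF assms(1,3) x] by blast
  then show ?thesis by (simp add: quot_lift_def)
qed

lemma lin_map_quot_lift:
  assumes "module CC M" "module CC M'" "submodule W CC M" "lin_map M M' f" "\<And>w. w \<in> W \<Longrightarrow> f w = \<zero>\<^bsub>M'\<^esub>"
  shows "lin_map (quot_space M W) M' (quot_lift f)"
proof -
  interpret M: module CC M by fact
  note co = module_quot(2)[OF assms(1,3)]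
  note ql = quot_lift_coset[OF assms]
  show ?thesis
  proof (rule lin_mapI)
    fix X assume "X \<in> carrier (quot_space M W)"
    then obtain x where x: "x \<in> carrier M" "X = W +>\<^bsub>M\<^esub> x" by (auto simp: quot_simps)
    then show "quot_lift f X \<in> carrier M'" using lin_map_closed[OF assms(4)] by (simp add: ql)
    show "quot_lift f (c \<odot>\<^bsub>quot_space M W\<^esub> X) = c \<odot>\<^bsub>M'\<^esub> quot_lift f X" for c
      unfolding x(2) lin_map_smult[OF co x(1), symmetric] using x(1)
      by (simp add: ql lin_map_smult[OF assms(4)] M.smult_closed)
    fix Y assume "Y \<in> carrier (quot_space M W)"
    then obtain y where y: "y \<in> carrier M" "Y = W +>\<^bsub>M\<^esub> y" by (auto simp: quot_simps)
    show "quot_lift f (X \<oplus>\<^bsub>quot_space M W\<^esub> Y) = quot_lift f X \<oplus>\<^bsub>M'\<^esub> quot_lift f Y"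
      unfolding x(2) y(2) lin_map_add[OF co x(1) y(1), symmetric] using x(1) y(1)
      by (simp add: ql lin_map_add[OF assms(4)])
  qed
qed

lemma vanish_on_span:
  assumes "module CC M" "module CC M'" "lin_map M M' f" "\<And>s. s \<in> S \<Longrightarrow> s \<in> carrier M \<and> f s = \<zero>\<^bsub>M'\<^esub>"
    "w \<in> lin_span M S"
  shows "f w = \<zero>\<^bsub>M'\<^esub>"
  using lin_span_least[OF submodule_kernel[OF assms(1-3)], of S] assms(4,5) by auto

lemma span_quot:
  assumes "module CC M" "submodule W CC M" "carrier M \<subseteq> lin_span M S" "S \<subseteq> carrier M"
  shows "carrier (quot_space M W) \<subseteq> lin_span (quot_space M W) ((\<lambda>x. W +>\<^bsub>M\<^esub> x) ` S)"
proof -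
  interpret M: module CC M by fact
  note Q = module_quot[OF assms(1,2)]
  let ?T = "lin_span (quot_space M W) ((\<lambda>x. W +>\<^bsub>M\<^esub> x) ` S)"
  have sub: "submodule ?T CC (quot_space M W)"
    using assms lin_map_closed[OF Q(2)] by (intro submodule_lin_span[OF Q(1)]) auto
  have "submodule {x \<in> carrier M. W +>\<^bsub>M\<^esub> x \<in> ?T} CC M"
    by (rule submodule_vimage[OF assms(1) Q sub])
  then have "lin_span M S \<subseteq> {x \<in> carrier M. W +>\<^bsub>M\<^esub> x \<in> ?T}"
    using assms lin_span_incl[of "(\<lambda>x. W +>\<^bsub>M\<^esub> x) ` S" "quot_space M W"]
    by (intro lin_span_least) auto
  then show ?thesis using assms(3) by (auto simp: quot_simps)
qed

section \<open>Free vector spaces and direct sums\<close>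

abbreviation "single \<equiv> Poly_Mapping.single"
abbreviation "keys \<equiv> Poly_Mapping.keys"
abbreviation "lookup \<equiv> Poly_Mapping.lookup"

lemma lookup_map_times [simp]:
  "lookup (Poly_Mapping.map ((*) c) f) x = c * (lookup f x :: complex)"
  by (simp add: Poly_Mapping.map.rep_eq when_def)

lemma map_times_single [simp]:
  "Poly_Mapping.map ((*) c) (single x (a :: complex)) = single x (c * a)"
  by (rule poly_mapping_eqI) (simp add: lookup_single when_def)

lemma free_space_simps [simp]:
  "carrier (free_space X) = {f. keys f \<subseteq> X}" "add (free_space X) = (+)"
  "zero (free_space X) = 0" "smult (free_space X) = (\<lambda>c. Poly_Mapping.map ((*) c))"
  by (simp_all add: free_space_def)

lemma keys_map_times: "keys (Poly_Mapping.map ((*) c) (f :: _ \<Rightarrow>\<^sub>0 complex)) \<subseteq> keys f"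
  by (auto simp: in_keys_iff)

lemma module_free_space: "module CC (free_space X)"
proof (rule moduleI)
  show "abelian_group (free_space X)"
  proof (rule abelian_groupI)
    show "\<exists>y\<in>carrier (free_space X). y \<oplus>\<^bsub>free_space X\<^esub> x = \<zero>\<^bsub>free_space X\<^esub>" if "x \<in> carrier (free_space X)" for x
      using that by (intro bexI[of _ "- x"]) (auto simp: in_keys_iff)
  qed (auto simp: add_ac dest!: subsetD[OF keys_add])
qed (use keys_map_times in \<open>force intro!: poly_mapping_eqI simp: CC_cring lookup_add algebra_simps\<close>)+

lemma free_space_minus:
  assumes "f \<in> carrier (free_space X)" "g \<in> carrier (free_space X)"
  shows "f \<ominus>\<^bsub>free_space X\<^esub> g = f - g"
proof -
  interpret M: module CC "free_space X" by (rule module_free_space)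
  have "- g \<in> carrier (free_space X)" using assms by (auto simp: in_keys_iff)
  then have "\<ominus>\<^bsub>free_space X\<^esub> g = - g"
    using assms M.minus_equality[of "- g" g] by simp
  then show ?thesis by (simp add: a_minus_def)
qed

lemma lin_map_sum:
  fixes h :: "'i \<Rightarrow> 'x \<Rightarrow>\<^sub>0 complex"
  assumes "module CC F" "add F = (+)" "zero F = 0" "module CC M" "lin_map F M f" "finite I"
    "\<And>i. i \<in> I \<Longrightarrow> h i \<in> carrier F"
  shows "f (\<Sum>i\<in>I. h i) = (\<Oplus>\<^bsub>M\<^esub>i\<in>I. f (h i))"
proof -
  interpret F: module CC F by fact
  have "(\<Oplus>\<^bsub>F\<^esub>i\<in>I. h i) = (\<Sum>i\<in>I. h i)" using assms(6,7)
  proof (induct I)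
    case (insert i I)
    then have "h \<in> I \<rightarrow> carrier F" by auto
    with insert show ?case by (simp add: F.finsum_insert assms(2))
  qed (simp add: F.finsum_empty assms(3))
  then show ?thesis using lin_map_finsum[OF assms(1,4-6), of h] assms(7) by simp
qed

lemma poly_mapping_eq_sum_single:
  "f = (\<Sum>x\<in>keys f. single x (lookup f x))"
  by (rule poly_mapping_eqI)
    (simp add: lookup_sum lookup_single when_def in_keys_iff sum.delta)

lemma span_free_space:
  "carrier (free_space X) \<subseteq> lin_span (free_space X) ((\<lambda>x. single x 1) ` X)"
proof
  fix f assume f: "f \<in> carrier (free_space X)"
  let ?T = "lin_span (free_space X) ((\<lambda>x. single x 1) ` X)"
  note M = module_free_space[of X]
  have T: "submodule ?T CC (free_space X)" by (rule submodule_lin_span[OF M]) auto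
  note T = submoduleD[OF M T]
  have s: "single x c \<in> ?T" if "x \<in> X" for x c
    using T(4)[of "single x 1" c] that
      lin_span_incl[of "(\<lambda>x. single x 1) ` X" "free_space X"] by auto
  have "(\<Sum>x\<in>S. single x (lookup f x)) \<in> ?T" if "finite S" "S \<subseteq> X" for S
    using that
  proof (induct S)
    case empty
    then show ?case using T(2) by simp
  next
    case (insert x S)
    then show ?case using T(3)[OF s[of x "lookup f x"], of "\<Sum>x\<in>S. single x (lookup f x)"]
      by simp
  qed
  then show "f \<in> ?T" using f by (subst poly_mapping_eq_sum_single) simp
qed

text \<open>
  The sum over the support may be taken over any finite set containing it; this reduces additivity
  in \<open>f\<close> to sums over a common index set.
\<close>

lemma free_lift_superset:
  assumes "module CC M" "finite S" "keys f \<subseteq> S" "g \<in> S \<rightarrow> carrier M"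
  shows "free_lift M g f = (\<Oplus>\<^bsub>M\<^esub>x\<in>S. lookup f x \<odot>\<^bsub>M\<^esub> g x)"
proof -
  interpret M: module CC M by fact
  show ?thesis unfolding free_lift_def
    using assms(2-4) M.smult_closed M.smult_l_null
    by (intro M.add.finprod_mono_neutral_cong_left) (auto simp: in_keys_iff)
qed

lemma free_lift_single:
  assumes "module CC M" "g x \<in> carrier M"
  shows "free_lift M g (single x c) = c \<odot>\<^bsub>M\<^esub> g x"
proof -
  interpret M: module CC M by fact
  show ?thesis
    using assms(2) M.smult_closed
    by (subst free_lift_superset[OF assms(1), of "{x}"]) (auto simp: M.finsum_insert)
qed

lemma lin_map_free_lift:
  assumes "module CC M" "g \<in> X \<rightarrow> carrier M"
  shows "lin_map (free_space X) M (free_lift M g)"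
proof -
  interpret M: module CC M by fact
  have cl: "c \<odot>\<^bsub>M\<^esub> g x \<in> carrier M" if "x \<in> X" for c x using that assms(2) M.smult_closed by auto
  note sup = free_lift_superset[OF assms(1)]
  show ?thesis
  proof (rule lin_mapI)
    fix f :: "'b \<Rightarrow>\<^sub>0 complex" assume f: "f \<in> carrier (free_space X)"
    then show "free_lift M g f \<in> carrier M"
      unfolding free_lift_def by (intro M.finsum_closed) (auto simp: cl)
    show "free_lift M g (c \<odot>\<^bsub>free_space X\<^esub> f) = c \<odot>\<^bsub>M\<^esub> free_lift M g f" for c
    proof -
      have "free_lift M g (c \<odot>\<^bsub>free_space X\<^esub> f) = (\<Oplus>\<^bsub>M\<^esub>x\<in>keys f. (c * lookup f x) \<odot>\<^bsub>M\<^esub> g x)"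
        using f assms(2) keys_map_times[of c f] by (subst sup[of "keys f"]) auto
      also have "\<dots> = (\<Oplus>\<^bsub>M\<^esub>x\<in>keys f. c \<odot>\<^bsub>M\<^esub> (lookup f x \<odot>\<^bsub>M\<^esub> g x))"
        using f assms(2) cl M.smult_closed
        by (intro M.finsum_cong') (auto simp: M.smult_assoc1[simplified] subset_iff Pi_iff)
      also have "\<dots> = c \<odot>\<^bsub>M\<^esub> free_lift M g f"
        unfolding free_lift_def using f cl by (intro module_finsum_smult[OF assms(1), symmetric]) auto
      finally show ?thesis .
    qed
    fix h :: "'b \<Rightarrow>\<^sub>0 complex" assume h: "h \<in> carrier (free_space X)"
    let ?S = "keys f \<union> keys h"
    have S: "?S \<subseteq> X" using f h by auto
    have gS: "g \<in> ?S \<rightarrow> carrier M" "\<And>x. x \<in> ?S \<Longrightarrow> g x \<in> carrier M" using S assms(2) by auto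
    have "free_lift M g (f + h) = (\<Oplus>\<^bsub>M\<^esub>x\<in>?S. lookup (f + h) x \<odot>\<^bsub>M\<^esub> g x)"
      by (rule sup) (use keys_add[of f h] gS in auto)
    also have "\<dots> = (\<Oplus>\<^bsub>M\<^esub>x\<in>?S. lookup f x \<odot>\<^bsub>M\<^esub> g x \<oplus>\<^bsub>M\<^esub> lookup h x \<odot>\<^bsub>M\<^esub> g x)"
      using gS(2) M.smult_closed by (intro M.finsum_cong') (auto simp: lookup_add M.smult_l_distr[simplified])
    also have "\<dots> = (\<Oplus>\<^bsub>M\<^esub>x\<in>?S. lookup f x \<odot>\<^bsub>M\<^esub> g x) \<oplus>\<^bsub>M\<^esub> (\<Oplus>\<^bsub>M\<^esub>x\<in>?S. lookup h x \<odot>\<^bsub>M\<^esub> g x)"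
      using gS(2) M.smult_closed by (intro M.finsum_addf) auto
    also have "\<dots> = free_lift M g f \<oplus>\<^bsub>M\<^esub> free_lift M g h"
      using gS by (simp add: sup[of ?S])
    finally show "free_lift M g (f \<oplus>\<^bsub>free_space X\<^esub> h) = free_lift M g f \<oplus>\<^bsub>M\<^esub> free_lift M g h" by simp
  qed
qed

lemma direct_sum_simps:
  "carrier (direct_sum I V) = {f \<in> \<Pi>\<^sub>E i\<in>I. carrier (V i). finite {i\<in>I. f i \<noteq> \<zero>\<^bsub>V i\<^esub>}}"
  "zero (direct_sum I V) = (\<lambda>i\<in>I. \<zero>\<^bsub>V i\<^esub>)"
  "add (direct_sum I V) f g = (\<lambda>i\<in>I. f i \<oplus>\<^bsub>V i\<^esub> g i)"
  "smult (direct_sum I V) c f = (\<lambda>i\<in>I. c \<odot>\<^bsub>V i\<^esub> f i)"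
  by (simp_all add: direct_sum_def)

context
  fixes I :: "'i set" and V :: "'i \<Rightarrow> (complex, 'v) module"
  assumes V: "\<And>i. i \<in> I \<Longrightarrow> module CC (V i)"
begin

abbreviation "DS \<equiv> direct_sum I V"

lemma component_ops:
  assumes "i \<in> I"
  shows "\<zero>\<^bsub>V i\<^esub> \<in> carrier (V i)"
    "x \<in> carrier (V i) \<Longrightarrow> y \<in> carrier (V i) \<Longrightarrow> x \<oplus>\<^bsub>V i\<^esub> y \<in> carrier (V i)"
    "x \<in> carrier (V i) \<Longrightarrow> c \<odot>\<^bsub>V i\<^esub> x \<in> carrier (V i)"
    "x \<in> carrier (V i) \<Longrightarrow> \<zero>\<^bsub>V i\<^esub> \<oplus>\<^bsub>V i\<^esub> x = x"
    "x \<in> carrier (V i) \<Longrightarrow> x \<oplus>\<^bsub>V i\<^esub> \<zero>\<^bsub>V i\<^esub> = x"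
    "c \<odot>\<^bsub>V i\<^esub> \<zero>\<^bsub>V i\<^esub> = \<zero>\<^bsub>V i\<^esub>"
proof -
  interpret M: module CC "V i" using V[OF assms] .
  show "\<zero>\<^bsub>V i\<^esub> \<in> carrier (V i)"
    "x \<in> carrier (V i) \<Longrightarrow> y \<in> carrier (V i) \<Longrightarrow> x \<oplus>\<^bsub>V i\<^esub> y \<in> carrier (V i)"
    "x \<in> carrier (V i) \<Longrightarrow> c \<odot>\<^bsub>V i\<^esub> x \<in> carrier (V i)"
    "x \<in> carrier (V i) \<Longrightarrow> \<zero>\<^bsub>V i\<^esub> \<oplus>\<^bsub>V i\<^esub> x = x"
    "x \<in> carrier (V i) \<Longrightarrow> x \<oplus>\<^bsub>V i\<^esub> \<zero>\<^bsub>V i\<^esub> = x"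
    "c \<odot>\<^bsub>V i\<^esub> \<zero>\<^bsub>V i\<^esub> = \<zero>\<^bsub>V i\<^esub>"
    using M.smult_r_null[of c] by (auto simp: M.smult_closed)
qed

lemma direct_sum_memD: "f \<in> carrier DS \<Longrightarrow> i \<in> I \<Longrightarrow> f i \<in> carrier (V i)"
  by (auto simp: direct_sum_simps)

lemma direct_sum_eqI:
  assumes "f \<in> carrier DS" "g \<in> carrier DS" "\<And>i. i \<in> I \<Longrightarrow> f i = g i"
  shows "f = g"
  using assms by (auto simp: direct_sum_simps intro: PiE_ext)

lemma direct_sum_closed:
  "\<zero>\<^bsub>DS\<^esub> \<in> carrier DS"
  "f \<in> carrier DS \<Longrightarrow> g \<in> carrier DS \<Longrightarrow> f \<oplus>\<^bsub>DS\<^esub> g \<in> carrier DS"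
  "f \<in> carrier DS \<Longrightarrow> c \<odot>\<^bsub>DS\<^esub> f \<in> carrier DS"
proof -
  show "\<zero>\<^bsub>DS\<^esub> \<in> carrier DS"
    by (auto simp: direct_sum_simps component_ops not_finite_existsD)
  show "f \<oplus>\<^bsub>DS\<^esub> g \<in> carrier DS"
    if "f \<in> carrier DS" "g \<in> carrier DS"
  proof -
    have "{i \<in> I. f i \<oplus>\<^bsub>V i\<^esub> g i \<noteq> \<zero>\<^bsub>V i\<^esub>} \<subseteq> {i\<in>I. f i \<noteq> \<zero>\<^bsub>V i\<^esub>} \<union> {i\<in>I. g i \<noteq> \<zero>\<^bsub>V i\<^esub>}"
      using component_ops by auto
    then have "finite {i \<in> I. f i \<oplus>\<^bsub>V i\<^esub> g i \<noteq> \<zero>\<^bsub>V i\<^esub>}"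
      using that by (auto simp: direct_sum_simps elim: finite_subset)
    moreover have "f i \<oplus>\<^bsub>V i\<^esub> g i \<in> carrier (V i)" if "i \<in> I" for i
      using component_ops(2)[OF that] direct_sum_memD[OF _ that] \<open>f \<in> _\<close> \<open>g \<in> _\<close> by blast
    ultimately show ?thesis by (auto simp: direct_sum_simps cong: conj_cong)
  qed
  show "c \<odot>\<^bsub>DS\<^esub> f \<in> carrier DS" if "f \<in> carrier DS"
  proof -
    have "{i \<in> I. c \<odot>\<^bsub>V i\<^esub> f i \<noteq> \<zero>\<^bsub>V i\<^esub>} \<subseteq> {i\<in>I. f i \<noteq> \<zero>\<^bsub>V i\<^esub>}" using component_ops by auto
    then have "finite {i \<in> I. c \<odot>\<^bsub>V i\<^esub> f i \<noteq> \<zero>\<^bsub>V i\<^esub>}"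
      using that by (auto simp: direct_sum_simps elim: finite_subset)
    moreover have "c \<odot>\<^bsub>V i\<^esub> f i \<in> carrier (V i)" if "i \<in> I" for i
      using component_ops(3)[OF that] direct_sum_memD[OF _ that] \<open>f \<in> _\<close> by blast
    ultimately show ?thesis by (auto simp: direct_sum_simps cong: conj_cong)
  qed
qed

lemma module_direct_sum: "module CC DS"
proof (rule moduleI)
  show "abelian_group DS"
  proof (rule abelian_groupI)
    fix f assume f: "f \<in> carrier DS"
    show "\<exists>g\<in>carrier DS. g \<oplus>\<^bsub>DS\<^esub> f = \<zero>\<^bsub>DS\<^esub>"
    proof (rule bexI[of _ "(-1) \<odot>\<^bsub>DS\<^esub> f"])
      have "(-1) \<odot>\<^bsub>V i\<^esub> f i \<oplus>\<^bsub>V i\<^esub> f i = \<zero>\<^bsub>V i\<^esub>" if "i \<in> I" for i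
      proof -
        interpret M: module CC "V i" using V[OF that] .
        show ?thesis using direct_sum_memD[OF f that] M.smult_l_distr[of "-1" 1 "f i"] M.smult_one M.smult_l_null
          by simp
      qed
      then show "(-1) \<odot>\<^bsub>DS\<^esub> f \<oplus>\<^bsub>DS\<^esub> f = \<zero>\<^bsub>DS\<^esub>"
        by (auto simp: direct_sum_simps)
    qed (rule direct_sum_closed(3)[OF f])
    show "\<zero>\<^bsub>DS\<^esub> \<oplus>\<^bsub>DS\<^esub> f = f"
      by (rule direct_sum_eqI[OF direct_sum_closed(2)[OF direct_sum_closed(1) f] f])
        (simp add: direct_sum_simps(2,3) component_ops direct_sum_memD[OF f])
    fix g assume g: "g \<in> carrier DS"
    show "f \<oplus>\<^bsub>DS\<^esub> g \<in> carrier DS" by (intro direct_sum_closed f g)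
    show "f \<oplus>\<^bsub>DS\<^esub> g = g \<oplus>\<^bsub>DS\<^esub> f"
      using V direct_sum_memD[OF f] direct_sum_memD[OF g]
      by (auto simp: direct_sum_simps(3) fun_eq_iff restrict_def module_def abelian_groupE(4))
    fix h assume h: "h \<in> carrier DS"
    show "f \<oplus>\<^bsub>DS\<^esub> g \<oplus>\<^bsub>DS\<^esub> h = f \<oplus>\<^bsub>DS\<^esub> (g \<oplus>\<^bsub>DS\<^esub> h)"
      using V direct_sum_memD[OF f] direct_sum_memD[OF g] direct_sum_memD[OF h]
      by (auto simp: direct_sum_simps(3) fun_eq_iff restrict_def module_def abelian_groupE(3))
  qed (rule direct_sum_closed)
  fix a b :: complex and f g
  assume f: "f \<in> carrier DS" and g: "g \<in> carrier DS"
  note mem = direct_sum_memD[OF f] direct_sum_memD[OF g]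
  show "(a \<oplus>\<^bsub>CC\<^esub> b) \<odot>\<^bsub>DS\<^esub> f = a \<odot>\<^bsub>DS\<^esub> f \<oplus>\<^bsub>DS\<^esub> b \<odot>\<^bsub>DS\<^esub> f"
    using V mem by (auto simp: direct_sum_simps(3,4) fun_eq_iff restrict_def module.smult_l_distr[where R = CC, simplified])
  show "a \<odot>\<^bsub>DS\<^esub> (f \<oplus>\<^bsub>DS\<^esub> g) = a \<odot>\<^bsub>DS\<^esub> f \<oplus>\<^bsub>DS\<^esub> a \<odot>\<^bsub>DS\<^esub> g"
    using V mem by (auto simp: direct_sum_simps(3,4) fun_eq_iff restrict_def module.smult_r_distr[where R = CC, simplified])
  show "(a \<otimes>\<^bsub>CC\<^esub> b) \<odot>\<^bsub>DS\<^esub> f = a \<odot>\<^bsub>DS\<^esub> (b \<odot>\<^bsub>DS\<^esub> f)"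
    using V mem by (auto simp: direct_sum_simps(4) fun_eq_iff restrict_def module.smult_assoc1[where R = CC, simplified])
  show "a \<odot>\<^bsub>DS\<^esub> f \<in> carrier DS" by (rule direct_sum_closed(3)[OF f])
  have "1 \<odot>\<^bsub>DS\<^esub> f = f"
    by (rule direct_sum_eqI[OF direct_sum_closed(3)[OF f] f])
      (use V mem in \<open>auto simp: direct_sum_simps(4) module.smult_one[where R = CC, simplified]\<close>)
  then show "\<one>\<^bsub>CC\<^esub> \<odot>\<^bsub>DS\<^esub> f = f" by simp
qed (rule CC_cring)

lemma lin_map_proj: "i \<in> I \<Longrightarrow> lin_map DS (V i) (\<lambda>f. f i)"
  by (rule lin_mapI) (auto simp: direct_sum_memD direct_sum_simps(3,4))

lemma lin_map_sum_incl:
  assumes "i \<in> I"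
  shows "lin_map (V i) DS (sum_incl I V i)"
proof (rule lin_mapI)
  fix x assume x: "x \<in> carrier (V i)"
  have "finite {j \<in> I. sum_incl I V i x j \<noteq> \<zero>\<^bsub>V j\<^esub>}"
    by (rule finite_subset[of _ "{i}"]) (auto simp: sum_incl_def)
  then show "sum_incl I V i x \<in> carrier DS"
    using x assms by (auto simp: direct_sum_simps sum_incl_def component_ops)
qed (auto simp: sum_incl_def direct_sum_simps(3,4) fun_eq_iff restrict_def component_ops)

lemma direct_sum_eq_finsum_incl:
  assumes f: "f \<in> carrier DS"
  shows "f = (\<Oplus>\<^bsub>DS\<^esub>i\<in>{i\<in>I. f i \<noteq> \<zero>\<^bsub>V i\<^esub>}. sum_incl I V i (f i))"
proof (rule direct_sum_eqI[OF f])
  interpret M: module CC "DS" by (rule module_direct_sum)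
  let ?S = "{i\<in>I. f i \<noteq> \<zero>\<^bsub>V i\<^esub>}"
  have fin: "finite ?S" using f by (simp add: direct_sum_simps)
  have cl: "sum_incl I V i (f i) \<in> carrier DS" if "i \<in> I" for i
    using lin_map_closed[OF lin_map_sum_incl[OF that]] direct_sum_memD[OF f that] .
  show "(\<Oplus>\<^bsub>DS\<^esub>i\<in>?S. sum_incl I V i (f i)) \<in> carrier DS"
    by (rule M.finsum_closed) (auto intro: cl)
  fix j assume j: "j \<in> I"
  interpret Vj: module CC "V j" using V[OF j] .
  have "(\<Oplus>\<^bsub>DS\<^esub>i\<in>?S. sum_incl I V i (f i)) j = (\<Oplus>\<^bsub>V j\<^esub>i\<in>?S. sum_incl I V i (f i) j)"
    by (rule lin_map_finsum[OF module_direct_sum V[OF j] lin_map_proj[OF j] fin]) (auto intro: cl)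
  also have "\<dots> = (\<Oplus>\<^bsub>V j\<^esub>i\<in>?S. if j = i then f j else \<zero>\<^bsub>V j\<^esub>)"
    using j direct_sum_memD[OF f j] by (intro Vj.finsum_cong') (auto simp: sum_incl_def)
  also have "\<dots> = f j"
  proof (cases "j \<in> ?S")
    case True
    then show ?thesis using Vj.finsum_singleton[OF True fin, of "\<lambda>_. f j"] direct_sum_memD[OF f j] by simp
  next
    case False
    then have "(\<Oplus>\<^bsub>V j\<^esub>i\<in>?S. if j = i then f j else \<zero>\<^bsub>V j\<^esub>) = (\<Oplus>\<^bsub>V j\<^esub>i\<in>?S. \<zero>\<^bsub>V j\<^esub>)"
      by (intro Vj.finsum_cong') auto
    then show ?thesis using False j by simp
  qed
  finally show "f j = (\<Oplus>\<^bsub>DS\<^esub>i\<in>?S. sum_incl I V i (f i)) j" by simp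
qed

lemma span_direct_sum:
  assumes "\<And>i. i \<in> I \<Longrightarrow> carrier (V i) \<subseteq> lin_span (V i) (S i)" "\<And>i. i \<in> I \<Longrightarrow> S i \<subseteq> carrier (V i)"
  shows "carrier DS \<subseteq> lin_span DS (\<Union>i\<in>I. sum_incl I V i ` S i)"
proof
  fix f assume f: "f \<in> carrier DS"
  interpret M: module CC "DS" by (rule module_direct_sum)
  let ?S = "{i\<in>I. f i \<noteq> \<zero>\<^bsub>V i\<^esub>}"
  let ?T = "lin_span DS (\<Union>i\<in>I. sum_incl I V i ` S i)"
  have fin: "finite ?S" using f by (simp add: direct_sum_simps)
  have T: "submodule ?T CC DS"
    using assms(2) lin_map_closed[OF lin_map_sum_incl]
    by (intro submodule_lin_span[OF module_direct_sum]) blast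
  note TD = submoduleD[OF module_direct_sum T]
  have incl: "sum_incl I V i x \<in> ?T" if i: "i \<in> I" and x: "x \<in> carrier (V i)" for i x
  proof -
    have "lin_span (V i) (S i) \<subseteq> {x \<in> carrier (V i). sum_incl I V i x \<in> ?T}"
      using assms(2)[OF i] i lin_span_incl[of "\<Union>i\<in>I. sum_incl I V i ` S i" "DS"]
      by (intro lin_span_least[OF submodule_vimage[OF V[OF i] module_direct_sum lin_map_sum_incl[OF i] T]]) blast
    then show ?thesis using assms(1)[OF i] x by auto
  qed
  have "(\<Oplus>\<^bsub>DS\<^esub>i\<in>J. sum_incl I V i (f i)) \<in> ?T" if "finite J" "J \<subseteq> I" for J
    using that
  proof (induct J)
    case empty
    then show ?case using TD(2) by (simp add: M.finsum_empty)
  next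
    case (insert j J)
    then have "(\<Oplus>\<^bsub>DS\<^esub>i\<in>insert j J. sum_incl I V i (f i))
        = sum_incl I V j (f j) \<oplus>\<^bsub>DS\<^esub> (\<Oplus>\<^bsub>DS\<^esub>i\<in>J. sum_incl I V i (f i))"
      using direct_sum_memD[OF f] lin_map_closed[OF lin_map_sum_incl]
      by (intro M.finsum_insert) blast+
    then show ?case using insert incl direct_sum_memD[OF f] TD(3) by simp
  qed
  then have "(\<Oplus>\<^bsub>DS\<^esub>i\<in>?S. sum_incl I V i (f i)) \<in> ?T" using fin by blast
  then show "f \<in> ?T" using direct_sum_eq_finsum_incl[OF f] by simp
qed

context
  fixes M :: "(complex, 'w) module" and g
  assumes M: "module CC M" and g: "\<And>i. i \<in> I \<Longrightarrow> lin_map (V i) M (g i)"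
begin

lemma sum_lift_superset:
  assumes f: "f \<in> carrier DS" and S: "finite S" "S \<subseteq> I" "{i\<in>I. f i \<noteq> \<zero>\<^bsub>V i\<^esub>} \<subseteq> S"
  shows "sum_lift I V M g f = (\<Oplus>\<^bsub>M\<^esub>i\<in>S. g i (f i))"
proof -
  interpret M: module CC M by (rule M)
  show ?thesis unfolding sum_lift_def
    using S direct_sum_memD[OF f] lin_map_closed[OF g] lin_map_zero[OF V M g]
    by (intro M.add.finprod_mono_neutral_cong_left) auto
qed

lemma lin_map_sum_lift: "lin_map DS M (sum_lift I V M g)"
proof -
  interpret M: module CC M by (rule M)
  show ?thesis
  proof (rule lin_mapI)
    fix f assume f: "f \<in> carrier DS"
    let ?S = "{i\<in>I. f i \<noteq> \<zero>\<^bsub>V i\<^esub>}"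
    have fin: "finite ?S" using f by (simp add: direct_sum_simps)
    note gf = lin_map_closed[OF g direct_sum_memD[OF f]]
    show "sum_lift I V M g f \<in> carrier M"
      unfolding sum_lift_def by (intro M.finsum_closed) (auto intro: gf)
    show "sum_lift I V M g (c \<odot>\<^bsub>DS\<^esub> f) = c \<odot>\<^bsub>M\<^esub> sum_lift I V M g f" for c
    proof -
      have "sum_lift I V M g (c \<odot>\<^bsub>DS\<^esub> f) = (\<Oplus>\<^bsub>M\<^esub>i\<in>?S. g i ((c \<odot>\<^bsub>DS\<^esub> f) i))"
        using fin by (intro sum_lift_superset direct_sum_closed f) (auto simp: direct_sum_simps(4) component_ops)
      also have "\<dots> = (\<Oplus>\<^bsub>M\<^esub>i\<in>?S. c \<odot>\<^bsub>M\<^esub> g i (f i))"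
        using gf M.smult_closed
        by (intro M.finsum_cong') (auto simp: direct_sum_simps(4) lin_map_smult[OF g] direct_sum_memD[OF f])
      also have "\<dots> = c \<odot>\<^bsub>M\<^esub> sum_lift I V M g f"
        unfolding sum_lift_def using fin gf by (intro module_finsum_smult[OF M, symmetric]) auto
      finally show ?thesis .
    qed
    fix h assume h: "h \<in> carrier DS"
    note gh = lin_map_closed[OF g direct_sum_memD[OF h]]
    let ?S = "{i\<in>I. f i \<noteq> \<zero>\<^bsub>V i\<^esub>} \<union> {i\<in>I. h i \<noteq> \<zero>\<^bsub>V i\<^esub>}"
    have fin: "finite ?S" using f h by (simp add: direct_sum_simps)
    have "sum_lift I V M g (f \<oplus>\<^bsub>DS\<^esub> h) = (\<Oplus>\<^bsub>M\<^esub>i\<in>?S. g i ((f \<oplus>\<^bsub>DS\<^esub> h) i))"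
      using fin by (intro sum_lift_superset direct_sum_closed f h) (auto simp: direct_sum_simps(3) component_ops)
    also have "\<dots> = (\<Oplus>\<^bsub>M\<^esub>i\<in>?S. g i (f i) \<oplus>\<^bsub>M\<^esub> g i (h i))"
      using gf gh by (intro M.finsum_cong')
        (auto simp: direct_sum_simps(3) lin_map_add[OF g] direct_sum_memD[OF f] direct_sum_memD[OF h])
    also have "\<dots> = (\<Oplus>\<^bsub>M\<^esub>i\<in>?S. g i (f i)) \<oplus>\<^bsub>M\<^esub> (\<Oplus>\<^bsub>M\<^esub>i\<in>?S. g i (h i))"
      using gf gh by (intro M.finsum_addf) auto
    also have "\<dots> = sum_lift I V M g f \<oplus>\<^bsub>M\<^esub> sum_lift I V M g h"
      using fin f h by (simp add: sum_lift_superset[of _ ?S] subset_iff)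
    finally show "sum_lift I V M g (f \<oplus>\<^bsub>DS\<^esub> h) = sum_lift I V M g f \<oplus>\<^bsub>M\<^esub> sum_lift I V M g h" .
  qed
qed

lemma sum_lift_incl:
  assumes i: "i \<in> I" and x: "x \<in> carrier (V i)"
  shows "sum_lift I V M g (sum_incl I V i x) = g i x"
proof -
  interpret M: module CC M by (rule M)
  have "sum_lift I V M g (sum_incl I V i x) = (\<Oplus>\<^bsub>M\<^esub>j\<in>{i}. g j (sum_incl I V i x j))"
    using i by (intro sum_lift_superset lin_map_closed[OF lin_map_sum_incl[OF i] x]) (auto simp: sum_incl_def)
  then show ?thesis using i lin_map_closed[OF g[OF i] x] by (simp add: M.finsum_insert sum_incl_def)
qed

end

lemma lin_map_direct_sum:
  assumes h: "\<And>i. i \<in> I \<Longrightarrow> lin_map (V i) (V i) (h i)"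
  shows "lin_map DS DS (\<lambda>f. \<lambda>i\<in>I. h i (f i))"
proof (rule lin_mapI)
  fix f assume f: "f \<in> carrier DS"
  have "{i \<in> I. h i (f i) \<noteq> \<zero>\<^bsub>V i\<^esub>} \<subseteq> {i\<in>I. f i \<noteq> \<zero>\<^bsub>V i\<^esub>}"
    using lin_map_zero[OF V V h] by auto
  then show "(\<lambda>i\<in>I. h i (f i)) \<in> carrier DS"
    using f lin_map_closed[OF h]
    by (auto simp: direct_sum_simps cong: conj_cong elim: finite_subset intro!: PiE_I)
qed (auto simp: direct_sum_simps(3,4) direct_sum_memD lin_map_add[OF h] lin_map_smult[OF h] fun_eq_iff restrict_def)

end

section \<open>Mirzavaziri's recursion\<close>

text \<open>All compositions of \<open>k\<close>, of any length; the empty list is the only composition of 0.\<close>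

definition comps :: "nat \<Rightarrow> nat list set" where
  "comps k = {rs. sum_list rs = k \<and> (\<forall>r\<in>set rs. 0 < r)}"

lemma comps_0 [simp]: "comps 0 = {[]}"
proof -
  have "rs = []" if "sum_list rs = 0" "\<forall>r\<in>set rs. 0 < r" for rs :: "nat list"
    using that by (cases rs) auto
  then show ?thesis by (auto simp: comps_def)
qed

lemma comps_rec:
  assumes "1 \<le> k"
  shows "comps k = (\<Union>r\<in>{1..k}. (#) r ` comps (k - r))"
proof -
  have "rs \<in> (\<Union>r\<in>{1..k}. (#) r ` comps (k - r))" if "rs \<in> comps k" for rs
  proof (cases rs)
    case (Cons r ts)
    then have "r \<in> {1..k}" "ts \<in> comps (k - r)" using that by (auto simp: comps_def)
    then show ?thesis using Cons by blast
  qed (use that assms in \<open>simp add: comps_def\<close>)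
  then show ?thesis using assms by (auto simp: comps_def)
qed

lemma finite_comps: "finite (comps k)"
proof (induct k rule: less_induct)
  case (less k)
  show ?case
  proof (cases "k = 0")
    case False
    then show ?thesis using less by (subst comps_rec) auto
  qed simp
qed

lemma sum_comps_rec:
  assumes "1 \<le> k"
  shows "(\<Sum>rs\<in>comps k. h rs) = (\<Sum>r=1..k. \<Sum>rs\<in>comps (k - r). h (r # rs))"
proof -
  have "(\<Sum>rs\<in>comps k. h rs) = (\<Sum>r=1..k. \<Sum>rs\<in>(#) r ` comps (k - r). h rs)"
    unfolding comps_rec[OF assms] by (rule sum.UNION_disjoint) (auto simp: finite_comps)
  then show ?thesis by (simp add: sum.reindex)
qed

lemma length_le_sum_list: "\<forall>r\<in>set rs. 0 < r \<Longrightarrow> length rs \<le> sum_list (rs :: nat list)"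
  by (induct rs) auto

lemma comps_eq_compositions:
  assumes "1 \<le> k"
  shows "comps k = (\<Union>i\<in>{1..k}. compositions i k)"
proof -
  have "rs \<in> (\<Union>i\<in>{1..k}. compositions i k)" if "rs \<in> comps k" for rs
    using that assms length_le_sum_list[of rs]
    by (intro UN_I[of "length rs"]) (auto simp: comps_def compositions_def Suc_le_eq)
  then show ?thesis by (auto simp: comps_def compositions_def)
qed

lemma compositions_subset: "compositions i k \<subseteq> comps k"
  by (auto simp: comps_def compositions_def)

lemma sum_compositions:
  assumes "1 \<le> k"
  shows "(\<Sum>i=1..k. \<Sum>rs\<in>compositions i k. h rs) = (\<Sum>rs\<in>comps k. h rs)"
proof -
  have "finite (compositions i k)" for i
    by (rule finite_subset[OF compositions_subset finite_comps])
  then show ?thesis unfolding comps_eq_compositions[OF assms]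
    by (intro sum.UNION_disjoint[symmetric]) (auto simp: compositions_def)
qed

lemma mirz_coeff_Nil [simp]: "mirz_coeff [] = 1"
  by (simp add: mirz_coeff_def)

lemma mirz_coeff_Cons: "mirz_coeff (r # rs) = 1 / of_nat (r + sum_list rs) * mirz_coeff rs"
  by (simp add: mirz_coeff_def prod.lessThan_Suc_shift del: prod.lessThan_Suc)

lemma mirz_coeff_Cons_comps:
  "r \<in> {1..k} \<Longrightarrow> rs \<in> comps (k - r) \<Longrightarrow> mirz_coeff (r # rs) = 1 / of_nat k * mirz_coeff rs"
  by (simp add: mirz_coeff_Cons comps_def)

text \<open>
  The right-hand side of Mirzavaziri's formula, evaluated on \<open>A\<close>, with the lengths of the
  compositions summed over implicitly. For \<open>k = 0\<close> it is the identity.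
\<close>

definition mirz_sum ::
  "(complex \<Rightarrow> 'a::ab_group_add \<Rightarrow> 'a) \<Rightarrow> (nat \<Rightarrow> 'a \<Rightarrow> 'a) \<Rightarrow> nat \<Rightarrow> 'a \<Rightarrow> 'a" where
  "mirz_sum scale d k a = (\<Sum>rs\<in>comps k. scale (mirz_coeff rs) (foldr d rs a))"

lemma derivationD:
  assumes "derivation scale d"
  shows "d (a + b) = d a + d b" "d (scale c a) = scale c (d a)" "d (a * b) = d a * b + a * d b"
    "d 0 = 0" "d (- a) = - d a" "d (a - b) = d a - d b" "d (sum g S) = (\<Sum>x\<in>S. d (g x))"
proof -
  have lin: "Vector_Spaces.linear scale scale d" using assms by (simp add: derivation_def)
  interpret Vector_Spaces.linear scale scale d by (rule lin)
  show "d (a + b) = d a + d b" "d (scale c a) = scale c (d a)" "d 0 = 0" "d (- a) = - d a"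
    "d (a - b) = d a - d b" "d (sum g S) = (\<Sum>x\<in>S. d (g x))"
    by (rule add scale zero neg diff sum)+
  show "d (a * b) = d a * b + a * d b" using assms by (simp add: derivation_def)
qed

lemma higher_derivationD:
  assumes "higher_derivation scale D"
  shows "D n (a + b) = D n a + D n b" "D n (scale c a) = scale c (D n a)"
    "D n (a * b) = (\<Sum>i\<le>n. D i a * D (n - i) b)"
    "D n 0 = 0"
proof -
  have lin: "Vector_Spaces.linear scale scale (D n)" using assms by (simp add: higher_derivation_def)
  interpret Vector_Spaces.linear scale scale "D n" by (rule lin)
  show "D n (a + b) = D n a + D n b" "D n (scale c a) = scale c (D n a)" "D n 0 = 0"
    by (rule add scale zero)+
  show "D n (a * b) = (\<Sum>i\<le>n. D i a * D (n - i) b)" using assms by (simp add: higher_derivation_def)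
qed

text \<open>
  The coefficients of the logarithmic derivative of \<open>\<Sum>\<^sub>n t\<^sup>n D\<^sub>n\<close>, defined by solving
  \<open>n D\<^sub>n = \<Sum>\<^sub>1\<^sub>\<le>\<^sub>r\<^sub>\<le>\<^sub>n d\<^sub>r D\<^sub>n\<^sub>-\<^sub>r\<close> for \<open>d\<^sub>n\<close> when \<open>D\<^sub>0 = 1\<close>. The term
  with \<open>n = 0\<close> is zero.
\<close>

fun log_der :: "(complex \<Rightarrow> 'a::ab_group_add \<Rightarrow> 'a) \<Rightarrow> (nat \<Rightarrow> 'a \<Rightarrow> 'a) \<Rightarrow> nat \<Rightarrow> 'a \<Rightarrow> 'a" where
  "log_der scale D n a =
     scale (of_nat n) (D n a) - (\<Sum>r\<in>{1..<n}. log_der scale D r (D (n - r) a))"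

declare log_der.simps [simp del]

context complex_comm_algebra
begin

lemma scale_mult_right: "x * scale c y = scale c (x * y)"
  using scale_mult_left[of c y x] by (simp add: mult.commute)

lemma derivationI:
  assumes "\<And>a b. d (a + b) = d a + d b" "\<And>c a. d (scale c a) = scale c (d a)"
    "\<And>a b. d (a * b) = d a * b + a * d b"
  shows "derivation scale d"
  using assms vector_space_axioms by (simp add: derivation_def Vector_Spaces.linear_iff)

lemma log_der_rec:
  assumes "normalized D"
  shows "scale (of_nat n) (D n a) = (\<Sum>r=1..n. log_der scale D r (D (n - r) a))"
proof (cases n)
  case 0
  then show ?thesis by simp
next
  case (Suc m)
  then have "{1..n} = insert n {1..<n}" by auto
  then show ?thesis using assms log_der.simps[of scale D n a] by (simp add: normalized_def)
qed

text \<open>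
  By induction on \<open>n\<close>. Expanding \<open>n D\<^sub>n(a b)\<close> by the Leibniz rule and subtracting the products
  produced by \<open>d\<^sub>r\<close> with \<open>r < n\<close>, which are known to be derivations, everything cancels except
  \<open>d\<^sub>n(a) b + a d\<^sub>n(b)\<close>.
\<close>

lemma derivation_log_der:
  assumes D: "higher_derivation scale D" and D0: "normalized D"
  shows "derivation scale (log_der scale D n)"
proof (induct n rule: less_induct)
  case (less n)
  let ?\<delta> = "log_der scale D"
  note d = derivationD[OF less] and D' = higher_derivationD[OF D]
  show ?case
  proof (rule derivationI)
    show "?\<delta> n (a + b) = ?\<delta> n a + ?\<delta> n b" for a b
      unfolding log_der.simps[of scale D n] by (simp add: D' d sum.distrib scale_right_distrib)
    show "?\<delta> n (scale c a) = scale c (?\<delta> n a)" for c a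
      unfolding log_der.simps[of scale D n]
      by (simp add: D' d scale_sum_right scale_right_diff_distrib mult.commute)
    fix a b
    \<comment> \<open>\<open>P a b\<close> collects the terms in which the derivations with \<open>r < n\<close> act on the first factor.\<close>
    define P where "P a b = (\<Sum>r\<in>{1..<n}. \<Sum>j\<le>n - r. ?\<delta> r (D j a) * D (n - r - j) b)" for a b
    have P: "P a b + ?\<delta> n a * b = (\<Sum>i\<le>n. scale (of_nat i) (D i a) * D (n - i) b)" for a b
    proof -
      have "P a b = (\<Sum>(r, j)\<in>(SIGMA r:{1..<n}. {..n - r}). ?\<delta> r (D j a) * D (n - r - j) b)"
        unfolding P_def by (rule sum.Sigma) auto
      also have "\<dots> = (\<Sum>(i, r)\<in>(SIGMA i:{..n}. {r\<in>{1..<n}. r \<le> i}). ?\<delta> r (D (i - r) a) * D (n - i) b)"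
        by (rule sum.reindex_bij_witness[where i = "\<lambda>(i, r). (r, i - r)" and j = "\<lambda>(r, j). (r + j, r)"])
          auto
      also have "\<dots> = (\<Sum>i\<le>n. \<Sum>r\<in>{r\<in>{1..<n}. r \<le> i}. ?\<delta> r (D (i - r) a) * D (n - i) b)"
        by (rule sum.Sigma[symmetric]) auto
      also have "\<dots> = (\<Sum>i\<le>n. (\<Sum>r\<in>{r\<in>{1..<n}. r \<le> i}. ?\<delta> r (D (i - r) a)) * D (n - i) b)"
        by (simp add: sum_distrib_right)
      also have "\<dots> = (\<Sum>i\<le>n. (scale (of_nat i) (D i a) - (if i = n then ?\<delta> n a else 0)) * D (n - i) b)"
      proof (rule sum.cong[OF refl])
        fix i assume i: "i \<in> {..n}"
        have "(\<Sum>r\<in>{r\<in>{1..<n}. r \<le> i}. ?\<delta> r (D (i - r) a)) = scale (of_nat i) (D i a) - (if i = n then ?\<delta> n a else 0)"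
        proof (cases "i = n")
          case True
          then have "{r\<in>{1..<n}. r \<le> i} = {1..<n}" by auto
          then show ?thesis using True log_der.simps[of scale D n a] by simp
        next
          case False
          then have "{r\<in>{1..<n}. r \<le> i} = {1..i}" using i by auto
          then show ?thesis using False log_der_rec[OF D0, of i a] by simp
        qed
        then show "(\<Sum>r\<in>{r\<in>{1..<n}. r \<le> i}. ?\<delta> r (D (i - r) a)) * D (n - i) b =
            (scale (of_nat i) (D i a) - (if i = n then ?\<delta> n a else 0)) * D (n - i) b" by simp
      qed
      also have "\<dots> = (\<Sum>i\<le>n. scale (of_nat i) (D i a) * D (n - i) b) - ?\<delta> n a * b"
        using D0 by (simp add: left_diff_distrib sum_subtractf if_distrib[of "\<lambda>x. x * _"] sum.delta
            normalized_def cong: if_cong)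
      finally show ?thesis by simp
    qed
    have "(\<Sum>r\<in>{1..<n}. ?\<delta> r (D (n - r) (a * b))) =
        (\<Sum>r\<in>{1..<n}. \<Sum>j\<le>n - r. ?\<delta> r (D j a) * D (n - r - j) b + D j a * ?\<delta> r (D (n - r - j) b))"
      by (simp add: D' d)
    also have "\<dots> = P a b + (\<Sum>r\<in>{1..<n}. \<Sum>j\<le>n - r. D j a * ?\<delta> r (D (n - r - j) b))"
      by (simp add: sum.distrib P_def)
    also have "(\<Sum>r\<in>{1..<n}. \<Sum>j\<le>n - r. D j a * ?\<delta> r (D (n - r - j) b)) = P b a"
      unfolding P_def
    proof (rule sum.cong[OF refl])
      fix r
      show "(\<Sum>j\<le>n - r. D j a * ?\<delta> r (D (n - r - j) b)) = (\<Sum>j\<le>n - r. ?\<delta> r (D j b) * D (n - r - j) a)"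
        by (rule sum.reindex_bij_witness[where i = "\<lambda>j. n - r - j" and j = "\<lambda>j. n - r - j"])
          (auto simp: mult.commute simp del: diff_diff_left)
    qed
    finally have 1: "(\<Sum>r\<in>{1..<n}. ?\<delta> r (D (n - r) (a * b))) = P a b + P b a" .
    have "(\<Sum>i\<le>n. scale (of_nat i) (D i b) * D (n - i) a) = (\<Sum>i\<le>n. scale (of_nat (n - i)) (D i a * D (n - i) b))"
      by (rule sum.reindex_bij_witness[where i = "\<lambda>j. n - j" and j = "\<lambda>j. n - j"])
        (auto simp: mult.commute scale_mult_right)
    moreover have "scale (of_nat n) (D n (a * b)) =
        (\<Sum>i\<le>n. scale (of_nat i) (D i a) * D (n - i) b + scale (of_nat (n - i)) (D i a * D (n - i) b))"
      by (auto simp: D' scale_sum_right scale_mult_left scale_left_distrib[symmetric] of_nat_diff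
          intro!: sum.cong)
    ultimately have 2: "scale (of_nat n) (D n (a * b)) = P a b + ?\<delta> n a * b + (P b a + ?\<delta> n b * a)"
      by (simp add: sum.distrib P)
    show "?\<delta> n (a * b) = ?\<delta> n a * b + a * ?\<delta> n b"
      unfolding log_der.simps[of scale D n "a * b"] 1 2 by (simp add: algebra_simps)
  qed
qed

lemma mirz_sum_0 [simp]: "mirz_sum scale d 0 a = a"
  by (simp add: mirz_sum_def)

lemma mirz_sum_rec:
  assumes "\<And>r. derivation scale (d r)" "1 \<le> k"
  shows "mirz_sum scale d k a = scale (1 / of_nat k) (\<Sum>r=1..k. d r (mirz_sum scale d (k - r) a))"
proof -
  have "mirz_sum scale d k a = (\<Sum>r=1..k. \<Sum>rs\<in>comps (k - r). scale (mirz_coeff (r # rs)) (d r (foldr d rs a)))"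
    unfolding mirz_sum_def using assms(2) by (simp add: sum_comps_rec)
  also have "\<dots> = (\<Sum>r=1..k. \<Sum>rs\<in>comps (k - r). scale (1 / of_nat k) (d r (scale (mirz_coeff rs) (foldr d rs a))))"
    by (intro sum.cong refl)
      (simp only: mirz_coeff_Cons_comps derivationD(2)[OF assms(1)] scale_scale)
  also have "\<dots> = scale (1 / of_nat k) (\<Sum>r=1..k. d r (mirz_sum scale d (k - r) a))"
    by (simp only: mirz_sum_def derivationD(7)[OF assms(1)] scale_sum_right)
  finally show ?thesis .
qed

lemma scale_of_nat_cancel:
  assumes "1 \<le> k"
  shows "scale (1 / of_nat k) (scale (of_nat k) a) = a"
  using assms by simp

lemma is_mirz_seq_iff:
  "is_mirz_seq scale D d \<longleftrightarrow> (\<forall>n. derivation scale (d n)) \<and> (\<forall>k\<ge>1. \<forall>a. D k a = mirz_sum scale d k a)"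
  by (simp add: is_mirz_seq_def mirz_sum_def sum_compositions del: One_nat_def)

text \<open>
  Mirzavaziri's theorem: sequences as required in the choice of \<open>mirz_seq\<close> exist.
\<close>

lemma is_mirz_seq_mirz_seq:
  assumes D: "higher_derivation scale D" and D0: "normalized D"
  shows "is_mirz_seq scale D (mirz_seq scale D)"
proof -
  have "D k a = mirz_sum scale (log_der scale D) k a" for k a
  proof (induct k arbitrary: a rule: less_induct)
    case (less k)
    show ?case
    proof (cases "k = 0")
      case True
      then show ?thesis using D0 by (simp add: normalized_def)
    next
      case False
      then have k: "1 \<le> k" by simp
      have "D k a = scale (1 / of_nat k) (\<Sum>r=1..k. log_der scale D r (D (k - r) a))"
        using scale_of_nat_cancel[OF k, of "D k a"] by (simp add: log_der_rec[OF D0])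
      also have "\<dots> = mirz_sum scale (log_der scale D) k a"
        using less k by (simp add: mirz_sum_rec[OF derivation_log_der[OF D D0]])
      finally show ?thesis .
    qed
  qed
  then have "is_mirz_seq scale D (log_der scale D)"
    using derivation_log_der[OF D D0] by (simp add: is_mirz_seq_iff)
  then show ?thesis unfolding mirz_seq_def by (rule someI[of "is_mirz_seq scale D"])
qed

lemma mirz_seq_rec:
  assumes D: "higher_derivation scale D" and D0: "normalized D"
  shows "derivation scale (mirz_seq scale D n)"
    and "scale (of_nat k) (D k a) = (\<Sum>r=1..k. mirz_seq scale D r (D (k - r) a))"
proof -
  let ?d = "mirz_seq scale D"
  show der: "derivation scale (?d n)" for n
    using is_mirz_seq_mirz_seq[OF assms] by (simp add: is_mirz_seq_iff)
  have eq: "D k a = mirz_sum scale ?d k a" for k a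
    using is_mirz_seq_mirz_seq[OF assms] D0 by (cases "k = 0") (simp_all add: is_mirz_seq_iff normalized_def)
  show "scale (of_nat k) (D k a) = (\<Sum>r=1..k. ?d r (D (k - r) a))"
  proof (cases "k = 0")
    case False
    then have "scale (of_nat k) (mirz_sum scale ?d k a) = (\<Sum>r=1..k. ?d r (mirz_sum scale ?d (k - r) a))"
      by (subst mirz_sum_rec[OF der]) simp_all
    then show ?thesis by (simp add: eq[symmetric])
  qed simp
qed

end

section \<open>Enveloping algebras and their actions\<close>

lemma module_cong_ops:
  assumes M: "module CC M"
    and "carrier M' = carrier M" "add M' = add M" "zero M' = zero M" "smult M' = smult M"
  shows "module CC M'"
proof -
  interpret M: module CC M by (rule M)
  show ?thesis
  proof (rule moduleI)
    show "abelian_group M'"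
    proof (rule abelian_groupI)
      show "\<exists>y\<in>carrier M'. y \<oplus>\<^bsub>M'\<^esub> x = \<zero>\<^bsub>M'\<^esub>" if "x \<in> carrier M'" for x
        using that assms(2-) M.l_neg[of x] by (intro bexI[of _ "\<ominus>\<^bsub>M\<^esub> x"]) auto
    qed (auto simp: assms(2-) M.a_ac)
  qed (auto simp: CC_cring assms(2-) M.smult_closed M.smult_l_distr[simplified] M.smult_r_distr[simplified]
      M.smult_assoc1[simplified] M.smult_one[simplified])
qed

lemma poly_mapping_add_induct:
  fixes f :: "'b \<Rightarrow>\<^sub>0 'c::comm_monoid_add"
  assumes "P 0" "\<And>x c. P (single x c)" "\<And>f g. P f \<Longrightarrow> P g \<Longrightarrow> P (f + g)"
  shows "P f"
proof -
  have "P (\<Sum>x\<in>S. single x (lookup f x))" if "finite S" for S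
    using that by induct (auto intro: assms)
  then show ?thesis by (subst poly_mapping_eq_sum_single) simp
qed

text \<open>The product of the free algebra: concatenation of words, extended bilinearly.\<close>

definition word_mult :: "('x list \<Rightarrow>\<^sub>0 complex) \<Rightarrow> ('x list \<Rightarrow>\<^sub>0 complex) \<Rightarrow> 'x list \<Rightarrow>\<^sub>0 complex" where
  "word_mult f g = (\<Sum>u\<in>keys f. \<Sum>v\<in>keys g.
     single (u @ v) (lookup f u * lookup g v))"

lemma word_mult_zero [simp]: "word_mult 0 g = 0" "word_mult f 0 = 0"
  by (simp_all add: word_mult_def)

lemma word_mult_single [simp]:
  "word_mult (single u a) (single v b) = single (u @ v) (a * b)"
  by (cases "a = 0"; cases "b = 0") (simp_all add: word_mult_def)

lemma word_mult_add_left: "word_mult (f + f') g = word_mult f g + word_mult f' g"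
proof -
  define F where "F u c = (\<Sum>v\<in>keys g. single (u @ v) (c * lookup g v))"
    for u c
  have "(\<Sum>u\<in>keys (f + f'). F u (lookup (f + f') u)) =
      (\<Sum>u\<in>keys f. F u (lookup f u)) +
      (\<Sum>u\<in>keys f'. F u (lookup f' u))"
    by (rule setsum_keys_plus_distrib) (simp_all add: F_def distrib_right single_add sum.distrib)
  then show ?thesis by (simp add: word_mult_def F_def)
qed

lemma word_mult_add_right: "word_mult f (g + g') = word_mult f g + word_mult f g'"
proof -
  define F where "F v c = (\<Sum>u\<in>keys f. single (u @ v) (lookup f u * c))"
    for v c
  have *: "word_mult f h = (\<Sum>v\<in>keys h. F v (lookup h v))" for h
    unfolding word_mult_def F_def by (rule sum.swap)
  show ?thesis unfolding *
    by (rule setsum_keys_plus_distrib) (simp_all add: F_def distrib_left single_add sum.distrib)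
qed

lemma word_mult_sum_right: "word_mult f (\<Sum>i\<in>S. h i) = (\<Sum>i\<in>S. word_mult f (h i))"
  by (induct S rule: infinite_finite_induct) (simp_all add: word_mult_add_right)

lemma word_mult_assoc: "word_mult (word_mult f g) h = word_mult f (word_mult g h)"
proof (induct f rule: poly_mapping_add_induct)
  case (2 u a)
  show ?case
  proof (induct g rule: poly_mapping_add_induct)
    case (2 v b)
    show ?case
      by (induct h rule: poly_mapping_add_induct) (simp_all add: word_mult_add_right mult.assoc)
  qed (simp_all add: word_mult_add_left word_mult_add_right)
qed (simp_all add: word_mult_add_left)

lemma map_times_add:
  "Poly_Mapping.map ((*) (c :: complex)) (f + g) = Poly_Mapping.map ((*) c) f + Poly_Mapping.map ((*) c) g"
  by (rule poly_mapping_eqI) (simp add: lookup_add distrib_left)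

lemma map_times_zero [simp]: "Poly_Mapping.map ((*) (c :: complex)) 0 = 0"
  by (rule poly_mapping_eqI) simp

lemma word_mult_unit:
  "word_mult (single [] c) f = Poly_Mapping.map ((*) c) f"
  "word_mult f (single [] c) = Poly_Mapping.map ((*) c) f"
  by (induct f rule: poly_mapping_add_induct)
    (simp_all add: word_mult_add_left word_mult_add_right map_times_add mult.commute)

lemma map_times_one: "Poly_Mapping.map ((*) (1 :: complex)) f = f"
  by (rule poly_mapping_eqI) simp

lemma word_mult_scale_left:
  "word_mult (Poly_Mapping.map ((*) c) f) g = Poly_Mapping.map ((*) c) (word_mult f g)"
  by (simp only: word_mult_unit(1)[symmetric] word_mult_assoc)

lemma word_mult_scale_right:
  "word_mult f (Poly_Mapping.map ((*) c) g) = Poly_Mapping.map ((*) c) (word_mult f g)"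
  by (metis word_mult_unit word_mult_assoc)

lemma free_algebra_simps [simp]:
  "carrier (free_algebra X) = {f. keys f \<subseteq> lists X}" "add (free_algebra X) = (+)"
  "zero (free_algebra X) = 0" "smult (free_algebra X) = (\<lambda>c. Poly_Mapping.map ((*) c))"
  "mult (free_algebra X) = word_mult" "one (free_algebra X) = single [] 1"
  by (simp_all add: free_algebra_def free_space_def word_mult_def[abs_def])

lemma module_free_algebra: "module CC (free_algebra X)"
  by (rule module_cong_ops[OF module_free_space[of "lists X"]]) simp_all

lemma lin_map_free_algebra_iff: "lin_map (free_algebra X) M f \<longleftrightarrow> lin_map (free_space (lists X)) M f"
  by (simp add: lin_map_def)

lemma keys_word_mult:
  assumes "keys f \<subseteq> lists X" "keys g \<subseteq> lists X"
  shows "keys (word_mult f g) \<subseteq> lists X"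
proof -
  have A: "keys (single (u @ v) c) \<subseteq> lists X"
    if "u \<in> keys f" "v \<in> keys g" for u v and c :: complex
    using subsetD[OF assms(1) that(1)] subsetD[OF assms(2) that(2)] by simp
  have B: "keys (\<Sum>v\<in>keys g.
      single (u @ v) (lookup f u * lookup g v)) \<subseteq> lists X"
    if "u \<in> keys f" for u
    by (rule order.trans[OF keys_sum], rule UN_least, rule A[OF that])
  show ?thesis unfolding word_mult_def
    by (rule order.trans[OF keys_sum], rule UN_least, rule B)
qed

lemma ring_free_algebra: "ring (free_algebra X)"
proof (rule ringI)
  interpret module CC "free_algebra X" by (rule module_free_algebra)
  show "abelian_group (free_algebra X)" by (rule M.abelian_group_axioms)
  show "Group.monoid (free_algebra X)"
    by (rule monoidI) (auto simp: word_mult_assoc word_mult_unit map_times_one dest: subsetD[OF keys_word_mult])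
qed (simp_all add: word_mult_add_left word_mult_add_right)

lemma lin_map_word_mult_left:
  assumes "g \<in> carrier (free_algebra X)"
  shows "lin_map (free_algebra X) (free_algebra X) (\<lambda>f. word_mult f g)"
  using assms by (intro lin_mapI) (simp_all add: keys_word_mult word_mult_add_left word_mult_scale_left)

lemma lin_map_word_mult_right:
  assumes "f \<in> carrier (free_algebra X)"
  shows "lin_map (free_algebra X) (free_algebra X) (\<lambda>g. word_mult f g)"
  using assms by (intro lin_mapI) (simp_all add: keys_word_mult word_mult_add_right word_mult_scale_right)

lemmas lin_map_free_algebra_sum = lin_map_sum[OF module_free_algebra free_algebra_simps(2,3)]

lemma span_free_algebra:
  "carrier (free_algebra X) \<subseteq> lin_span (free_algebra X) ((\<lambda>x. single x 1) ` lists X)"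
proof -
  have "submodule W CC (free_algebra X) \<longleftrightarrow> submodule W CC (free_space (lists X))" for W
    by (simp add: submodule_def submodule_axioms_def subgroup_def m_inv_def)
  then have "lin_span (free_algebra X) S = lin_span (free_space (lists X)) S" for S
    by (simp add: lin_span_def)
  then show ?thesis using span_free_space[of "lists X"] by simp
qed

text \<open>
  The part of the structure of a Lie algebra that the presentation of its enveloping algebra refers
  to: closure under the operations. The Lie algebra axioms themselves play no role here.
\<close>

locale lie_ops =
  fixes L :: "(complex, 'x) module" and br :: "'x \<Rightarrow> 'x \<Rightarrow> 'x"
  assumes L_add: "x \<in> carrier L \<Longrightarrow> y \<in> carrier L \<Longrightarrow> x \<oplus>\<^bsub>L\<^esub> y \<in> carrier L"
    and L_smult: "x \<in> carrier L \<Longrightarrow> c \<odot>\<^bsub>L\<^esub> x \<in> carrier L"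
    and L_br: "x \<in> carrier L \<Longrightarrow> y \<in> carrier L \<Longrightarrow> br x y \<in> carrier L"
begin

abbreviation "FA \<equiv> free_algebra (carrier L)"
abbreviation "UI \<equiv> uea_ideal L br"
abbreviation "UL \<equiv> uea L br"
abbreviation "\<kappa> f \<equiv> UI +>\<^bsub>FA\<^esub> f"

lemma single_closed: "w \<in> lists (carrier L) \<Longrightarrow> single w c \<in> carrier FA"
  by simp

lemma diff_closed: "f \<in> carrier FA \<Longrightarrow> g \<in> carrier FA \<Longrightarrow> f - g \<in> carrier FA"
  using keys_diff[of f g] by (simp add: subset_iff) blast

lemma sum_closed: "(\<And>i. i \<in> S \<Longrightarrow> h i \<in> carrier FA) \<Longrightarrow> sum h S \<in> carrier FA"
  using keys_sum[of h S] by (simp add: subset_iff) blast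

lemma uea_rels_subset: "uea_rels L br \<subseteq> carrier FA"
  unfolding uea_rels_def
  by (rule subsetI, elim UnE CollectE exE conjE; hypsubst; intro diff_closed single_closed;
      simp add: L_add L_smult L_br)

lemma ideal_UI: "ideal UI FA"
  unfolding uea_ideal_def by (rule ring.genideal_ideal[OF ring_free_algebra uea_rels_subset])

lemma submodule_UI: "submodule UI CC FA"
proof -
  interpret I: ideal UI FA by (rule ideal_UI)
  show ?thesis
  proof (rule submoduleI'[OF module_free_algebra])
    show "c \<odot>\<^bsub>FA\<^esub> f \<in> UI" if "f \<in> UI" for c f
      using I.I_l_closed[OF that, of "single [] c"] by (simp add: word_mult_unit)
    show "UI \<subseteq> carrier FA" by (rule I.a_subset)
  qed (use additive_subgroup.a_closed[OF I.additive_subgroup_axioms]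
      additive_subgroup.zero_closed[OF I.additive_subgroup_axioms] in auto)
qed

lemma uea_simps:
  "carrier UL = carrier (quot_space FA UI)" "add UL = add (quot_space FA UI)"
  "zero UL = zero (quot_space FA UI)" "smult UL = smult (quot_space FA UI)"
  "mult UL = rcoset_mult FA UI" "one UL = \<kappa> (one FA)"
  by (simp_all add: uea_def FactRing_def)

lemma module_uea: "module CC UL"
  by (rule module_cong_ops[OF module_quot(1)[OF module_free_algebra submodule_UI]]) (simp_all add: uea_simps)

lemma lin_map_\<kappa>: "lin_map FA UL (\<lambda>f. \<kappa> f)"
  using module_quot(2)[OF module_free_algebra submodule_UI] by (simp add: lin_map_def uea_simps)

lemma \<kappa>_mult:
  "f \<in> carrier FA \<Longrightarrow> g \<in> carrier FA \<Longrightarrow> \<kappa> f \<otimes>\<^bsub>UL\<^esub> \<kappa> g = \<kappa> (word_mult f g)"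
  using ideal.rcoset_mult_add[OF ideal_UI, of f g] by (simp add: uea_simps)

lemma foldr_uea_incl:
  assumes "\<And>r. \<delta> r \<in> carrier L"
  shows "foldr (\<lambda>r u. uea_incl L br (\<delta> r) \<otimes>\<^bsub>UL\<^esub> u) rs \<one>\<^bsub>UL\<^esub> = \<kappa> (single (map \<delta> rs) 1)"
proof (induct rs)
  case (Cons r rs)
  have "\<kappa> (single [\<delta> r] 1) \<otimes>\<^bsub>UL\<^esub> \<kappa> (single (map \<delta> rs) 1)
      = \<kappa> (word_mult (single [\<delta> r] 1) (single (map \<delta> rs) 1))"
    by (rule \<kappa>_mult) (use assms in auto)
  then show ?case using Cons by (simp add: uea_incl_def)
qed (simp add: uea_simps)

text \<open>
  The right-hand side of Mirzavaziri's formula as an element of the free algebra, with \<open>d\<^sub>r\<close> replaced by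
  arbitrary elements \<open>\<delta> r\<close>.
\<close>

definition mirz_word :: "(nat \<Rightarrow> 'x) \<Rightarrow> nat \<Rightarrow> 'x list \<Rightarrow>\<^sub>0 complex" where
  "mirz_word \<delta> k = (\<Sum>rs\<in>comps k. single (map \<delta> rs) (mirz_coeff rs))"

lemma mirz_word_0 [simp]: "mirz_word \<delta> 0 = single [] 1"
  by (simp add: mirz_word_def)

lemma mirz_word_closed:
  assumes "\<And>r. \<delta> r \<in> carrier L"
  shows "mirz_word \<delta> k \<in> carrier FA"
  unfolding mirz_word_def using assms by (intro sum_closed single_closed) auto

lemma mirz_word_rec:
  assumes "1 \<le> k"
  shows "mirz_word \<delta> k = (\<Sum>r=1..k. word_mult (single [\<delta> r] (1 / of_nat k)) (mirz_word \<delta> (k - r)))"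
  unfolding mirz_word_def sum_comps_rec[OF assms]
  unfolding word_mult_sum_right by (intro sum.cong refl) (simp only: mirz_coeff_Cons_comps word_mult_single list.map append.simps)

lemma mirz_word_image:
  assumes \<delta>: "\<And>r. \<delta> r \<in> carrier L" and k: "1 \<le> k"
  shows "(\<Oplus>\<^bsub>UL\<^esub>i\<in>{1..k}. \<Oplus>\<^bsub>UL\<^esub>rs\<in>compositions i k. mirz_coeff rs \<odot>\<^bsub>UL\<^esub>
      foldr (\<lambda>r u. uea_incl L br (\<delta> r) \<otimes>\<^bsub>UL\<^esub> u) rs \<one>\<^bsub>UL\<^esub>) = \<kappa> (mirz_word \<delta> k)"
proof -
  interpret U: module CC UL by (rule module_uea)
  let ?s = "\<lambda>rs. single (map \<delta> rs) (mirz_coeff rs)"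
  have s: "?s rs \<in> carrier FA" for rs using \<delta> by (intro single_closed) auto
  have fin: "finite (compositions i k)" for i
    by (rule finite_subset[OF compositions_subset finite_comps])
  have 1: "mirz_coeff rs \<odot>\<^bsub>UL\<^esub> foldr (\<lambda>r u. uea_incl L br (\<delta> r) \<otimes>\<^bsub>UL\<^esub> u) rs \<one>\<^bsub>UL\<^esub> = \<kappa> (?s rs)" for rs
  proof -
    have "map \<delta> rs \<in> lists (carrier L)" using \<delta> by auto
    then show ?thesis
      using lin_map_smult[OF lin_map_\<kappa> single_closed[of "map \<delta> rs" 1], of "mirz_coeff rs"]
      by (simp add: foldr_uea_incl[of \<delta>, OF \<delta>])
  qed
  have 2: "(\<Oplus>\<^bsub>UL\<^esub>rs\<in>compositions i k. \<kappa> (?s rs)) = \<kappa> (\<Sum>rs\<in>compositions i k. ?s rs)" for i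
    by (rule lin_map_free_algebra_sum[OF module_uea lin_map_\<kappa> fin s, symmetric])
  have s2: "(\<Sum>rs\<in>compositions i k. ?s rs) \<in> carrier FA" for i
    by (rule sum_closed) (rule s)
  have "(\<Oplus>\<^bsub>UL\<^esub>i\<in>{1..k}. \<kappa> (\<Sum>rs\<in>compositions i k. ?s rs)) = \<kappa> (\<Sum>i=1..k. \<Sum>rs\<in>compositions i k. ?s rs)"
    by (rule lin_map_free_algebra_sum[OF module_uea lin_map_\<kappa> finite_atLeastAtMost s2, symmetric])
  then show ?thesis unfolding 1 2 by (simp only: sum_compositions[OF k] mirz_word_def)
qed

end

text \<open>
  A representation of \<open>L\<close> on a complex vector space \<open>M\<close>. The identities are required on the carrier of
  \<open>M\<close> only.
\<close>

locale lie_rep = lie_ops L br for L :: "(complex, 'x) module" and br +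
  fixes M :: "(complex, 'v) module" and \<rho> :: "'x \<Rightarrow> 'v \<Rightarrow> 'v"
  assumes M: "module CC M"
    and \<rho>_lin: "x \<in> carrier L \<Longrightarrow> lin_map M M (\<rho> x)"
    and \<rho>_add: "x \<in> carrier L \<Longrightarrow> y \<in> carrier L \<Longrightarrow> v \<in> carrier M \<Longrightarrow> \<rho> (x \<oplus>\<^bsub>L\<^esub> y) v = \<rho> x v \<oplus>\<^bsub>M\<^esub> \<rho> y v"
    and \<rho>_smult: "x \<in> carrier L \<Longrightarrow> v \<in> carrier M \<Longrightarrow> \<rho> (c \<odot>\<^bsub>L\<^esub> x) v = c \<odot>\<^bsub>M\<^esub> \<rho> x v"
    and \<rho>_br: "x \<in> carrier L \<Longrightarrow> y \<in> carrier L \<Longrightarrow> v \<in> carrier M \<Longrightarrow>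
      \<rho> (br x y) v = \<rho> x (\<rho> y v) \<ominus>\<^bsub>M\<^esub> \<rho> y (\<rho> x v)"
begin

sublocale M: module CC M by (rule M)

text \<open>
  The action of the free algebra on \<open>M\<close>, before passing to the enveloping algebra.
\<close>

definition act :: "('x list \<Rightarrow>\<^sub>0 complex) \<Rightarrow> 'v \<Rightarrow> 'v" where
  "act f v = free_lift M (\<lambda>w. foldr \<rho> w v) f"

lemma lin_map_foldr: "w \<in> lists (carrier L) \<Longrightarrow> lin_map M M (foldr \<rho> w)"
proof (induct w)
  case Nil
  then show ?case by (simp add: lin_map_ident id_def)
next
  case (Cons x w)
  then show ?case using lin_map_comp[OF _ \<rho>_lin, of M "foldr \<rho> w" x] by (simp add: o_def)
qed

lemma act_lin:
  assumes "v \<in> carrier M"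
  shows "lin_map FA M (\<lambda>f. act f v)"
  unfolding act_def lin_map_free_algebra_iff
  using lin_map_closed[OF lin_map_foldr assms] by (intro lin_map_free_lift[OF M]) blast

lemma act_lin_right:
  assumes "f \<in> carrier FA"
  shows "lin_map M M (act f)"
  unfolding act_def[abs_def] free_lift_def
  using assms by (intro lin_map_lincomb[OF M _ lin_map_foldr M]) (simp_all add: subset_iff)

lemma act_single:
  assumes "w \<in> lists (carrier L)" "v \<in> carrier M"
  shows "act (single w c) v = c \<odot>\<^bsub>M\<^esub> foldr \<rho> w v"
  unfolding act_def using lin_map_closed[OF lin_map_foldr[OF assms(1)] assms(2)]
  by (intro free_lift_single[OF M]) simp

lemma act_mult:
  assumes v: "v \<in> carrier M" and f: "f \<in> carrier FA" and g: "g \<in> carrier FA"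
  shows "act (word_mult f g) v = act f (act g v)"
proof (rule lin_map_eq_on_span[OF module_free_algebra M _ _ span_free_algebra _ f])
  note gv = lin_map_closed[OF act_lin[OF v] g]
  show "lin_map FA M (\<lambda>f. act (word_mult f g) v)"
    by (rule lin_map_comp[OF lin_map_word_mult_left[OF g] act_lin[OF v]])
  show "lin_map FA M (\<lambda>f. act f (act g v))" by (rule act_lin[OF gv])
  fix s assume "s \<in> (\<lambda>x. single x (1::complex)) ` lists (carrier L)"
  then obtain u where u: "u \<in> lists (carrier L)" "s = single u 1" by auto
  then have s: "s \<in> carrier FA" by auto
  have "act (word_mult s g) v = act s (act g v)"
  proof (rule lin_map_eq_on_span[OF module_free_algebra M _ _ span_free_algebra _ g])
    show "lin_map FA M (\<lambda>g. act (word_mult s g) v)"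
      by (rule lin_map_comp[OF lin_map_word_mult_right[OF s] act_lin[OF v]])
    show "lin_map FA M (\<lambda>g. act s (act g v))"
      by (rule lin_map_comp[OF act_lin[OF v] act_lin_right[OF s]])
    fix t assume "t \<in> (\<lambda>x. single x (1::complex)) ` lists (carrier L)"
    then obtain w where w: "w \<in> lists (carrier L)" "t = single w 1" by auto
    have wv: "foldr \<rho> w v \<in> carrier M" "foldr \<rho> u (foldr \<rho> w v) \<in> carrier M"
      using lin_map_closed[OF lin_map_foldr] u w v by auto
    then show "t \<in> carrier FA \<and> act (word_mult s t) v = act s (act t v)"
      using u w v act_single[of "u @ w" v 1] by (simp add: act_single M.smult_one[simplified])
  qed
  with s show "s \<in> carrier FA \<and> act (word_mult s g) v = act s (act g v)" by simp
qed

lemma act_diff: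
  assumes "v \<in> carrier M" "f \<in> carrier FA" "g \<in> carrier FA"
  shows "act (f - g) v = act f v \<ominus>\<^bsub>M\<^esub> act g v"
  using lin_map_minus[OF module_free_space[of "lists (carrier L)"] M
      act_lin[OF assms(1), unfolded lin_map_free_algebra_iff], of f g] assms
  by (simp add: free_space_minus)

text \<open>
  The elements of the free algebra acting as zero form a two-sided ideal, which contains the
  defining relations and hence the ideal generated by them.
\<close>

lemma act_ideal:
  assumes "f \<in> UI" "v \<in> carrier M"
  shows "act f v = \<zero>\<^bsub>M\<^esub>"
proof -
  define J where "J = {f \<in> carrier FA. \<forall>v\<in>carrier M. act f v = \<zero>\<^bsub>M\<^esub>}"
  have "submodule J CC FA"
    unfolding J_def using act_lin lin_map_zero[OF module_free_algebra M act_lin]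
    by (intro submoduleI'[OF module_free_algebra])
      (auto simp: lin_map_add[OF act_lin, simplified] lin_map_smult[OF act_lin, simplified] M.smult_r_null[simplified]
        dest!: subsetD[OF keys_add] subsetD[OF keys_map_times])
  then have J: "subgroup J (add_monoid FA)" by (rule submodule.axioms)
  have "ideal J FA"
  proof (rule idealI[OF ring_free_algebra J])
    fix f x assume f: "f \<in> J" and x: "x \<in> carrier FA"
    then have fc: "f \<in> carrier FA" by (simp add: J_def)
    have "act (word_mult x f) v = \<zero>\<^bsub>M\<^esub>" if v: "v \<in> carrier M" for v
      using f v lin_map_zero[OF M M act_lin_right[OF x]] by (simp add: act_mult[OF v x fc] J_def)
    then show "x \<otimes>\<^bsub>FA\<^esub> f \<in> J" using fc x keys_word_mult by (simp add: J_def)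
    have "act (word_mult f x) v = \<zero>\<^bsub>M\<^esub>" if v: "v \<in> carrier M" for v
      using f lin_map_closed[OF act_lin[OF v] x] by (simp add: act_mult[OF v fc x] J_def)
    then show "f \<otimes>\<^bsub>FA\<^esub> x \<in> J" using fc x keys_word_mult by (simp add: J_def)
  qed
  moreover have "uea_rels L br \<subseteq> J"
  proof
    fix s assume s: "s \<in> uea_rels L br"
    have sc: "s \<in> carrier FA" using s uea_rels_subset by auto
    note [simp del] = free_algebra_simps and [simp] = single_closed diff_closed
    have "act s v = \<zero>\<^bsub>M\<^esub>" if v: "v \<in> carrier M" for v
    proof -
      have cl: "\<rho> x v \<in> carrier M" if "x \<in> carrier L" "v \<in> carrier M" for x v
        using lin_map_closed[OF \<rho>_lin] that .
      note one = M.smult_one[simplified]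
      from s consider (a) x y where "x \<in> carrier L" "y \<in> carrier L"
          "s = single [x \<oplus>\<^bsub>L\<^esub> y] 1 - single [x] 1 - single [y] 1"
        | (b) c x where "x \<in> carrier L" "s = single [c \<odot>\<^bsub>L\<^esub> x] 1 - single [x] c"
        | (c) x y where "x \<in> carrier L" "y \<in> carrier L"
          "s = single [x, y] 1 - single [y, x] 1 - single [br x y] 1"
        unfolding uea_rels_def by blast
      then show ?thesis
      proof cases
        case a
        then have "act s v = \<rho> (x \<oplus>\<^bsub>L\<^esub> y) v \<ominus>\<^bsub>M\<^esub> \<rho> x v \<ominus>\<^bsub>M\<^esub> \<rho> y v"
          using v L_add cl by (simp add: act_diff act_single one)
        also have "\<dots> = \<zero>\<^bsub>M\<^esub>"
          using a v cl M.a_comm[of "\<rho> x v" "\<rho> y v"]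
          by (simp add: \<rho>_add a_minus_def M.a_assoc M.r_neg M.r_neg2)
        finally show ?thesis .
      next
        case b
        then show ?thesis
          using v L_smult cl M.smult_closed by (simp add: act_diff act_single one \<rho>_smult a_minus_def M.r_neg)
      next
        case c
        then have "act s v = \<rho> x (\<rho> y v) \<ominus>\<^bsub>M\<^esub> \<rho> y (\<rho> x v) \<ominus>\<^bsub>M\<^esub> \<rho> (br x y) v"
          using v L_br cl by (simp add: act_diff act_single one)
        then show ?thesis using c v cl by (simp add: \<rho>_br a_minus_def M.r_neg)
      qed
    qed
    then show "s \<in> J" using sc by (simp add: J_def)
  qed
  ultimately have "UI \<subseteq> J" unfolding uea_ideal_def genideal_def by auto
  then show ?thesis using assms by (auto simp: J_def)
qed

lemma uea_action_coset:
  assumes "f \<in> carrier FA" "v \<in> carrier M"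
  shows "uea_action M \<rho> (\<kappa> f) v = act f v"
  unfolding uea_action_def act_def[symmetric]
  by (rule quot_lift_coset[OF module_free_algebra M submodule_UI act_lin[OF assms(2)] act_ideal[OF _ assms(2)] assms(1)])

lemma act_mirz_word_0: "v \<in> carrier M \<Longrightarrow> act (mirz_word \<delta> 0) v = v"
  by (simp add: act_single M.smult_one[simplified])

lemma act_mirz_word_rec:
  assumes \<delta>: "\<And>r. \<delta> r \<in> carrier L" and k: "1 \<le> k" and v: "v \<in> carrier M"
  shows "act (mirz_word \<delta> k) v =
    (\<Oplus>\<^bsub>M\<^esub>r\<in>{1..k}. (1 / of_nat k) \<odot>\<^bsub>M\<^esub> \<rho> (\<delta> r) (act (mirz_word \<delta> (k - r)) v))"
proof -
  let ?t = "\<lambda>r. word_mult (single [\<delta> r] (1 / of_nat k)) (mirz_word \<delta> (k - r))"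
  have s: "single [\<delta> r] (1 / of_nat k) \<in> carrier FA" for r using \<delta> by (intro single_closed) auto
  have t: "?t r \<in> carrier FA" for r
    by (rule lin_map_closed[OF lin_map_word_mult_right[OF s] mirz_word_closed[OF \<delta>]])
  note w = mirz_word_closed[of \<delta>, OF \<delta>]
  note wv = lin_map_closed[OF act_lin[OF v] w]
  have "act (mirz_word \<delta> k) v = (\<Oplus>\<^bsub>M\<^esub>r\<in>{1..k}. act (?t r) v)"
    unfolding mirz_word_rec[OF k, of \<delta>]
    by (rule lin_map_free_algebra_sum[OF M act_lin[OF v] finite_atLeastAtMost t])
  also have "\<dots> = (\<Oplus>\<^bsub>M\<^esub>r\<in>{1..k}. (1 / of_nat k) \<odot>\<^bsub>M\<^esub> \<rho> (\<delta> r) (act (mirz_word \<delta> (k - r)) v))"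
    using lin_map_closed[OF \<rho>_lin[OF \<delta>] wv] \<delta> wv M.smult_closed
    by (intro M.finsum_cong') (auto simp: act_mult[OF v s w] act_single)
  finally show ?thesis .
qed

end

section \<open>Tensor powers and the functor on pointed maps\<close>

lemmas lin_map_free_space_sum = lin_map_sum[OF module_free_space free_space_simps(2,3)]

context complex_comm_algebra
begin

abbreviation "tuples n \<equiv> {as :: 'a list. length as = Suc n}"
abbreviation "words n \<equiv> free_space (tuples n)"
abbreviation "rel n \<equiv> tensor_subspace scale n"
abbreviation "L n \<equiv> L_obj scale n"
abbreviation "pure n as \<equiv> pure_tensor scale n as"

text \<open>
  The class in \<open>A \<otimes> A\<^sup>\<otimes>\<^sup>n\<close> of a formal linear combination of tuples. Computations with sums of pure
  tensors are carried out with finite sums of such combinations.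
\<close>

definition tens :: "nat \<Rightarrow> ('a list \<Rightarrow>\<^sub>0 complex) \<Rightarrow> ('a list \<Rightarrow>\<^sub>0 complex) set" where
  "tens n f = rel n +>\<^bsub>words n\<^esub> f"

lemma pure_eq_tens: "pure n as = tens n (single as 1)"
  by (simp add: pure_tensor_def tens_def)

lemma single_words: "length as = Suc n \<Longrightarrow> single as c \<in> carrier (words n)"
  by simp

lemma sum_words: "(\<And>i. i \<in> I \<Longrightarrow> h i \<in> carrier (words n)) \<Longrightarrow> sum h I \<in> carrier (words n)"
  using keys_sum[of h I] by (simp add: subset_iff) blast

lemma diff_words: "f \<in> carrier (words n) \<Longrightarrow> g \<in> carrier (words n) \<Longrightarrow> f - g \<in> carrier (words n)"
  using keys_diff[of f g] by (simp add: subset_iff) blast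

lemma add_words: "f \<in> carrier (words n) \<Longrightarrow> g \<in> carrier (words n) \<Longrightarrow> f + g \<in> carrier (words n)"
  using order.trans[OF keys_add[of f g], of "tuples n"] by simp

lemma tensor_rels_subset: "tensor_rels scale n \<subseteq> carrier (words n)"
  unfolding tensor_rels_def
  by (rule subsetI, elim UnE CollectE exE conjE; hypsubst; intro diff_words single_words; simp)

lemma submodule_rel: "submodule (rel n) CC (words n)"
  unfolding tensor_subspace_def by (rule submodule_lin_span[OF module_free_space tensor_rels_subset])

lemma module_L: "module CC (L n)"
  unfolding L_obj_def by (rule module_quot(1)[OF module_free_space submodule_rel])

lemma lin_map_tens: "lin_map (words n) (L n) (tens n)"
  unfolding L_obj_def tens_def[abs_def] by (rule module_quot(2)[OF module_free_space submodule_rel])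

lemmas tens_closed = lin_map_closed[OF lin_map_tens]

lemma tens_sum:
  assumes "finite I" "\<And>i. i \<in> I \<Longrightarrow> h i \<in> carrier (words n)"
  shows "tens n (\<Sum>i\<in>I. h i) = (\<Oplus>\<^bsub>L n\<^esub>i\<in>I. tens n (h i))"
  by (rule lin_map_free_space_sum[OF module_L lin_map_tens assms])

lemma pure_closed: "length as = Suc n \<Longrightarrow> pure n as \<in> carrier (L n)"
  unfolding pure_eq_tens by (intro tens_closed single_words)

lemma span_L: "carrier (L n) \<subseteq> lin_span (L n) (pure n ` tuples n)"
proof -
  have "(\<lambda>as. single as (1::complex)) ` tuples n \<subseteq> carrier (words n)" by auto
  from span_quot[OF module_free_space submodule_rel span_free_space this]
  show ?thesis by (simp only: L_obj_def image_image pure_tensor_def[abs_def])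
qed

lemma lin_map_eq_on_pure:
  assumes "module CC M" "lin_map (L n) M f" "lin_map (L n) M g"
    and "\<And>as. length as = Suc n \<Longrightarrow> f (pure n as) = g (pure n as)" "X \<in> carrier (L n)"
  shows "f X = g X"
  by (rule lin_map_eq_on_span[OF module_L assms(1-3) span_L _ assms(5)]) (auto simp: assms(4) pure_closed)

lemma tens_eqI:
  assumes "f \<in> carrier (words n)" "g \<in> carrier (words n)" "f - g \<in> rel n"
  shows "tens n f = tens n g"
  unfolding tens_def using assms free_space_minus[OF assms(1,2)]
  by (intro coset_eqI[OF module_free_space submodule_rel]) auto

lemma tensor_rels_in: "tensor_rels scale n \<subseteq> rel n"
  unfolding tensor_subspace_def by (rule lin_span_incl)

lemma rel_add:
  assumes "length as = Suc n" "i \<le> n"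
  shows "single (as[i := x + y]) 1
    - single (as[i := x]) 1 - single (as[i := y]) 1 \<in> rel n"
  by (rule subsetD[OF tensor_rels_in], unfold tensor_rels_def, rule UnI1, rule CollectI, intro exI conjI)
    (rule refl assms)+

lemma rel_scale:
  assumes "length as = Suc n" "i \<le> n"
  shows "single (as[i := scale c x]) 1 - single (as[i := x]) c \<in> rel n"
  by (rule subsetD[OF tensor_rels_in], unfold tensor_rels_def, rule UnI2, rule CollectI, intro exI conjI)
    (rule refl assms)+

lemma tens_add:
  assumes "length as = Suc n" "i \<le> n"
  shows "tens n (single (as[i := x + y]) 1) =
    tens n (single (as[i := x]) 1 + single (as[i := y]) 1)"
proof (rule tens_eqI)
  show "single (as[i := x]) 1 + single (as[i := y]) 1 \<in> carrier (words n)"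
    using assms by (intro add_words single_words) simp_all
  show "single (as[i := x + y]) 1 -
    (single (as[i := x]) 1 + single (as[i := y]) 1) \<in> rel n"
    unfolding diff_diff_eq[symmetric] by (rule rel_add[OF assms])
qed (use assms in simp)

lemma tens_scale:
  assumes "length as = Suc n" "i \<le> n"
  shows "tens n (single (as[i := scale c x]) 1) = tens n (single (as[i := x]) c)"
proof (rule tens_eqI)
  show "single (as[i := scale c x]) 1 - single (as[i := x]) c \<in> rel n"
    by (rule rel_scale[OF assms])
qed (use assms in simp_all)

lemma tens_sum_entry:
  assumes "length as = Suc n" "i \<le> n" "finite S"
  shows "tens n (single (as[i := (\<Sum>s\<in>S. x s)]) 1) =
    tens n (\<Sum>s\<in>S. single (as[i := x s]) 1)"
  using assms(3)
proof induct
  case empty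
  then show ?case using tens_scale[OF assms(1,2), of 0 0] by simp
next
  case (insert s S)
  have w: "single (as[i := z]) 1 \<in> carrier (words n)" for z
    using assms(1) by (intro single_words) simp
  have "tens n (single (as[i := (\<Sum>s\<in>insert s S. x s)]) 1) =
      tens n (single (as[i := x s]) 1 + single (as[i := (\<Sum>s\<in>S. x s)]) 1)"
    using insert tens_add[OF assms(1,2)] by simp
  also have "\<dots> = tens n (single (as[i := x s]) 1) \<oplus>\<^bsub>L n\<^esub> tens n (\<Sum>s\<in>S. single (as[i := x s]) 1)"
    using insert lin_map_add[OF lin_map_tens w w] by simp
  also have "\<dots> = tens n (single (as[i := x s]) 1 + (\<Sum>s\<in>S. single (as[i := x s]) 1))"
    using lin_map_add[OF lin_map_tens w sum_words[OF w], of "x s" x S] by simp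
  finally show ?case using insert by simp
qed

lemma tens_diff_entry:
  assumes "length as = Suc n" "i \<le> n"
  shows "tens n (single (as[i := x - y]) 1) =
    tens n (single (as[i := x]) 1 - single (as[i := y]) 1)"
proof (rule tens_eqI)
  have "single (as[i := (x - y) + y]) 1 - single (as[i := x - y]) 1
      - single (as[i := y]) 1 \<in> rel n"
    by (rule rel_add[OF assms])
  then have "(-1) \<odot>\<^bsub>words n\<^esub> (single (as[i := x]) 1 - single (as[i := x - y]) 1
      - single (as[i := y]) 1) \<in> rel n"
    by (intro submoduleD(4)[OF module_free_space submodule_rel]) simp
  moreover have "Poly_Mapping.map ((*) (-1)) f = - f" for f :: "'a list \<Rightarrow>\<^sub>0 complex"
    by (rule poly_mapping_eqI) simp
  ultimately show "single (as[i := x - y]) 1 -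
    (single (as[i := x]) 1 - single (as[i := y]) 1) \<in> rel n"
    by (simp add: algebra_simps)
qed (use assms in \<open>auto intro!: diff_words simp del: free_space_simps simp: single_words\<close>)

lemma pure_add:
  assumes "length as = Suc n" "i \<le> n"
  shows "pure n (as[i := x + y]) = pure n (as[i := x]) \<oplus>\<^bsub>L n\<^esub> pure n (as[i := y])"
  using assms lin_map_add[OF lin_map_tens single_words single_words, of "as[i := x]" n "as[i := y]" 1 1]
  by (simp add: pure_eq_tens tens_add)

lemma pure_scale:
  assumes "length as = Suc n" "i \<le> n"
  shows "pure n (as[i := scale c x]) = c \<odot>\<^bsub>L n\<^esub> pure n (as[i := x])"
  using assms lin_map_smult[OF lin_map_tens single_words, of "as[i := x]" n c 1]
  by (simp add: pure_eq_tens tens_scale)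

lemma
  assumes M: "module CC M" and g: "\<And>as. length as = Suc n \<Longrightarrow> g as \<in> carrier M"
    and add: "\<And>as i x y. length as = Suc n \<Longrightarrow> i \<le> n \<Longrightarrow>
      g (as[i := x + y]) = g (as[i := x]) \<oplus>\<^bsub>M\<^esub> g (as[i := y])"
    and smult: "\<And>as i c x. length as = Suc n \<Longrightarrow> i \<le> n \<Longrightarrow> g (as[i := scale c x]) = c \<odot>\<^bsub>M\<^esub> g (as[i := x])"
  shows lin_map_tensor_lift: "lin_map (L n) M (tensor_lift M g)"
    and tensor_lift_pure: "length as = Suc n \<Longrightarrow> tensor_lift M g (pure n as) = g as"
proof -
  interpret M: module CC M by (rule M)
  have lin: "lin_map (words n) M (free_lift M g)"
    using g by (intro lin_map_free_lift[OF M]) auto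
  have fs: "free_lift M g (single as c) = c \<odot>\<^bsub>M\<^esub> g as" if "length as = Suc n" for as c
    using that by (intro free_lift_single[OF M] g)
  have fd: "free_lift M g (f - h) = free_lift M g f \<ominus>\<^bsub>M\<^esub> free_lift M g h"
    if "f \<in> carrier (words n)" "h \<in> carrier (words n)" for f h
    using lin_map_minus[OF module_free_space M lin that] free_space_minus[OF that] by simp
  have "free_lift M g w = \<zero>\<^bsub>M\<^esub>" if "w \<in> tensor_rels scale n" for w
  proof -
    note [simp del] = free_space_simps and [simp] = single_words diff_words
    from that consider (a) as i x y where "length as = Suc n" "i \<le> n"
        "w = single (as[i := x + y]) 1
          - single (as[i := x]) 1 - single (as[i := y]) 1"
      | (b) as i c x where "length as = Suc n" "i \<le> n"
        "w = single (as[i := scale c x]) 1 - single (as[i := x]) c"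
      unfolding tensor_rels_def by blast
    then show ?thesis
    proof cases
      case a
      have cl: "g (as[i := x]) \<in> carrier M" "g (as[i := y]) \<in> carrier M" using a g by auto
      then show ?thesis using a M.a_comm[OF cl]
        by (simp add: fd fs M.smult_one[simplified] g add a_minus_def M.a_assoc M.r_neg M.r_neg2)
    next
      case b
      have cl: "g (as[i := x]) \<in> carrier M" using b g by auto
      then show ?thesis using b M.smult_closed[of c, OF _ cl]
        by (simp add: fd fs M.smult_one[simplified] g smult a_minus_def M.r_neg)
    qed
  qed
  then have van: "free_lift M g w = \<zero>\<^bsub>M\<^esub>" if "w \<in> rel n" for w
    using tensor_rels_subset
    by (intro vanish_on_span[OF module_free_space M lin _ that[unfolded tensor_subspace_def]]) blast
  show "lin_map (L n) M (tensor_lift M g)"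
    unfolding tensor_lift_def L_obj_def
    by (rule lin_map_quot_lift[OF module_free_space M submodule_rel lin van])
  show "tensor_lift M g (pure n as) = g as" if "length as = Suc n"
    unfolding tensor_lift_def pure_tensor_def
    using quot_lift_coset[OF module_free_space M submodule_rel lin van single_words[OF that, of 1]] that
    by (simp add: fs g M.smult_one[simplified])
qed

text \<open>
  A multilinear map need not be checked to be multilinear if a linear map with the right values on
  pure tensors is already at hand.
\<close>

lemma tensor_lift_eqI:
  assumes M: "module CC M" and T: "lin_map (L n) M T"
    and g: "\<And>as. length as = Suc n \<Longrightarrow> T (pure n as) = g as" and X: "X \<in> carrier (L n)"
  shows "tensor_lift M g X = T X"
proof -
  interpret M: module CC M by (rule M)
  have gc: "g as \<in> carrier M" if "length as = Suc n" for as
    using lin_map_closed[OF T pure_closed[OF that]] g[OF that] by simp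
  have lin: "lin_map (words n) M (free_lift M g)"
    using gc by (intro lin_map_free_lift[OF M]) auto
  have linT: "lin_map (words n) M (\<lambda>f. T (tens n f))" by (rule lin_map_comp[OF lin_map_tens T])
  have fs: "free_lift M g (single as 1) = T (tens n (single as 1))"
    if "length as = Suc n" for as
    using free_lift_single[where g = g, OF M gc[OF that], of 1] gc[OF that] g[OF that]
    by (simp add: pure_eq_tens M.smult_one[simplified])
  have eq: "free_lift M g f = T (tens n f)" if "f \<in> carrier (words n)" for f
    by (rule lin_map_eq_on_span[OF module_free_space M lin linT span_free_space _ that])
      (auto simp: fs)
  have van: "free_lift M g w = \<zero>\<^bsub>M\<^esub>" if w: "w \<in> rel n" for w
  proof -
    have wc: "w \<in> carrier (words n)" using submoduleD(1)[OF module_free_space submodule_rel] w by blast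
    have "tens n w = tens n 0" using w wc by (intro tens_eqI) auto
    then show ?thesis using eq[OF wc] lin_map_zero[OF module_free_space M linT] by simp
  qed
  obtain f where f: "f \<in> carrier (words n)" "X = tens n f"
    using X unfolding L_obj_def tens_def quot_simps by auto
  have "quot_lift (free_lift M g) X = free_lift M g f"
    unfolding f(2) tens_def by (rule quot_lift_coset[OF module_free_space M submodule_rel lin van f(1)])
  then show ?thesis using eq[OF f(1)] by (simp only: tensor_lift_def f(2))
qed

text \<open>
  The tuple \<open>(b\<^sub>0, \<dots>, b\<^sub>n)\<close> with \<open>b\<^sub>j\<close> the product of the \<open>a\<^sub>i\<close> over \<open>\<phi>(i) = j\<close>.
\<close>

definition push :: "nat \<Rightarrow> nat \<Rightarrow> (nat \<Rightarrow> nat) \<Rightarrow> 'a list \<Rightarrow> 'a list" where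
  "push m n \<phi> as = map (\<lambda>j. \<Prod>i | i \<le> m \<and> \<phi> i = j. as ! i) [0..<Suc n]"

lemma length_push [simp]: "length (push m n \<phi> as) = Suc n"
  by (simp add: push_def)

lemma nth_push: "j \<le> n \<Longrightarrow> push m n \<phi> as ! j = (\<Prod>i | i \<le> m \<and> \<phi> i = j. as ! i)"
  by (simp add: push_def del: upt_Suc)

text \<open>
  The product of the factors other than \<open>a\<^sub>i\<close> in the entry of \<open>push m n \<phi> as\<close> to which \<open>a\<^sub>i\<close> contributes.
\<close>

definition cofactor :: "nat \<Rightarrow> (nat \<Rightarrow> nat) \<Rightarrow> 'a list \<Rightarrow> nat \<Rightarrow> 'a" where
  "cofactor m \<phi> as i = (\<Prod>i'\<in>{i'. i' \<le> m \<and> \<phi> i' = \<phi> i} - {i}. as ! i')"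

lemma push_update:
  assumes "length as = Suc m" "i \<le> m" "\<phi> \<in> Gamma_hom m n"
  shows "push m n \<phi> (as[i := x]) = (push m n \<phi> as)[\<phi> i := x * cofactor m \<phi> as i]"
proof (rule nth_equalityI)
  fix j assume "j < length (push m n \<phi> (as[i := x]))"
  then have j: "j \<le> n" by simp
  show "push m n \<phi> (as[i := x]) ! j = (push m n \<phi> as)[\<phi> i := x * cofactor m \<phi> as i] ! j"
  proof (cases "j = \<phi> i")
    case True
    let ?A = "{i'. i' \<le> m \<and> \<phi> i' = \<phi> i}"
    have "(\<Prod>i'\<in>?A. as[i := x] ! i') = as[i := x] ! i * (\<Prod>i'\<in>?A - {i}. as[i := x] ! i')"
      using assms(2) by (intro prod.remove) auto
    also have "(\<Prod>i'\<in>?A - {i}. as[i := x] ! i') = cofactor m \<phi> as i"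
      unfolding cofactor_def by (rule prod.cong) auto
    finally show ?thesis using True j assms by (simp add: nth_push)
  next
    case False
    have "(\<Prod>i' | i' \<le> m \<and> \<phi> i' = j. as[i := x] ! i') = (\<Prod>i' | i' \<le> m \<and> \<phi> i' = j. as ! i')"
      by (intro prod.cong refl nth_list_update_neq) (use False in auto)
    then show ?thesis using False j by (simp add: nth_push)
  qed
qed simp

lemma Gamma_hom_le: "\<phi> \<in> Gamma_hom m n \<Longrightarrow> i \<le> m \<Longrightarrow> \<phi> i \<le> n"
  by (auto simp: Gamma_hom_def pointed_maps_def)

lemma
  assumes "\<phi> \<in> Gamma_hom m n"
  shows lin_map_L_map: "lin_map (L m) (L n) (L_map scale m n \<phi>)"
    and L_map_pure: "length as = Suc m \<Longrightarrow> L_map scale m n \<phi> (pure m as) = pure n (push m n \<phi> as)"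
proof -
  have 1: "pure n (push m n \<phi> (as[i := x + y])) = pure n (push m n \<phi> (as[i := x])) \<oplus>\<^bsub>L n\<^esub> pure n (push m n \<phi> (as[i := y]))"
    if "length as = Suc m" "i \<le> m" for as i x y
    using that assms Gamma_hom_le[OF assms] by (simp add: push_update distrib_right pure_add)
  have 2: "pure n (push m n \<phi> (as[i := scale c x])) = c \<odot>\<^bsub>L n\<^esub> pure n (push m n \<phi> (as[i := x]))"
    if "length as = Suc m" "i \<le> m" for as i c x
    using that assms Gamma_hom_le[OF assms] by (simp add: push_update scale_mult_left pure_scale)
  show "lin_map (L m) (L n) (L_map scale m n \<phi>)"
    unfolding L_map_def push_def[symmetric] by (rule lin_map_tensor_lift[OF module_L _ 1 2]) (simp_all add: pure_closed)
  show "L_map scale m n \<phi> (pure m as) = pure n (push m n \<phi> as)" if "length as = Suc m"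
    unfolding L_map_def push_def[symmetric] using that
    by (intro tensor_lift_pure[OF module_L _ 1 2]) (simp_all add: pure_closed)
qed

lemma
  assumes d: "derivation scale d"
  shows lin_map_L_der: "lin_map (L n) (L n) (L_der scale d n)"
    and L_der_pure: "length as = Suc n \<Longrightarrow>
      L_der scale d n (pure n as) = tens n (\<Sum>i\<le>n. single (as[i := d (as ! i)]) 1)"
proof -
  interpret Ln: module CC "L n" by (rule module_L)
  let ?g = "\<lambda>as. \<Oplus>\<^bsub>L n\<^esub>i\<in>{0..n}. pure n (as[i := d (as ! i)])"
  have g: "?g as \<in> carrier (L n)" if "length as = Suc n" for as
    using that by (intro Ln.finsum_closed) (auto simp: pure_closed)
  have upd: "pure n ((as[j := z])[i := d (as[j := z] ! i)]) =
      (if i = j then pure n (as[j := d z]) else pure n ((as[i := d (as ! i)])[j := z]))"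
    if "length as = Suc n" "i \<le> n" "j \<le> n" for as i j z
    using that by (simp add: list_update_swap)
  have 1: "?g (as[j := x + y]) = ?g (as[j := x]) \<oplus>\<^bsub>L n\<^esub> ?g (as[j := y])"
    if as: "length as = Suc n" "j \<le> n" for as j x y
  proof -
    have "?g (as[j := x + y]) =
        (\<Oplus>\<^bsub>L n\<^esub>i\<in>{0..n}. pure n ((as[j := x])[i := d (as[j := x] ! i)]) \<oplus>\<^bsub>L n\<^esub>
          pure n ((as[j := y])[i := d (as[j := y] ! i)]))"
      using as by (intro Ln.finsum_cong')
        (auto simp: upd pure_closed derivationD[OF d] pure_add simp del: list_update_overwrite nth_list_update)
    also have "\<dots> = ?g (as[j := x]) \<oplus>\<^bsub>L n\<^esub> ?g (as[j := y])"
      using as by (intro Ln.finsum_addf) (auto simp: pure_closed)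
    finally show ?thesis .
  qed
  have 2: "?g (as[j := scale c x]) = c \<odot>\<^bsub>L n\<^esub> ?g (as[j := x])"
    if as: "length as = Suc n" "j \<le> n" for as j c x
  proof -
    have "?g (as[j := scale c x]) = (\<Oplus>\<^bsub>L n\<^esub>i\<in>{0..n}. c \<odot>\<^bsub>L n\<^esub> pure n ((as[j := x])[i := d (as[j := x] ! i)]))"
      using as Ln.smult_closed by (intro Ln.finsum_cong')
        (auto simp: upd pure_closed derivationD[OF d] pure_scale simp del: list_update_overwrite nth_list_update)
    also have "\<dots> = c \<odot>\<^bsub>L n\<^esub> ?g (as[j := x])"
      using as by (intro module_finsum_smult[OF module_L, symmetric]) (auto simp: pure_closed)
    finally show ?thesis .
  qed
  show "lin_map (L n) (L n) (L_der scale d n)"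
    unfolding L_der_def by (rule lin_map_tensor_lift[OF module_L g 1 2])
  show "L_der scale d n (pure n as) = tens n (\<Sum>i\<le>n. single (as[i := d (as ! i)]) 1)"
    if as: "length as = Suc n"
  proof -
    have "L_der scale d n (pure n as) = ?g as"
      unfolding L_der_def by (rule tensor_lift_pure[OF module_L g 1 2 as])
    also have "\<dots> = tens n (\<Sum>i\<in>{0..n}. single (as[i := d (as ! i)]) 1)"
      unfolding pure_eq_tens using as by (intro tens_sum[symmetric]) (simp_all add: single_words del: free_space_simps)
    finally show ?thesis by (simp add: atMost_atLeast0)
  qed
qed

lemma lin_map_tens_singles:
  assumes "module CC M" "lin_map (L n) M T" "finite S" "\<And>s. s \<in> S \<Longrightarrow> length (as s) = Suc n"
  shows "T (tens n (\<Sum>s\<in>S. single (as s) 1)) = (\<Oplus>\<^bsub>M\<^esub>s\<in>S. T (pure n (as s)))"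
  unfolding pure_eq_tens
  by (rule lin_map_free_space_sum[OF assms(1) lin_map_comp[OF lin_map_tens assms(2)] assms(3)])
    (rule single_words[OF assms(4)])

lemma L_der_tens:
  assumes "derivation scale d" "finite S" "\<And>s. s \<in> S \<Longrightarrow> length (as s) = Suc n"
  shows "L_der scale d n (tens n (\<Sum>s\<in>S. single (as s) 1)) =
    tens n (\<Sum>s\<in>S. \<Sum>i\<le>n. single ((as s)[i := d (as s ! i)]) 1)"
proof -
  interpret Ln: module CC "L n" by (rule module_L)
  have w: "(\<Sum>i\<le>n. single ((as s)[i := d (as s ! i)]) 1) \<in> carrier (words n)" if "s \<in> S" for s
    using assms(3)[OF that] by (intro sum_words single_words) simp
  have "L_der scale d n (tens n (\<Sum>s\<in>S. single (as s) 1)) = (\<Oplus>\<^bsub>L n\<^esub>s\<in>S. L_der scale d n (pure n (as s)))"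
    by (rule lin_map_tens_singles[OF module_L lin_map_L_der[OF assms(1)] assms(2,3)])
  also have "\<dots> = (\<Oplus>\<^bsub>L n\<^esub>s\<in>S. tens n (\<Sum>i\<le>n. single ((as s)[i := d (as s ! i)]) 1))"
    using assms(3) tens_closed[OF w] by (intro Ln.finsum_cong') (auto simp: L_der_pure[OF assms(1)])
  also have "\<dots> = tens n (\<Sum>s\<in>S. \<Sum>i\<le>n. single ((as s)[i := d (as s ! i)]) 1)"
    by (rule tens_sum[OF assms(2) w, symmetric])
  finally show ?thesis .
qed

lemma derivation_one: "derivation scale d \<Longrightarrow> d 1 = 0"
  using derivationD(3)[of scale d 1 1] by simp

lemma derivation_prod:
  assumes "derivation scale d" "finite S"
  shows "d (\<Prod>i\<in>S. a i) = (\<Sum>i\<in>S. d (a i) * (\<Prod>i'\<in>S - {i}. a i'))"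
  using assms(2)
proof induct
  case empty
  then show ?case by (simp add: derivation_one[OF assms(1)])
next
  case (insert s S)
  have "(\<Prod>i'\<in>insert s S - {i}. a i') = a s * (\<Prod>i'\<in>S - {i}. a i')" if "i \<in> S" for i
  proof -
    have "insert s S - {i} = insert s (S - {i})" using insert that by auto
    then show ?thesis using insert by simp
  qed
  then have "(\<Sum>i\<in>S. d (a i) * (\<Prod>i'\<in>insert s S - {i}. a i')) = a s * (\<Sum>i\<in>S. d (a i) * (\<Prod>i'\<in>S - {i}. a i'))"
    by (simp add: sum_distrib_left mult_ac)
  then show ?case using insert by (simp add: derivationD[OF assms(1)])
qed

text \<open>
  Endomorphisms of the functor \<open>\<L>(A)\<close>: natural families of linear maps, all conditions being
  required on the carriers only.
\<close>

definition nat_endo :: "(nat \<Rightarrow> ('a list \<Rightarrow>\<^sub>0 complex) set \<Rightarrow> ('a list \<Rightarrow>\<^sub>0 complex) set) \<Rightarrow> bool" where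
  "nat_endo \<alpha> \<longleftrightarrow> (\<forall>n. lin_map (L n) (L n) (\<alpha> n)) \<and>
     (\<forall>m n. \<forall>\<phi>\<in>Gamma_hom m n. \<forall>X\<in>carrier (L m).
        \<alpha> n (L_map scale m n \<phi> X) = L_map scale m n \<phi> (\<alpha> m X))"

text \<open>
  Naturality of \<open>L\<^sub>d\<close> is the Leibniz rule for \<open>d\<close> applied to the products \<open>b\<^sub>j\<close>, the terms being
  collected according to the value of \<open>\<phi>\<close>; the empty product is covered by \<open>d 1 = 0\<close>.
\<close>

lemma nat_endo_L_der:
  assumes d: "derivation scale d"
  shows "nat_endo (L_der scale d)"
  unfolding nat_endo_def
proof (intro conjI allI ballI)
  show "lin_map (L n) (L n) (L_der scale d n)" for n by (rule lin_map_L_der[OF d])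
  fix m n \<phi> X assume \<phi>: "\<phi> \<in> Gamma_hom m n" and X: "X \<in> carrier (L m)"
  note lm = lin_map_L_map[OF \<phi>]
  interpret Ln: module CC "L n" by (rule module_L)
  show "L_der scale d n (L_map scale m n \<phi> X) = L_map scale m n \<phi> (L_der scale d m X)"
  proof (rule lin_map_eq_on_pure[OF module_L lin_map_comp[OF lm lin_map_L_der[OF d]] lin_map_comp[OF lin_map_L_der[OF d] lm] _ X])
    fix as :: "'a list" assume as: "length as = Suc m"
    let ?bs = "push m n \<phi> as"
    let ?s = "\<lambda>i. single (?bs[\<phi> i := d (as ! i) * cofactor m \<phi> as i]) (1::complex)"
    have ws: "?s i \<in> carrier (words n)" for i by (rule single_words) simp
    have "L_map scale m n \<phi> (L_der scale d m (pure m as)) =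
        (\<Oplus>\<^bsub>L n\<^esub>i\<in>{..m}. L_map scale m n \<phi> (pure m (as[i := d (as ! i)])))"
      unfolding L_der_pure[OF d as] using as by (intro lin_map_tens_singles[OF module_L lm]) auto
    also have "\<dots> = (\<Oplus>\<^bsub>L n\<^esub>i\<in>{..m}. tens n (?s i))"
      using as tens_closed[OF ws]
      by (intro Ln.finsum_cong') (simp_all add: L_map_pure[OF \<phi>] push_update[OF _ _ \<phi>] pure_eq_tens[symmetric])
    also have "\<dots> = tens n (\<Sum>i\<le>m. ?s i)" by (intro tens_sum[symmetric] ws) simp
    also have "(\<Sum>i\<le>m. ?s i) = (\<Sum>j\<le>n. \<Sum>i | i \<in> {..m} \<and> \<phi> i = j. ?s i)"
      using Gamma_hom_le[OF \<phi>] by (intro sum.group[symmetric]) auto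
    also have "tens n \<dots> = (\<Oplus>\<^bsub>L n\<^esub>j\<in>{..n}. tens n (\<Sum>i | i \<in> {..m} \<and> \<phi> i = j. ?s i))"
      by (intro tens_sum sum_words ws) simp
    also have "\<dots> = (\<Oplus>\<^bsub>L n\<^esub>j\<in>{..n}. tens n (single (?bs[j := d (?bs ! j)]) 1))"
    proof (rule Ln.finsum_cong')
      fix j assume j: "j \<in> {..n}"
      have "d (?bs ! j) = (\<Sum>i | i \<in> {..m} \<and> \<phi> i = j. d (as ! i) * cofactor m \<phi> as i)"
        using j unfolding cofactor_def by (simp add: nth_push derivation_prod[OF d])
      then have "tens n (single (?bs[j := d (?bs ! j)]) 1) =
          tens n (\<Sum>i | i \<in> {..m} \<and> \<phi> i = j. single (?bs[j := d (as ! i) * cofactor m \<phi> as i]) 1)"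
        using j by (simp add: tens_sum_entry)
      also have "(\<Sum>i | i \<in> {..m} \<and> \<phi> i = j. single (?bs[j := d (as ! i) * cofactor m \<phi> as i]) 1) =
          (\<Sum>i | i \<in> {..m} \<and> \<phi> i = j. ?s i)" by (rule sum.cong) auto
      finally show "tens n (\<Sum>i | i \<in> {..m} \<and> \<phi> i = j. ?s i) = tens n (single (?bs[j := d (?bs ! j)]) 1)" ..
    qed (auto intro!: tens_closed single_words simp del: free_space_simps)
    also have "\<dots> = tens n (\<Sum>j\<le>n. single (?bs[j := d (?bs ! j)]) 1)"
      by (intro tens_sum[symmetric] single_words) simp_all
    also have "\<dots> = L_der scale d n (L_map scale m n \<phi> (pure m as))"
      by (simp add: L_map_pure[OF \<phi> as] L_der_pure[OF d])
    finally show "L_der scale d n (L_map scale m n \<phi> (pure m as)) = L_map scale m n \<phi> (L_der scale d m (pure m as))" ..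
  qed
qed

lemma nat_endo_ident: "nat_endo (\<lambda>n X. X)"
  by (simp add: nat_endo_def lin_map_ident)

lemma nat_endo_lincomb:
  assumes "finite I" "\<And>i. i \<in> I \<Longrightarrow> nat_endo (\<beta> i)" "\<And>i. i \<in> I \<Longrightarrow> nat_endo (\<gamma> i)"
    and eq: "\<And>n X. X \<in> carrier (L n) \<Longrightarrow> \<alpha> n X = (\<Oplus>\<^bsub>L n\<^esub>i\<in>I. c i \<odot>\<^bsub>L n\<^esub> \<beta> i n (\<gamma> i n X))"
  shows "nat_endo \<alpha>"
proof -
  have lin: "lin_map (L n) (L n) (\<lambda>X. \<beta> i n (\<gamma> i n X))" if "i \<in> I" for i n
    using assms(2,3)[OF that] lin_map_comp unfolding nat_endo_def by blast
  have lin\<alpha>: "lin_map (L n) (L n) (\<alpha> n)" for n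
    by (rule lin_map_cong[OF module_L lin_map_lincomb[OF module_L assms(1) lin module_L]]) (simp_all add: eq)
  have "\<alpha> n (L_map scale m n \<phi> X) = L_map scale m n \<phi> (\<alpha> m X)"
    if \<phi>: "\<phi> \<in> Gamma_hom m n" and X: "X \<in> carrier (L m)" for m n \<phi> X
  proof -
    interpret Lm: module CC "L m" by (rule module_L)
    interpret Ln: module CC "L n" by (rule module_L)
    note lm = lin_map_L_map[OF \<phi>]
    have cl: "\<beta> i m (\<gamma> i m X) \<in> carrier (L m)" if "i \<in> I" for i by (rule lin_map_closed[OF lin[OF that] X])
    have nat: "\<beta> i n (\<gamma> i n (L_map scale m n \<phi> X)) = L_map scale m n \<phi> (\<beta> i m (\<gamma> i m X))" if "i \<in> I" for i
      using assms(2,3)[OF that] \<phi> X lin_map_closed unfolding nat_endo_def by (metis (no_types, lifting))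
    have "L_map scale m n \<phi> (\<alpha> m X) = (\<Oplus>\<^bsub>L n\<^esub>i\<in>I. L_map scale m n \<phi> (c i \<odot>\<^bsub>L m\<^esub> \<beta> i m (\<gamma> i m X)))"
      unfolding eq[OF X] using cl Lm.smult_closed by (intro lin_map_finsum[OF module_L module_L lm assms(1)]) auto
    also have "\<dots> = (\<Oplus>\<^bsub>L n\<^esub>i\<in>I. c i \<odot>\<^bsub>L n\<^esub> \<beta> i n (\<gamma> i n (L_map scale m n \<phi> X)))"
      using cl lin_map_closed[OF lm cl] Ln.smult_closed
      by (intro Ln.finsum_cong') (auto simp: lin_map_smult[OF lm] nat)
    finally show ?thesis using eq[OF lin_map_closed[OF lm X]] by simp
  qed
  with lin\<alpha> show ?thesis by (simp add: nat_endo_def)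
qed

section \<open>The relations between the endomorphisms\<close>

lemma L_der_lincomb:
  assumes S: "finite S" and \<delta>: "\<And>s. s \<in> S \<Longrightarrow> derivation scale (\<delta> s)"
    and d: "derivation scale (\<lambda>a. \<Sum>s\<in>S. scale (c s) (\<delta> s a))" and X: "X \<in> carrier (L n)"
  shows "L_der scale (\<lambda>a. \<Sum>s\<in>S. scale (c s) (\<delta> s a)) n X = (\<Oplus>\<^bsub>L n\<^esub>s\<in>S. c s \<odot>\<^bsub>L n\<^esub> L_der scale (\<delta> s) n X)"
proof (rule lin_map_eq_on_pure[OF module_L lin_map_L_der[OF d]
      lin_map_lincomb[OF module_L S lin_map_L_der[OF \<delta>] module_L] _ X])
  fix as :: "'a list" assume as: "length as = Suc n"
  interpret Ln: module CC "L n" by (rule module_L)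
  let ?s = "\<lambda>c s i. single (as[i := \<delta> s (as ! i)]) (c::complex)"
  have w: "?s c s i \<in> carrier (words n)" for c s i using as by (intro single_words) simp
  have entry: "tens n (single (as[i := (\<Sum>s\<in>S. scale (c s) (\<delta> s (as ! i)))]) 1) = tens n (\<Sum>s\<in>S. ?s (c s) s i)"
    if i: "i \<le> n" for i
  proof -
    have "tens n (single (as[i := (\<Sum>s\<in>S. scale (c s) (\<delta> s (as ! i)))]) 1) =
        (\<Oplus>\<^bsub>L n\<^esub>s\<in>S. tens n (single (as[i := scale (c s) (\<delta> s (as ! i))]) 1))"
      unfolding tens_sum_entry[OF as i S] using as by (intro tens_sum[OF S] single_words) simp
    also have "\<dots> = (\<Oplus>\<^bsub>L n\<^esub>s\<in>S. tens n (?s (c s) s i))"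
      by (intro Ln.finsum_cong' refl funcsetI tens_closed w) (simp only: tens_scale[OF as i])
    also have "\<dots> = tens n (\<Sum>s\<in>S. ?s (c s) s i)" by (rule tens_sum[OF S w, symmetric])
    finally show ?thesis .
  qed
  have smult: "tens n (\<Sum>i\<le>n. ?s (c s) s i) = c s \<odot>\<^bsub>L n\<^esub> tens n (\<Sum>i\<le>n. ?s 1 s i)" for s
  proof -
    have "c s \<odot>\<^bsub>words n\<^esub> (\<Sum>i\<le>n. ?s 1 s i) = (\<Sum>i\<le>n. ?s (c s) s i)"
      by (auto simp: poly_mapping_eq_iff fun_eq_iff lookup_sum lookup_single sum_distrib_left when_def intro!: sum.cong)
    moreover have "(\<Sum>i\<le>n. ?s 1 s i) \<in> carrier (words n)" by (intro sum_words w)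
    ultimately show ?thesis using lin_map_smult[OF lin_map_tens, of "\<Sum>i\<le>n. ?s 1 s i" n "c s"] by (simp only:)
  qed
  have "L_der scale (\<lambda>a. \<Sum>s\<in>S. scale (c s) (\<delta> s a)) n (pure n as) =
      (\<Oplus>\<^bsub>L n\<^esub>i\<in>{..n}. tens n (single (as[i := (\<Sum>s\<in>S. scale (c s) (\<delta> s (as ! i)))]) 1))"
    unfolding L_der_pure[OF d as] using as by (intro tens_sum single_words) simp_all
  also have "\<dots> = (\<Oplus>\<^bsub>L n\<^esub>i\<in>{..n}. tens n (\<Sum>s\<in>S. ?s (c s) s i))"
    by (intro Ln.finsum_cong' refl funcsetI tens_closed sum_words w) (simp add: entry)
  also have "\<dots> = tens n (\<Sum>i\<le>n. \<Sum>s\<in>S. ?s (c s) s i)" by (intro tens_sum[symmetric] sum_words w) simp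
  also have "(\<Sum>i\<le>n. \<Sum>s\<in>S. ?s (c s) s i) = (\<Sum>s\<in>S. \<Sum>i\<le>n. ?s (c s) s i)" by (rule sum.swap)
  also have "tens n \<dots> = (\<Oplus>\<^bsub>L n\<^esub>s\<in>S. tens n (\<Sum>i\<le>n. ?s (c s) s i))" by (intro tens_sum[OF S] sum_words w)
  also have "\<dots> = (\<Oplus>\<^bsub>L n\<^esub>s\<in>S. c s \<odot>\<^bsub>L n\<^esub> L_der scale (\<delta> s) n (pure n as))"
  proof (rule Ln.finsum_cong'[OF refl])
    show "(\<lambda>s. c s \<odot>\<^bsub>L n\<^esub> L_der scale (\<delta> s) n (pure n as)) \<in> S \<rightarrow> carrier (L n)"
      using lin_map_closed[OF lin_map_L_der[OF \<delta>] pure_closed[OF as]] Ln.smult_closed by simp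
    show "tens n (\<Sum>i\<le>n. ?s (c s) s i) = c s \<odot>\<^bsub>L n\<^esub> L_der scale (\<delta> s) n (pure n as)" if "s \<in> S" for s
      unfolding smult L_der_pure[OF \<delta>[OF that] as] ..
  qed
  finally show "L_der scale (\<lambda>a. \<Sum>s\<in>S. scale (c s) (\<delta> s a)) n (pure n as) = \<dots>" .
qed

text \<open>
  In the commutator of \<open>L\<^sub>d\<close> and \<open>L\<^bsub>d'\<^esub>\<close> the terms with \<open>d\<close> and \<open>d'\<close> at different positions cancel.
\<close>

lemma L_der_bracket:
  assumes d: "derivation scale d" and d': "derivation scale d'" and dd: "derivation scale (der_bracket d d')"
    and X: "X \<in> carrier (L n)"
  shows "L_der scale (der_bracket d d') n X =
    L_der scale d n (L_der scale d' n X) \<ominus>\<^bsub>L n\<^esub> L_der scale d' n (L_der scale d n X)"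
proof -
  interpret Ln: module CC "L n" by (rule module_L)
  let ?h = "\<lambda>b X. if b then L_der scale d n (L_der scale d' n X) else L_der scale d' n (L_der scale d n X)"
  have linh: "lin_map (L n) (L n) (?h b)" for b
    using lin_map_comp[OF lin_map_L_der[OF d] lin_map_L_der[OF d']]
      lin_map_comp[OF lin_map_L_der[OF d'] lin_map_L_der[OF d]] by (cases b) simp_all
  have hc: "?h b X \<in> carrier (L n)" if "X \<in> carrier (L n)" for b X by (rule lin_map_closed[OF linh that])
  have "lin_map (L n) (L n) (\<lambda>X. \<Oplus>\<^bsub>L n\<^esub>b\<in>{True, False}. (if b then 1 else -1) \<odot>\<^bsub>L n\<^esub> ?h b X)"
    by (rule lin_map_lincomb[OF module_L _ linh module_L]) simp
  then have lin: "lin_map (L n) (L n)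
      (\<lambda>X. L_der scale d n (L_der scale d' n X) \<ominus>\<^bsub>L n\<^esub> L_der scale d' n (L_der scale d n X))"
    using hc[of _ True] hc[of _ False] Ln.smult_closed
    by (elim lin_map_cong[OF module_L])
      (simp add: Ln.finsum_insert Ln.smult_one[simplified] a_minus_def module_minus_eq_smult[OF module_L])
  show ?thesis
  proof (rule lin_map_eq_on_pure[OF module_L lin_map_L_der[OF dd] lin _ X])
    fix as :: "'a list" assume as: "length as = Suc n"
    let ?s = "\<lambda>d i. single (as[i := d (as ! i)]) (1::complex)"
    let ?v = "\<lambda>d d' i j. single ((as[i := d' (as ! i)])[j := d (as ! j)]) (1::complex)"
    let ?t = "\<lambda>d d'. \<Sum>i\<le>n. \<Sum>j\<le>n. single ((as[i := d' (as ! i)])[j := d (as[i := d' (as ! i)] ! j)]) (1::complex)"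
    have w: "?s d i \<in> carrier (words n)" for d i using as by (intro single_words) simp
    have wt: "?t d d' \<in> carrier (words n)" for d d' using as by (intro sum_words single_words) simp
    have two: "L_der scale d n (L_der scale d' n (pure n as)) = tens n (?t d d')"
      if "derivation scale d" "derivation scale d'" for d d'
      unfolding L_der_pure[OF that(2) as] using as by (intro L_der_tens[OF that(1)]) auto
    have split: "?t d d' = (\<Sum>i\<le>n. ?s (\<lambda>a. d (d' a)) i) + (\<Sum>i\<le>n. \<Sum>j | j \<in> {..n} \<and> i \<noteq> j. ?v d d' i j)" for d d'
    proof -
      have "(\<Sum>j\<le>n. single ((as[i := d' (as ! i)])[j := d (as[i := d' (as ! i)] ! j)]) 1) =
          ?s (\<lambda>a. d (d' a)) i + (\<Sum>j | j \<in> {..n} \<and> i \<noteq> j. ?v d d' i j)" if "i \<le> n" for i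
      proof -
        have "{j. j \<in> {..n} \<and> i \<noteq> j} = {..n} - {i}" by auto
        moreover have "(\<Sum>j\<in>{..n} - {i}. single ((as[i := d' (as ! i)])[j := d (as[i := d' (as ! i)] ! j)]) 1)
            = (\<Sum>j\<in>{..n} - {i}. ?v d d' i j)" by (rule sum.cong) auto
        ultimately show ?thesis using that as by (subst sum.remove[of _ i]) simp_all
      qed
      then show ?thesis by (simp add: sum.distrib)
    qed
    have "(\<Sum>i\<le>n. \<Sum>j | j \<in> {..n} \<and> i \<noteq> j. ?v d' d i j) = (\<Sum>j\<le>n. \<Sum>i | i \<in> {..n} \<and> i \<noteq> j. ?v d' d i j)"
      by (rule sum.swap_restrict) auto
    also have "\<dots> = (\<Sum>j\<le>n. \<Sum>i | i \<in> {..n} \<and> j \<noteq> i. ?v d d' j i)"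
      by (intro sum.cong refl) (auto simp: list_update_swap)
    finally have "?t d d' - ?t d' d = (\<Sum>i\<le>n. ?s (\<lambda>a. d (d' a)) i) - (\<Sum>i\<le>n. ?s (\<lambda>a. d' (d a)) i)"
      unfolding split by simp
    also have "\<dots> = (\<Sum>i\<le>n. ?s (\<lambda>a. d (d' a)) i - ?s (\<lambda>a. d' (d a)) i)" by (rule sum_subtractf[symmetric])
    finally have eq: "?t d d' - ?t d' d = \<dots>" .
    have "L_der scale (der_bracket d d') n (pure n as) = (\<Oplus>\<^bsub>L n\<^esub>i\<in>{..n}. tens n (?s (der_bracket d d') i))"
      unfolding L_der_pure[OF dd as] by (intro tens_sum w) simp
    also have "\<dots> = (\<Oplus>\<^bsub>L n\<^esub>i\<in>{..n}. tens n (?s (\<lambda>a. d (d' a)) i - ?s (\<lambda>a. d' (d a)) i))"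
      using tens_closed[OF diff_words[OF w w]] as
      by (intro Ln.finsum_cong') (auto simp: der_bracket_def tens_diff_entry)
    also have "\<dots> = tens n (?t d d' - ?t d' d)" unfolding eq by (intro tens_sum[symmetric] diff_words w) simp
    also have "\<dots> = tens n (?t d d') \<ominus>\<^bsub>L n\<^esub> tens n (?t d' d)"
      using lin_map_minus[OF module_free_space module_L lin_map_tens wt wt] free_space_minus[OF wt wt] by simp
    finally show "L_der scale (der_bracket d d') n (pure n as) =
        L_der scale d n (L_der scale d' n (pure n as)) \<ominus>\<^bsub>L n\<^esub> L_der scale d' n (L_der scale d n (pure n as))"
      by (simp only: two[OF d d'] two[OF d' d])
  qed
qed

end

context complex_comm_algebra
begin

section \<open>Higher derivations on tensor powers\<close>

text \<open>
  The weights \<open>(p\<^sub>0, \<dots>, p\<^sub>n)\<close> with sum \<open>k\<close>, over which \<open>L\<^sub>D\<^sup>k\<close> is summed.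
\<close>

definition splits :: "nat \<Rightarrow> nat \<Rightarrow> nat list set" where
  "splits n k = {ps. length ps = Suc n \<and> sum_list ps = k}"

lemma finite_splits: "finite (splits n k)"
proof (rule finite_subset)
  show "splits n k \<subseteq> {ps. set ps \<subseteq> {0..k} \<and> length ps = Suc n}"
    by (auto simp: splits_def intro: member_le_sum_list)
  show "finite {ps. set ps \<subseteq> {0..k} \<and> length ps = Suc n}" by (rule finite_lists_length_eq) simp
qed

text \<open>
  A formal linear combination of tuples representing the value of \<open>L\<^sub>D\<^sup>k\<close> on a pure tensor.
\<close>

definition hder_words :: "(nat \<Rightarrow> 'a \<Rightarrow> 'a) \<Rightarrow> nat \<Rightarrow> nat \<Rightarrow> 'a list \<Rightarrow> 'a list \<Rightarrow>\<^sub>0 complex" where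
  "hder_words D n k as = (\<Sum>ps\<in>splits n k. single (map2 D ps as) 1)"

lemma single_sum: "single x (\<Sum>i\<in>I. c i) = (\<Sum>i\<in>I. single x (c i))"
  by (induct I rule: infinite_finite_induct) (simp_all add: single_add)

lemma length_map2_splits: "ps \<in> splits n k \<Longrightarrow> length as = Suc n \<Longrightarrow> length (map2 D ps as) = Suc n"
  by (simp add: splits_def)

lemma tens_hder_words_0:
  assumes "normalized D" "length as = Suc n"
  shows "tens n (hder_words D n 0 as) = pure n as"
proof -
  have "splits n 0 = {replicate (Suc n) 0}"
    by (auto simp: splits_def list_eq_iff_nth_eq simp del: replicate_Suc)
  moreover have "map2 D (replicate (Suc n) 0) as = as"
    using assms by (auto simp: list_eq_iff_nth_eq normalized_def simp del: replicate_Suc)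
  ultimately show ?thesis by (simp add: hder_words_def pure_eq_tens del: replicate_Suc)
qed

lemma nth_le_sum_list: "i < length ps \<Longrightarrow> ps ! i \<le> sum_list (ps :: nat list)"
  by (rule elem_le_sum_list)

text \<open>
  The Leibniz rule for weights: a factor \<open>k\<close> is distributed over the positions \<open>i\<close> as \<open>p\<^sub>0 + \<dots> + p\<^sub>n\<close>,
  each \<open>p\<^sub>i D\<^bsub>p\<^sub>i\<^esub>(a\<^sub>i)\<close> is expanded by Mirzavaziri's recursion, and the triples \<open>(p, i, r)\<close> are
  matched with \<open>(r, p', i)\<close>, where \<open>p'\<close> arises from \<open>p\<close> by subtracting \<open>r\<close> at position \<open>i\<close>.
\<close>

lemma tens_hder_words_rec:
  assumes rec: "\<And>k a. scale (of_nat k) (D k a) = (\<Sum>r=1..k. \<delta> r (D (k - r) a))"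
    and \<delta>: "\<And>r. derivation scale (\<delta> r)" and k: "1 \<le> k" and as: "length as = Suc n"
  shows "tens n (hder_words D n k as) =
    (\<Oplus>\<^bsub>L n\<^esub>r\<in>{1..k}. (1 / of_nat k) \<odot>\<^bsub>L n\<^esub> L_der scale (\<delta> r) n (tens n (hder_words D n (k - r) as)))"
proof -
  interpret Ln: module CC "L n" by (rule module_L)
  let ?m = "\<lambda>ps. map2 D ps as"
  let ?F = "\<lambda>ps i r. single ((?m ps)[i := \<delta> r (D (ps ! i - r) (as ! i))]) (1::complex)"
  let ?G = "\<lambda>r ps i. single ((?m ps)[i := \<delta> r (?m ps ! i)]) (1::complex)"
  have len: "length (?m ps) = Suc n" if "ps \<in> splits n l" for ps l using that as by (simp add: splits_def)
  have wm: "single (?m ps) c \<in> carrier (words n)" if "ps \<in> splits n l" for ps c l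
    by (rule single_words[OF len[OF that]])
  have wF: "?F ps i r \<in> carrier (words n)" if "ps \<in> splits n l" for ps i r l
    using len[OF that] by (intro single_words) simp
  have wG: "?G r ps i \<in> carrier (words n)" if "ps \<in> splits n l" for ps i r l
    using len[OF that] by (intro single_words) simp
  have wh: "hder_words D n l as \<in> carrier (words n)" for l
    unfolding hder_words_def by (intro sum_words wm)
  have A: "tens n (single (?m ps) (of_nat (ps ! i))) = tens n (\<Sum>r=1..ps ! i. ?F ps i r)"
    if ps: "ps \<in> splits n k" and i: "i \<le> n" for ps i
  proof -
    have "?m ps = (?m ps)[i := D (ps ! i) (as ! i)]"
      using ps i as by (intro list_update_same_conv[THEN iffD2, symmetric]) (simp_all add: splits_def)
    then have "tens n (single (?m ps) (of_nat (ps ! i))) =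
        tens n (single ((?m ps)[i := scale (of_nat (ps ! i)) (D (ps ! i) (as ! i))]) 1)"
      by (simp only: tens_scale[OF len[OF ps] i])
    then show ?thesis by (simp only: rec tens_sum_entry[OF len[OF ps] i finite_atLeastAtMost])
  qed
  have B: "of_nat k \<odot>\<^bsub>L n\<^esub> tens n (single (?m ps) 1) = tens n (\<Sum>i\<le>n. \<Sum>r=1..ps ! i. ?F ps i r)"
    if ps: "ps \<in> splits n k" for ps
  proof -
    have kk: "k = (\<Sum>i\<le>n. ps ! i)"
      using ps by (auto simp: splits_def sum_list_sum_nth atLeast0LessThan lessThan_Suc_atMost)
    have "of_nat k \<odot>\<^bsub>L n\<^esub> tens n (single (?m ps) 1) = tens n (single (?m ps) (of_nat k))"
      using lin_map_smult[OF lin_map_tens wm[OF ps], of "of_nat k" 1] by simp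
    also have "single (?m ps) (of_nat k) =
        (\<Sum>i\<le>n. single (?m ps) (of_nat (ps ! i) :: complex))"
      unfolding kk by (simp add: single_sum)
    also have "tens n \<dots> = (\<Oplus>\<^bsub>L n\<^esub>i\<in>{..n}. tens n (single (?m ps) (of_nat (ps ! i))))"
      by (rule tens_sum[OF finite_atMost wm[OF ps]])
    also have "\<dots> = (\<Oplus>\<^bsub>L n\<^esub>i\<in>{..n}. tens n (\<Sum>r=1..ps ! i. ?F ps i r))"
      by (intro Ln.finsum_cong' funcsetI tens_closed sum_words wF[OF ps]) (simp_all add: A[OF ps])
    also have "\<dots> = tens n (\<Sum>i\<le>n. \<Sum>r=1..ps ! i. ?F ps i r)"
      by (rule tens_sum[OF finite_atMost sum_words[OF wF[OF ps]], symmetric])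
    finally show ?thesis .
  qed
  have "of_nat k \<odot>\<^bsub>L n\<^esub> tens n (hder_words D n k as) =
      of_nat k \<odot>\<^bsub>L n\<^esub> (\<Oplus>\<^bsub>L n\<^esub>ps\<in>splits n k. tens n (single (?m ps) 1))"
    unfolding hder_words_def by (subst tens_sum[OF finite_splits wm]) simp_all
  also have "\<dots> = (\<Oplus>\<^bsub>L n\<^esub>ps\<in>splits n k. of_nat k \<odot>\<^bsub>L n\<^esub> tens n (single (?m ps) 1))"
    by (rule module_finsum_smult[OF module_L finite_splits tens_closed[OF wm]])
  also have "\<dots> = (\<Oplus>\<^bsub>L n\<^esub>ps\<in>splits n k. tens n (\<Sum>i\<le>n. \<Sum>r=1..ps ! i. ?F ps i r))"
    by (intro Ln.finsum_cong' funcsetI tens_closed sum_words wF) (simp_all add: B)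
  also have "\<dots> = tens n (\<Sum>ps\<in>splits n k. \<Sum>i\<le>n. \<Sum>r=1..ps ! i. ?F ps i r)"
    by (rule tens_sum[OF finite_splits sum_words[OF sum_words[OF wF]], symmetric])
  also have "(\<Sum>ps\<in>splits n k. \<Sum>i\<le>n. \<Sum>r=1..ps ! i. ?F ps i r) =
      (\<Sum>r=1..k. \<Sum>ps\<in>splits n (k - r). \<Sum>i\<le>n. ?G r ps i)"
  proof -
    have "(\<Sum>ps\<in>splits n k. \<Sum>i\<le>n. \<Sum>r=1..ps ! i. ?F ps i r) =
        (\<Sum>(ps, i, r)\<in>(SIGMA ps:splits n k. SIGMA i:{..n}. {1..ps ! i}). ?F ps i r)"
      by (simp add: sum.Sigma finite_splits)
    also have "\<dots> = (\<Sum>(r, ps, i)\<in>(SIGMA r:{1..k}. SIGMA ps:splits n (k - r). {..n}). ?G r ps i)"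
    proof (rule sum.reindex_bij_witness[where j = "\<lambda>(ps, i, r). (r, ps[i := ps ! i - r], i)"
          and i = "\<lambda>(r, ps, i). (ps[i := ps ! i + r], i, r)"])
      fix x assume "x \<in> (SIGMA ps:splits n k. SIGMA i:{..n}. {1..ps ! i})"
      then obtain ps i r where x: "x = (ps, i, r)" and ps: "length ps = Suc n" "sum_list ps = k"
        and i: "i \<le> n" and r: "1 \<le> r" "r \<le> ps ! i"
        by (auto simp: splits_def)
      have "ps ! i \<le> k" using nth_le_sum_list[of i ps] ps i by simp
      then show "(case x of (ps, i, r) \<Rightarrow> (r, ps[i := ps ! i - r], i)) \<in> (SIGMA r:{1..k}. SIGMA ps:splits n (k - r). {..n})"
        using ps i r by (auto simp: x splits_def sum_list_update)
      show "(case (case x of (ps, i, r) \<Rightarrow> (r, ps[i := ps ! i - r], i)) of (r, ps, i) \<Rightarrow> (ps[i := ps ! i + r], i, r)) = x"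
        using ps i r by (simp add: x)
      have "(?m (ps[i := ps ! i - r]))[i := z] = (?m ps)[i := z]" for z
        using ps i as by (auto simp: list_eq_iff_nth_eq nth_list_update)
      then show "(case (case x of (ps, i, r) \<Rightarrow> (r, ps[i := ps ! i - r], i)) of (r, ps, i) \<Rightarrow> ?G r ps i) =
          (case x of (ps, i, r) \<Rightarrow> ?F ps i r)"
        using ps i as by (simp add: x)
    next
      fix y assume "y \<in> (SIGMA r:{1..k}. SIGMA ps:splits n (k - r). {..n})"
      then obtain ps i r where y: "y = (r, ps, i)" and ps: "length ps = Suc n" "sum_list ps = k - r"
        and i: "i \<le> n" and r: "1 \<le> r" "r \<le> k"
        by (auto simp: splits_def)
      have "ps ! i \<le> k - r" using nth_le_sum_list[of i ps] ps i by simp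
      then show "(case y of (r, ps, i) \<Rightarrow> (ps[i := ps ! i + r], i, r)) \<in> (SIGMA ps:splits n k. SIGMA i:{..n}. {1..ps ! i})"
        using ps i r by (auto simp: y splits_def sum_list_update)
      show "(case (case y of (r, ps, i) \<Rightarrow> (ps[i := ps ! i + r], i, r)) of (ps, i, r) \<Rightarrow> (r, ps[i := ps ! i - r], i)) = y"
        using ps i r by (simp add: y)
    qed
    also have "\<dots> = (\<Sum>r=1..k. \<Sum>ps\<in>splits n (k - r). \<Sum>i\<le>n. ?G r ps i)"
      by (simp add: sum.Sigma finite_splits)
    finally show ?thesis .
  qed
  also have "tens n \<dots> = (\<Oplus>\<^bsub>L n\<^esub>r\<in>{1..k}. tens n (\<Sum>ps\<in>splits n (k - r). \<Sum>i\<le>n. ?G r ps i))"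
    by (rule tens_sum[OF finite_atLeastAtMost sum_words[OF sum_words[OF wG]]])
  also have "\<dots> = (\<Oplus>\<^bsub>L n\<^esub>r\<in>{1..k}. L_der scale (\<delta> r) n (tens n (hder_words D n (k - r) as)))"
    using lin_map_closed[OF lin_map_L_der[OF \<delta>] tens_closed[OF wh]]
    by (intro Ln.finsum_cong') (simp_all add: hder_words_def L_der_tens[OF \<delta> finite_splits len] Pi_iff)
  finally have C: "of_nat k \<odot>\<^bsub>L n\<^esub> tens n (hder_words D n k as) = \<dots>" .
  have "tens n (hder_words D n k as) = (1 / of_nat k) \<odot>\<^bsub>L n\<^esub> (of_nat k \<odot>\<^bsub>L n\<^esub> tens n (hder_words D n k as))"
    using k tens_closed[OF wh] by (simp add: Ln.smult_assoc1[simplified, symmetric] Ln.smult_one[simplified])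
  also have "\<dots> = (\<Oplus>\<^bsub>L n\<^esub>r\<in>{1..k}. (1 / of_nat k) \<odot>\<^bsub>L n\<^esub> L_der scale (\<delta> r) n (tens n (hder_words D n (k - r) as)))"
    unfolding C by (rule module_finsum_smult[OF module_L finite_atLeastAtMost lin_map_closed[OF lin_map_L_der[OF \<delta>] tens_closed[OF wh]]])
  finally show ?thesis .
qed

lemma L_hder_eqI:
  assumes "lin_map (L n) (L n) T" "\<And>as. length as = Suc n \<Longrightarrow> T (pure n as) = tens n (hder_words D n k as)"
    and "X \<in> carrier (L n)"
  shows "L_hder scale D k n X = T X"
  unfolding L_hder_def
proof (rule tensor_lift_eqI[OF module_L assms(1) _ assms(3)])
  fix as :: "'a list" assume as: "length as = Suc n"
  show "T (pure n as) = (\<Oplus>\<^bsub>L n\<^esub>ps\<in>{ps. length ps = Suc n \<and> sum_list ps = k}. pure n (map2 D ps as))"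
    unfolding assms(2)[OF as] unfolding hder_words_def splits_def[symmetric] pure_eq_tens
    by (rule tens_sum[OF finite_splits]) (rule single_words[OF length_map2_splits[OF _ as]])
qed

text \<open>
  The recursion determines \<open>L\<^sub>D\<^sup>k\<close> from the \<open>L\<^sub>D\<^sup>j\<close> with \<open>j < k\<close>. Linearity, naturality and the values on pure
  tensors are obtained along with it in a single induction, so that neither multilinearity of the
  defining expression nor its compatibility with products needs to be examined.
\<close>

lemma L_hder_rec:
  assumes rec: "\<And>k a. scale (of_nat k) (D k a) = (\<Sum>r=1..k. \<delta> r (D (k - r) a))"
    and \<delta>: "\<And>r. derivation scale (\<delta> r)" and D0: "normalized D"
  shows "nat_endo (L_hder scale D k) \<and>
    (\<forall>n as. length as = Suc n \<longrightarrow> L_hder scale D k n (pure n as) = tens n (hder_words D n k as)) \<and>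
    (\<forall>n. \<forall>X\<in>carrier (L n). (k = 0 \<longrightarrow> L_hder scale D k n X = X) \<and>
      (1 \<le> k \<longrightarrow> L_hder scale D k n X =
        (\<Oplus>\<^bsub>L n\<^esub>r\<in>{1..k}. (1 / of_nat k) \<odot>\<^bsub>L n\<^esub> L_der scale (\<delta> r) n (L_hder scale D (k - r) n X))))"
proof (induct k rule: less_induct)
  case (less k)
  show ?case
  proof (cases "k = 0")
    case True
    have eq: "L_hder scale D 0 n X = X" if "X \<in> carrier (L n)" for n X
      by (rule L_hder_eqI[OF lin_map_ident _ that]) (simp add: tens_hder_words_0[OF D0])
    have "nat_endo (L_hder scale D 0)"
      using eq lin_map_closed[OF lin_map_L_map] lin_map_cong[OF module_L lin_map_ident, of _ "L_hder scale D 0 _"]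
      unfolding nat_endo_def by simp
    then show ?thesis using True eq by (simp add: pure_closed tens_hder_words_0[OF D0])
  next
    case False
    then have k: "1 \<le> k" by simp
    let ?T = "\<lambda>n X. \<Oplus>\<^bsub>L n\<^esub>r\<in>{1..k}. (1 / of_nat k) \<odot>\<^bsub>L n\<^esub> L_der scale (\<delta> r) n (L_hder scale D (k - r) n X)"
    have ne: "nat_endo (L_hder scale D (k - r))" if "r \<in> {1..k}" for r using less[of "k - r"] that by simp
    have pe: "L_hder scale D (k - r) n (pure n as) = tens n (hder_words D n (k - r) as)"
      if "r \<in> {1..k}" "length as = Suc n" for r n as using less[of "k - r"] that by simp
    have linT: "lin_map (L n) (L n) (?T n)" for n
      using ne unfolding nat_endo_def
      by (intro lin_map_lincomb[OF module_L _ _ module_L] lin_map_comp[OF _ lin_map_L_der[OF \<delta>]]) auto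
    have pT: "?T n (pure n as) = tens n (hder_words D n k as)" if as: "length as = Suc n" for n as
    proof -
      interpret Ln: module CC "L n" by (rule module_L)
      have "tens n (hder_words D n l as) \<in> carrier (L n)" for l
        unfolding hder_words_def
        by (intro tens_closed sum_words) (rule single_words[OF length_map2_splits[OF _ as]])
      then have "L_der scale (\<delta> r) n (tens n (hder_words D n l as)) \<in> carrier (L n)" for r l
        using lin_map_closed[OF lin_map_L_der[OF \<delta>]] by blast
      then show ?thesis unfolding tens_hder_words_rec[OF rec \<delta> k as]
        using Ln.smult_closed by (intro Ln.finsum_cong') (simp_all add: pe[OF _ as] Pi_iff)
    qed
    have eq: "L_hder scale D k n X = ?T n X" if "X \<in> carrier (L n)" for n X
      by (rule L_hder_eqI[OF linT pT that])
    have "nat_endo (L_hder scale D k)"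
      by (rule nat_endo_lincomb[OF finite_atLeastAtMost nat_endo_L_der[OF \<delta>] ne eq])
    then show ?thesis using False eq pT by (simp add: pure_closed)
  qed
qed

end

section \<open>Extension of functors to pointed sets\<close>

text \<open>
  Families of spaces \<open>Fo n\<close> and linear maps between them indexed by the morphisms of \<open>\<Gamma>\<close>. The colimit
  construction does not use that identities and composites are preserved.
\<close>

locale gamma_functor =
  fixes Fo :: "nat \<Rightarrow> (complex, 'v) module" and Fm :: "nat \<Rightarrow> nat \<Rightarrow> (nat \<Rightarrow> nat) \<Rightarrow> 'v \<Rightarrow> 'v"
  assumes module_Fo: "module CC (Fo n)"
    and lin_map_Fm: "\<theta> \<in> Gamma_hom m n \<Longrightarrow> lin_map (Fo m) (Fo n) (Fm m n \<theta>)"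
begin

abbreviation "Fv \<equiv> (\<lambda>(n, \<phi>). Fo n)"
abbreviation "csum T t \<equiv> colim_sum Fo T t"
abbreviation "crel T t \<equiv> lin_span (colim_sum Fo T t) (colim_rels Fo Fm T t)"
abbreviation "ext T t \<equiv> ext_space Fo Fm T t"
abbreviation "inc T t i \<equiv> ext_incl Fo Fm T t i"

lemma module_Fv: "module CC (Fv i)"
  by (cases i) (simp add: module_Fo)

lemma module_csum: "module CC (csum T t)"
  unfolding colim_sum_def by (rule module_direct_sum[OF module_Fv])

lemma lin_map_incl: "(n, \<phi>) \<in> over T t \<Longrightarrow> lin_map (Fo n) (csum T t) (sum_incl (over T t) Fv (n, \<phi>))"
  using lin_map_sum_incl[of "over T t" Fv "(n, \<phi>)", OF module_Fv] by (simp add: colim_sum_def)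

lemma over_compose:
  assumes "(n, \<psi>) \<in> over T t" "\<theta> \<in> Gamma_hom m n"
  shows "(m, compose {0..m} \<psi> \<theta>) \<in> over T t"
proof -
  have "\<psi> \<in> {0..n} \<rightarrow> T" "\<theta> \<in> {0..m} \<rightarrow> {0..n}" "\<theta> 0 = 0" "\<psi> 0 = t"
    using assms by (auto simp: over_def Gamma_hom_def pointed_maps_def PiE_def)
  then show ?thesis
    by (auto simp: over_def pointed_maps_def PiE_def compose_def)
qed

lemma over_compose_map:
  assumes "(n, \<phi>) \<in> over T t" "f \<in> pointed_maps T t T' t'"
  shows "(n, compose {0..n} f \<phi>) \<in> over T' t'"
proof -
  have "\<phi> \<in> {0..n} \<rightarrow> T" "f \<in> T \<rightarrow> T'" "\<phi> 0 = t" "f t = t'"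
    using assms by (auto simp: over_def pointed_maps_def PiE_def)
  then show ?thesis
    by (auto simp: over_def pointed_maps_def PiE_def compose_def)
qed

lemma colim_rels_subset: "colim_rels Fo Fm T t \<subseteq> carrier (csum T t)"
proof
  fix s assume "s \<in> colim_rels Fo Fm T t"
  then obtain m n \<theta> \<psi> x where s: "s = sum_incl (over T t) Fv (m, compose {0..m} \<psi> \<theta>) x
      \<ominus>\<^bsub>csum T t\<^esub> sum_incl (over T t) Fv (n, \<psi>) (Fm m n \<theta> x)"
    and o: "(n, \<psi>) \<in> over T t" "\<theta> \<in> Gamma_hom m n" "x \<in> carrier (Fo m)"
    unfolding colim_rels_def by blast
  interpret S: module CC "csum T t" by (rule module_csum)
  show "s \<in> carrier (csum T t)"
    unfolding s by (intro S.minus_closed lin_map_closed[OF lin_map_incl[OF over_compose[OF o(1,2)]] o(3)]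
        lin_map_closed[OF lin_map_incl[OF o(1)] lin_map_closed[OF lin_map_Fm[OF o(2)] o(3)]])
qed

lemma submodule_crel: "submodule (crel T t) CC (csum T t)"
  by (rule submodule_lin_span[OF module_csum colim_rels_subset])

lemma module_ext: "module CC (ext T t)"
  unfolding ext_space_def by (rule module_quot(1)[OF module_csum submodule_crel])

lemma lin_map_ext_coset: "lin_map (csum T t) (ext T t) (\<lambda>x. crel T t +>\<^bsub>csum T t\<^esub> x)"
  unfolding ext_space_def by (rule module_quot(2)[OF module_csum submodule_crel])

lemma lin_map_inc: "(n, \<phi>) \<in> over T t \<Longrightarrow> lin_map (Fo n) (ext T t) (inc T t (n, \<phi>))"
  unfolding ext_incl_def[abs_def] by (rule lin_map_comp[OF lin_map_incl lin_map_ext_coset])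

text \<open>
  The inclusions into the colimit form a cocone.
\<close>

lemma inc_compose:
  assumes "(n, \<psi>) \<in> over T t" "\<theta> \<in> Gamma_hom m n" "x \<in> carrier (Fo m)"
  shows "inc T t (m, compose {0..m} \<psi> \<theta>) x = inc T t (n, \<psi>) (Fm m n \<theta> x)"
  unfolding ext_incl_def
proof (rule coset_eqI[OF module_csum submodule_crel])
  show "sum_incl (over T t) Fv (m, compose {0..m} \<psi> \<theta>) x
      \<ominus>\<^bsub>csum T t\<^esub> sum_incl (over T t) Fv (n, \<psi>) (Fm m n \<theta> x) \<in> crel T t"
    by (rule subsetD[OF lin_span_incl], unfold colim_rels_def, rule CollectI, intro exI conjI)
      (rule refl assms)+
  show "sum_incl (over T t) Fv (m, compose {0..m} \<psi> \<theta>) x \<in> carrier (csum T t)"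
    by (rule lin_map_closed[OF lin_map_incl[OF over_compose[OF assms(1,2)]] assms(3)])
  show "sum_incl (over T t) Fv (n, \<psi>) (Fm m n \<theta> x) \<in> carrier (csum T t)"
    by (rule lin_map_closed[OF lin_map_incl[OF assms(1)] lin_map_closed[OF lin_map_Fm[OF assms(2)] assms(3)]])
qed

lemma lin_map_eq_on_inc:
  assumes M: "module CC M" and f: "lin_map (ext T t) M f" and g: "lin_map (ext T t) M g"
    and eq: "\<And>n \<phi> x. (n, \<phi>) \<in> over T t \<Longrightarrow> x \<in> carrier (Fo n) \<Longrightarrow> f (inc T t (n, \<phi>) x) = g (inc T t (n, \<phi>) x)"
    and X: "X \<in> carrier (ext T t)"
  shows "f X = g X"
proof -
  let ?S = "\<Union>i\<in>over T t. sum_incl (over T t) Fv i ` carrier (Fv i)"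
  have "carrier (csum T t) \<subseteq> lin_span (csum T t) ?S"
    unfolding colim_sum_def by (rule span_direct_sum[OF module_Fv lin_span_incl]) simp
  moreover have sub: "?S \<subseteq> carrier (csum T t)"
    using lin_map_closed[OF lin_map_incl] by auto
  ultimately have span: "carrier (ext T t) \<subseteq> lin_span (ext T t) ((\<lambda>x. crel T t +>\<^bsub>csum T t\<^esub> x) ` ?S)"
    unfolding ext_space_def by (rule span_quot[OF module_csum submodule_crel])
  show ?thesis
  proof (rule lin_map_eq_on_span[OF module_ext M f g span _ X])
    fix s assume "s \<in> (\<lambda>x. crel T t +>\<^bsub>csum T t\<^esub> x) ` ?S"
    then obtain n \<phi> x where "(n, \<phi>) \<in> over T t" "x \<in> carrier (Fo n)" "s = inc T t (n, \<phi>) x"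
      by (auto simp: ext_incl_def)
    then show "s \<in> carrier (ext T t) \<and> f s = g s" using eq lin_map_closed[OF lin_map_inc] by simp
  qed
qed

lemma
  assumes M: "module CC M" and g: "\<And>n \<phi>. (n, \<phi>) \<in> over T t \<Longrightarrow> lin_map (Fo n) M (g (n, \<phi>))"
    and cocone: "\<And>m n \<theta> \<psi> x. (n, \<psi>) \<in> over T t \<Longrightarrow> \<theta> \<in> Gamma_hom m n \<Longrightarrow> x \<in> carrier (Fo m) \<Longrightarrow>
      g (m, compose {0..m} \<psi> \<theta>) x = g (n, \<psi>) (Fm m n \<theta> x)"
  shows lin_map_ext_lift: "lin_map (ext T t) M (ext_lift Fo T t M g)"
    and ext_lift_inc: "(n, \<phi>) \<in> over T t \<Longrightarrow> x \<in> carrier (Fo n) \<Longrightarrow>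
      ext_lift Fo T t M g (inc T t (n, \<phi>) x) = g (n, \<phi>) x"
proof -
  interpret M: module CC M by (rule M)
  have g': "lin_map (Fv i) M (g i)" if "i \<in> over T t" for i using g that by (cases i) simp
  let ?l = "sum_lift (over T t) Fv M g"
  have lin: "lin_map (csum T t) M ?l"
    unfolding colim_sum_def by (rule lin_map_sum_lift[OF module_Fv M g'])
  have val: "?l (sum_incl (over T t) Fv (n, \<phi>) x) = g (n, \<phi>) x"
    if "(n, \<phi>) \<in> over T t" "x \<in> carrier (Fo n)" for n \<phi> x
    using sum_lift_incl[of "over T t" Fv M g "(n, \<phi>)" x, OF module_Fv M g'] that by simp
  have "?l s = \<zero>\<^bsub>M\<^esub>" if "s \<in> colim_rels Fo Fm T t" for s
  proof -
    from that obtain m n \<theta> \<psi> x where s: "s = sum_incl (over T t) Fv (m, compose {0..m} \<psi> \<theta>) x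
        \<ominus>\<^bsub>csum T t\<^esub> sum_incl (over T t) Fv (n, \<psi>) (Fm m n \<theta> x)"
      and o: "(n, \<psi>) \<in> over T t" "\<theta> \<in> Gamma_hom m n" "x \<in> carrier (Fo m)"
      unfolding colim_rels_def by blast
    note Fx = lin_map_closed[OF lin_map_Fm[OF o(2)] o(3)]
    note oc = over_compose[OF o(1,2)]
    have "?l s = ?l (sum_incl (over T t) Fv (m, compose {0..m} \<psi> \<theta>) x)
        \<ominus>\<^bsub>M\<^esub> ?l (sum_incl (over T t) Fv (n, \<psi>) (Fm m n \<theta> x))"
      unfolding s by (rule lin_map_minus[OF module_csum M lin lin_map_closed[OF lin_map_incl[OF oc] o(3)]
          lin_map_closed[OF lin_map_incl[OF o(1)] Fx]])
    also have "\<dots> = g (m, compose {0..m} \<psi> \<theta>) x \<ominus>\<^bsub>M\<^esub> g (n, \<psi>) (Fm m n \<theta> x)"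
      by (simp only: val[OF oc o(3)] val[OF o(1) Fx])
    also have "\<dots> = \<zero>\<^bsub>M\<^esub>"
      using cocone[OF o] lin_map_closed[OF g[OF o(1)] Fx] by (simp add: a_minus_def M.r_neg)
    finally show ?thesis .
  qed
  then have "s \<in> carrier (csum T t) \<and> ?l s = \<zero>\<^bsub>M\<^esub>" if "s \<in> colim_rels Fo Fm T t" for s
    using that subsetD[OF colim_rels_subset that] by simp
  then have van: "?l w = \<zero>\<^bsub>M\<^esub>" if "w \<in> crel T t" for w
    by (rule vanish_on_span[OF module_csum M lin _ that])
  show "lin_map (ext T t) M (ext_lift Fo T t M g)"
    unfolding ext_lift_def ext_space_def
    by (rule lin_map_quot_lift[OF module_csum M submodule_crel lin van])
  show "ext_lift Fo T t M g (inc T t (n, \<phi>) x) = g (n, \<phi>) x"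
    if o: "(n, \<phi>) \<in> over T t" "x \<in> carrier (Fo n)"
    unfolding ext_lift_def ext_incl_def
    using quot_lift_coset[OF module_csum M submodule_crel lin van lin_map_closed[OF lin_map_incl[OF o(1)] o(2)]]
    by (simp only: val[OF o])
qed

lemma
  assumes f: "f \<in> pointed_maps T t T' t'"
  shows lin_map_ext_map: "lin_map (ext T t) (ext T' t') (ext_map Fo Fm T t T' t' f)"
    and ext_map_inc: "(n, \<phi>) \<in> over T t \<Longrightarrow> x \<in> carrier (Fo n) \<Longrightarrow>
      ext_map Fo Fm T t T' t' f (inc T t (n, \<phi>) x) = inc T' t' (n, compose {0..n} f \<phi>) x"
proof -
  let ?g = "\<lambda>(n, \<phi>). inc T' t' (n, compose {0..n} f \<phi>)"
  have g: "lin_map (Fo n) (ext T' t') (?g (n, \<phi>))" if "(n, \<phi>) \<in> over T t" for n \<phi>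
    using lin_map_inc[OF over_compose_map[OF that f]] by simp
  have c: "?g (m, compose {0..m} \<psi> \<theta>) x = ?g (n, \<psi>) (Fm m n \<theta> x)"
    if o: "(n, \<psi>) \<in> over T t" "\<theta> \<in> Gamma_hom m n" "x \<in> carrier (Fo m)" for m n \<theta> \<psi> x
  proof -
    have "\<theta> i \<in> {0..n}" if "i \<in> {0..m}" for i using o(2) that by (auto simp: Gamma_hom_def pointed_maps_def)
    then have "compose {0..m} f (compose {0..m} \<psi> \<theta>) = compose {0..m} (compose {0..n} f \<psi>) \<theta>"
      by (auto simp: compose_def fun_eq_iff)
    then show ?thesis using inc_compose[OF over_compose_map[OF o(1) f] o(2,3)] by simp
  qed
  show "lin_map (ext T t) (ext T' t') (ext_map Fo Fm T t T' t' f)"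
    unfolding ext_map_def by (rule lin_map_ext_lift[OF module_ext g c])
  show "ext_map Fo Fm T t T' t' f (inc T t (n, \<phi>) x) = inc T' t' (n, compose {0..n} f \<phi>) x"
    if "(n, \<phi>) \<in> over T t" "x \<in> carrier (Fo n)"
    unfolding ext_map_def using ext_lift_inc[OF module_ext g c that] by simp
qed

text \<open>
  A natural family of linear endomorphisms \<open>\<alpha>\<close> extends to the colimits, compatibly with pointed maps.
\<close>

context
  fixes \<alpha>
  assumes lin: "\<And>n. lin_map (Fo n) (Fo n) (\<alpha> n)"
    and nat: "\<And>m n \<theta> x. \<theta> \<in> Gamma_hom m n \<Longrightarrow> x \<in> carrier (Fo m) \<Longrightarrow> \<alpha> n (Fm m n \<theta> x) = Fm m n \<theta> (\<alpha> m x)"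
begin

lemma
  shows lin_map_ext_endo: "lin_map (ext T t) (ext T t) (ext_endo Fo Fm T t \<alpha>)"
    and ext_endo_inc: "(n, \<phi>) \<in> over T t \<Longrightarrow> x \<in> carrier (Fo n) \<Longrightarrow>
      ext_endo Fo Fm T t \<alpha> (inc T t (n, \<phi>) x) = inc T t (n, \<phi>) (\<alpha> n x)"
proof -
  let ?g = "\<lambda>(n, \<phi>) x. inc T t (n, \<phi>) (\<alpha> n x)"
  have g: "lin_map (Fo n) (ext T t) (?g (n, \<phi>))" if "(n, \<phi>) \<in> over T t" for n \<phi>
    using lin_map_comp[OF lin lin_map_inc[OF that]] by simp
  have c: "?g (m, compose {0..m} \<psi> \<theta>) x = ?g (n, \<psi>) (Fm m n \<theta> x)"
    if o: "(n, \<psi>) \<in> over T t" "\<theta> \<in> Gamma_hom m n" "x \<in> carrier (Fo m)" for m n \<theta> \<psi> x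
    using inc_compose[OF o(1,2) lin_map_closed[OF lin o(3)]] nat[OF o(2,3)] by simp
  show "lin_map (ext T t) (ext T t) (ext_endo Fo Fm T t \<alpha>)"
    unfolding ext_endo_def by (rule lin_map_ext_lift[OF module_ext g c])
  show "ext_endo Fo Fm T t \<alpha> (inc T t (n, \<phi>) x) = inc T t (n, \<phi>) (\<alpha> n x)"
    if "(n, \<phi>) \<in> over T t" "x \<in> carrier (Fo n)"
    unfolding ext_endo_def using ext_lift_inc[OF module_ext g c that] by simp
qed

lemma ext_endo_ext_map:
  assumes f: "f \<in> pointed_maps T t T' t'" and X: "X \<in> carrier (ext T t)"
  shows "ext_endo Fo Fm T' t' \<alpha> (ext_map Fo Fm T t T' t' f X) = ext_map Fo Fm T t T' t' f (ext_endo Fo Fm T t \<alpha> X)"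
proof (rule lin_map_eq_on_inc[OF module_ext lin_map_comp[OF lin_map_ext_map[OF f] lin_map_ext_endo]
      lin_map_comp[OF lin_map_ext_endo lin_map_ext_map[OF f]] _ X])
  fix n \<phi> x assume o: "(n, \<phi>) \<in> over T t" "x \<in> carrier (Fo n)"
  show "ext_endo Fo Fm T' t' \<alpha> (ext_map Fo Fm T t T' t' f (inc T t (n, \<phi>) x)) =
      ext_map Fo Fm T t T' t' f (ext_endo Fo Fm T t \<alpha> (inc T t (n, \<phi>) x))"
    by (simp only: ext_map_inc[OF f o] ext_endo_inc[OF o] ext_endo_inc[OF over_compose_map[OF o(1) f] o(2)]
        ext_map_inc[OF f o(1) lin_map_closed[OF lin o(2)]])
qed

end

end

section \<open>Homology of sequences of linear maps\<close>

text \<open>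
  In general \<open>N_homology_part\<close> is the space \<open>(Ker b\<^sup>i + Im b\<^sup>N\<^sup>-\<^sup>i) / Im b\<^sup>N\<^sup>-\<^sup>i\<close>, which is functorial whether or
  not \<open>b\<^sup>N = 0\<close>.
\<close>

locale graded_map =
  fixes C :: "int \<Rightarrow> (complex, 'v) module" and b :: "int \<Rightarrow> 'v \<Rightarrow> 'v" and N :: nat
  assumes module_C: "module CC (C n)" and lin_map_b: "lin_map (C n) (C (n - 1)) (b n)"
begin

abbreviation "part n i \<equiv> N_homology_part C b N i n"
abbreviation "im n i \<equiv> N_im C b (N - i) n"
abbreviation "tot \<equiv> direct_sum (UNIV :: nat set) (\<lambda>n. N_homology C b N (int n))"

text \<open>
  The map on total homology induced by maps \<open>f n\<close> in all degrees; negative degrees enter only through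
  the conditions in \<open>chain_endo\<close>.
\<close>

definition hmap :: "(int \<Rightarrow> 'v \<Rightarrow> 'v) \<Rightarrow> (nat \<Rightarrow> nat \<Rightarrow> 'v set) \<Rightarrow> nat \<Rightarrow> nat \<Rightarrow> 'v set" where
  "hmap f z = (\<lambda>n. N_homology_map C b N (int n) (f (int n)) (z n))"

text \<open>
  Degree-preserving linear maps that commute with \<open>b\<close>.
\<close>

definition chain_endo :: "(int \<Rightarrow> 'v \<Rightarrow> 'v) \<Rightarrow> bool" where
  "chain_endo f \<longleftrightarrow> (\<forall>n. lin_map (C n) (C n) (f n)) \<and>
     (\<forall>n. \<forall>x\<in>carrier (C n). f (n - 1) (b n x) = b n (f n x))"

lemma lin_map_bpow: "lin_map (C n) (C (n - int i)) (bpow b i n)"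
proof (induct i arbitrary: n)
  case 0
  then show ?case by (simp add: lin_map_ident)
next
  case (Suc i)
  have "n - int (Suc i) = n - 1 - int i" by simp
  moreover have "bpow b (Suc i) n = (\<lambda>x. bpow b i (n - 1) (b n x))" by (simp add: fun_eq_iff)
  ultimately show ?case using lin_map_comp[OF lin_map_b[of n] Suc[of "n - 1"]] by (simp only:)
qed

lemma submodule_im: "submodule (N_im C b j n) CC (C n)"
  using submodule_image[OF module_C module_C lin_map_bpow[of "n + int j" j]] by (simp add: N_im_def)

lemma submodule_ker: "submodule (N_ker C b i n) CC (C n)"
  unfolding N_ker_def by (rule submodule_kernel[OF module_C module_C lin_map_bpow])

lemma ker_carrier: "x \<in> N_ker C b i n \<Longrightarrow> x \<in> carrier (C n)"
  by (simp add: N_ker_def)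

lemma chain_endo_bpow:
  assumes "chain_endo f" "x \<in> carrier (C n)"
  shows "f (n - int i) (bpow b i n x) = bpow b i n (f n x)"
  using assms(2)
proof (induct i arbitrary: n x)
  case (Suc i)
  have "n - int (Suc i) = n - 1 - int i" by simp
  then have "f (n - int (Suc i)) (bpow b (Suc i) n x) = f (n - 1 - int i) (bpow b i (n - 1) (b n x))"
    by (simp only: bpow.simps)
  also have "\<dots> = bpow b i (n - 1) (f (n - 1) (b n x))"
    by (rule Suc(1)[OF lin_map_closed[OF lin_map_b Suc(2)]])
  finally show ?case using assms(1) Suc(2) by (simp add: chain_endo_def)
qed simp

lemma chain_endo_ker:
  assumes f: "chain_endo f" and x: "x \<in> N_ker C b i n"
  shows "f n x \<in> N_ker C b i n"
proof -
  have lin: "lin_map (C m) (C m) (f m)" for m using f by (simp add: chain_endo_def)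
  have "bpow b i n (f n x) = f (n - int i) \<zero>\<^bsub>C (n - int i)\<^esub>"
    using chain_endo_bpow[OF f ker_carrier[OF x], of i] x by (simp add: N_ker_def)
  then show ?thesis
    using lin_map_zero[OF module_C module_C lin] lin_map_closed[OF lin ker_carrier[OF x]] by (simp add: N_ker_def)
qed

lemma chain_endo_im:
  assumes f: "chain_endo f" and x: "x \<in> N_im C b j n"
  shows "f n x \<in> N_im C b j n"
proof -
  have lin: "lin_map (C m) (C m) (f m)" for m using f by (simp add: chain_endo_def)
  obtain y where y: "y \<in> carrier (C (n + int j))" "x = bpow b j (n + int j) y" using x by (auto simp: N_im_def)
  have "f n x = bpow b j (n + int j) (f (n + int j) y)"
    using chain_endo_bpow[OF f y(1), of j] y(2) by simp
  then show ?thesis using lin_map_closed[OF lin y(1)] by (simp add: N_im_def)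
qed

lemma module_part: "module CC (part n i)"
  unfolding N_homology_part_def by (rule module_quot_sub(1)[OF module_C submodule_ker submodule_im])

lemma part_cases:
  assumes "X \<in> carrier (part n i)"
  obtains x where "x \<in> N_ker C b i n" "X = im n i +>\<^bsub>C n\<^esub> x"
  using assms by (auto simp: N_homology_part_def quot_sub_simps)

lemma part_memI: "x \<in> N_ker C b i n \<Longrightarrow> im n i +>\<^bsub>C n\<^esub> x \<in> carrier (part n i)"
  by (simp add: N_homology_part_def quot_sub_simps)

abbreviation "Q n i \<equiv> quot_space (C n) (im n i)"

lemmas module_Q = module_quot(1)[OF module_C submodule_im]
lemmas lin_map_coset = module_quot(2)[OF module_C submodule_im]

text \<open>
  Inclusion of the homology into \<open>C n / Im\<close>, where sums of homology classes can be computed on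
  representatives.
\<close>

lemma lin_map_part_incl: "lin_map (part n i) (Q n i) (\<lambda>X. X)"
proof (rule lin_mapI)
  show "X \<in> carrier (Q n i)" if "X \<in> carrier (part n i)" for X
    using that by (rule part_cases) (simp add: quot_simps(1) ker_carrier)
qed (simp_all add: N_homology_part_def quot_sub_simps(2,4)
    quot_sub_simps(2,4)[where M = "C n" and K = "carrier (C n)" and W = "im n i", simplified]
    del: UN_simps)

lemma chain_endo_im_coset:
  assumes f: "chain_endo f" and w: "w \<in> im n i"
  shows "im n i +>\<^bsub>C n\<^esub> f n w = \<zero>\<^bsub>Q n i\<^esub>"
  using abelian_subgroup.a_rcos_const[OF submoduleD(7)[OF module_C submodule_im] chain_endo_im[OF f w]]
  by (simp add: quot_simps(2))

lemma part_lift: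
  assumes f: "chain_endo f" and x: "x \<in> carrier (C n)"
  shows "quot_lift (\<lambda>x. im n i +>\<^bsub>C n\<^esub> f n x) (im n i +>\<^bsub>C n\<^esub> x) = im n i +>\<^bsub>C n\<^esub> f n x"
proof (rule quot_lift_coset[OF module_C module_Q submodule_im _ _ x])
  have lin: "lin_map (C m) (C m) (f m)" for m using f by (simp add: chain_endo_def)
  show "lin_map (C n) (Q n i) (\<lambda>x. im n i +>\<^bsub>C n\<^esub> f n x)" by (rule lin_map_comp[OF lin lin_map_coset])
  fix w assume w: "w \<in> im n i"
  show "im n i +>\<^bsub>C n\<^esub> f n w = \<zero>\<^bsub>Q n i\<^esub>" by (rule chain_endo_im_coset[OF f w])
qed

lemma lin_map_part:
  assumes f: "chain_endo f"
  shows "lin_map (part n i) (part n i) (quot_lift (\<lambda>x. im n i +>\<^bsub>C n\<^esub> f n x))" (is "lin_map _ _ ?g")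
proof -
  have lin: "lin_map (C m) (C m) (f m)" for m using f by (simp add: chain_endo_def)
  have g: "lin_map (Q n i) (Q n i) ?g"
  proof -
    have lc: "lin_map (C n) (Q n i) (\<lambda>x. im n i +>\<^bsub>C n\<^esub> f n x)" by (rule lin_map_comp[OF lin lin_map_coset])
    show ?thesis
      by (rule lin_map_quot_lift[OF module_C module_Q submodule_im lc chain_endo_im_coset[OF f]])
  qed
  note add = lin_map_add[OF lin_map_part_incl] and smult = lin_map_smult[OF lin_map_part_incl]
    and cl = lin_map_closed[OF lin_map_part_incl]
  have gc: "?g X \<in> carrier (part n i)" if "X \<in> carrier (part n i)" for X
    using that by (cases rule: part_cases) (simp add: part_lift[OF f ker_carrier] part_memI chain_endo_ker[OF f])
  show ?thesis
  proof (rule lin_mapI[OF gc])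
    show "?g (X \<oplus>\<^bsub>part n i\<^esub> Y) = ?g X \<oplus>\<^bsub>part n i\<^esub> ?g Y"
      if "X \<in> carrier (part n i)" "Y \<in> carrier (part n i)" for X Y
      using that by (simp only: add[OF that] add[OF gc gc] lin_map_add[OF g cl cl])
    show "?g (c \<odot>\<^bsub>part n i\<^esub> X) = c \<odot>\<^bsub>part n i\<^esub> ?g X" if "X \<in> carrier (part n i)" for c X
      using that by (simp only: smult[OF that] smult[OF gc] lin_map_smult[OF g cl])
  qed
qed

lemma module_homology: "module CC (N_homology C b N n)"
  unfolding N_homology_def by (rule module_direct_sum[OF module_part])

lemma module_total: "module CC tot"
  by (rule module_direct_sum[OF module_homology])

lemma lin_map_hmap:
  assumes f: "chain_endo f"
  shows "lin_map tot tot (hmap f)"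
proof -
  have "lin_map (N_homology C b N n) (N_homology C b N n) (N_homology_map C b N n (f n))" for n
    unfolding N_homology_def N_homology_map_def[abs_def]
    by (rule lin_map_direct_sum[OF module_part lin_map_part[OF f]])
  from lin_map_direct_sum[where I = "UNIV :: nat set" and V = "\<lambda>n. N_homology C b N (int n)", OF module_homology this]
  show ?thesis by (simp add: hmap_def[abs_def] restrict_def)
qed

text \<open>Reading off the component of a homology class in degree \<open>n\<close> and in part \<open>i\<close>.\<close>

lemma lin_map_component:
  assumes "i \<in> {1..N - 1}"
  shows "lin_map tot (Q (int n) i) (\<lambda>z. z n i)"
proof -
  have 1: "lin_map tot (N_homology C b N (int n)) (\<lambda>z. z n)"
    by (rule lin_map_proj[where V = "\<lambda>n. N_homology C b N (int n)"]) (simp_all add: module_homology)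
  have 2: "lin_map (N_homology C b N (int n)) (part (int n) i) (\<lambda>z. z i)"
    unfolding N_homology_def by (rule lin_map_proj[OF module_part assms])
  show ?thesis by (rule lin_map_comp[OF lin_map_comp[OF 1 2] lin_map_part_incl])
qed

lemma total_eqI:
  assumes "z \<in> carrier tot" "w \<in> carrier tot"
    and "\<And>n i. i \<in> {1..N - 1} \<Longrightarrow> z n i = w n i"
  shows "z = w"
proof
  fix n
  have "z n \<in> carrier (N_homology C b N (int n))" "w n \<in> carrier (N_homology C b N (int n))"
    using assms(1,2) by (auto simp: direct_sum_simps)
  then show "z n = w n"
    unfolding N_homology_def using assms(3) by (intro direct_sum_eqI[OF module_part]) auto
qed

lemma total_component_cases:
  assumes "z \<in> carrier tot" "i \<in> {1..N - 1}"
  obtains x where "x \<in> N_ker C b i (int n)" "z n i = im (int n) i +>\<^bsub>C (int n)\<^esub> x"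
proof -
  have "z n \<in> carrier (N_homology C b N (int n))" using assms(1) by (auto simp: direct_sum_simps)
  then have "z n i \<in> carrier (part (int n) i)"
    unfolding N_homology_def using assms(2) by (auto simp: direct_sum_simps)
  then show ?thesis by (rule part_cases) (rule that)
qed

lemma hmap_component:
  assumes f: "chain_endo f" and i: "i \<in> {1..N - 1}" and x: "x \<in> carrier (C (int n))"
    and z: "z n i = im (int n) i +>\<^bsub>C (int n)\<^esub> x"
  shows "hmap f z n i = im (int n) i +>\<^bsub>C (int n)\<^esub> f (int n) x"
  using i by (simp add: hmap_def N_homology_map_def z part_lift[OF f x])

text \<open>
  Identities between chain maps pass to homology: both sides are compared on a representative of
  each component.
\<close>

lemma hmap_lincomb:
  assumes S: "finite S" and f: "chain_endo f" and \<beta>: "\<And>s. s \<in> S \<Longrightarrow> chain_endo (\<beta> s)"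
    and \<gamma>: "\<And>s. s \<in> S \<Longrightarrow> chain_endo (\<gamma> s)"
    and eq: "\<And>n x. x \<in> carrier (C (int n)) \<Longrightarrow>
      f (int n) x = (\<Oplus>\<^bsub>C (int n)\<^esub>s\<in>S. c s \<odot>\<^bsub>C (int n)\<^esub> \<beta> s (int n) (\<gamma> s (int n) x))"
    and z: "z \<in> carrier tot"
  shows "hmap f z = (\<Oplus>\<^bsub>tot\<^esub>s\<in>S. c s \<odot>\<^bsub>tot\<^esub> hmap (\<beta> s) (hmap (\<gamma> s) z))"
proof (rule total_eqI)
  interpret T: module CC tot by (rule module_total)
  have hc: "hmap (\<beta> s) (hmap (\<gamma> s) z) \<in> carrier tot" if "s \<in> S" for s
    using lin_map_closed[OF lin_map_hmap[OF \<beta>[OF that]] lin_map_closed[OF lin_map_hmap[OF \<gamma>[OF that]] z]] .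
  then have hc': "c s \<odot>\<^bsub>tot\<^esub> hmap (\<beta> s) (hmap (\<gamma> s) z) \<in> carrier tot" if "s \<in> S" for s
    using that T.smult_closed by simp
  show "hmap f z \<in> carrier tot" by (rule lin_map_closed[OF lin_map_hmap[OF f] z])
  show "(\<Oplus>\<^bsub>tot\<^esub>s\<in>S. c s \<odot>\<^bsub>tot\<^esub> hmap (\<beta> s) (hmap (\<gamma> s) z)) \<in> carrier tot"
    using hc' by (intro T.finsum_closed) auto
  fix n i assume i: "i \<in> {1..N - 1}"
  let ?n = "int n"
  let ?q = "\<lambda>x. im ?n i +>\<^bsub>C ?n\<^esub> x"
  interpret Qn: module CC "Q ?n i" by (rule module_Q)
  interpret Cn: module CC "C ?n" by (rule module_C)
  note comp = lin_map_component[OF i, of n]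
  obtain x where x: "x \<in> N_ker C b i ?n" "z n i = ?q x" using total_component_cases[OF z i] .
  note xc = ker_carrier[OF x(1)]
  have lin: "lin_map (C m) (C m) (\<beta> s m)" "lin_map (C m) (C m) (\<gamma> s m)" if "s \<in> S" for s m
    using \<beta>[OF that] \<gamma>[OF that] by (simp_all add: chain_endo_def)
  have \<gamma>c: "\<gamma> s ?n x \<in> carrier (C ?n)" and \<beta>c: "\<beta> s ?n (\<gamma> s ?n x) \<in> carrier (C ?n)" if "s \<in> S" for s
    using lin_map_closed[OF lin(2)[OF that] xc] lin_map_closed[OF lin(1)[OF that]] by auto
  have "(\<Oplus>\<^bsub>tot\<^esub>s\<in>S. c s \<odot>\<^bsub>tot\<^esub> hmap (\<beta> s) (hmap (\<gamma> s) z)) n i =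
      (\<Oplus>\<^bsub>Q ?n i\<^esub>s\<in>S. (c s \<odot>\<^bsub>tot\<^esub> hmap (\<beta> s) (hmap (\<gamma> s) z)) n i)"
    by (rule lin_map_finsum[OF module_total module_Q comp S hc'])
  also have "\<dots> = (\<Oplus>\<^bsub>Q ?n i\<^esub>s\<in>S. ?q (c s \<odot>\<^bsub>C ?n\<^esub> \<beta> s ?n (\<gamma> s ?n x)))"
  proof (rule Qn.finsum_cong'[OF refl])
    show "(\<lambda>s. ?q (c s \<odot>\<^bsub>C ?n\<^esub> \<beta> s ?n (\<gamma> s ?n x))) \<in> S \<rightarrow> carrier (Q ?n i)"
      using lin_map_closed[OF lin_map_coset] \<beta>c Cn.smult_closed by auto
    fix s assume s: "s \<in> S"
    have "hmap (\<beta> s) (hmap (\<gamma> s) z) n i = ?q (\<beta> s ?n (\<gamma> s ?n x))"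
      by (rule hmap_component[where z = "hmap (\<gamma> s) z" and n = n, OF \<beta>[OF s] i \<gamma>c[OF s] hmap_component[where z = z and n = n, OF \<gamma>[OF s] i xc x(2)]])
    then show "(c s \<odot>\<^bsub>tot\<^esub> hmap (\<beta> s) (hmap (\<gamma> s) z)) n i = ?q (c s \<odot>\<^bsub>C ?n\<^esub> \<beta> s ?n (\<gamma> s ?n x))"
      using lin_map_smult[OF comp hc[OF s]] lin_map_smult[OF lin_map_coset \<beta>c[OF s]] by simp
  qed
  also have "\<dots> = ?q (\<Oplus>\<^bsub>C ?n\<^esub>s\<in>S. c s \<odot>\<^bsub>C ?n\<^esub> \<beta> s ?n (\<gamma> s ?n x))"
    using \<beta>c Cn.smult_closed by (intro lin_map_finsum[OF module_C module_Q lin_map_coset S, symmetric]) auto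
  also have "\<dots> = hmap f z n i"
    unfolding eq[OF xc, symmetric] by (rule hmap_component[where z = z and n = n, OF f i xc x(2), symmetric])
  finally show "hmap f z n i = (\<Oplus>\<^bsub>tot\<^esub>s\<in>S. c s \<odot>\<^bsub>tot\<^esub> hmap (\<beta> s) (hmap (\<gamma> s) z)) n i" ..
qed

end

section \<open>The \<open>q\<close>-Hochschild homology\<close>

lemma module_zero_space: "module CC zero_space"
  by (intro moduleI abelian_groupI CC_cring) (auto simp: zero_space_def)

lemma coface_Delta_hom: "1 \<le> n \<Longrightarrow> coface n i \<in> Delta_hom (n - 1) n"
  by (auto simp: coface_def Delta_hom_def mono_on_def)

locale hochschild = complex_comm_algebra scale
  for scale :: "complex \<Rightarrow> 'a::{comm_ring, comm_monoid_mult} \<Rightarrow> 'a" +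
  fixes Y :: "'y simplicial_pset" and N :: nat and q :: complex
  assumes Y: "pointed_simplicial_finite_set Y"
begin

sublocale G: gamma_functor "L_obj scale" "L_map scale"
  by (rule gamma_functor.intro) (rule module_L, rule lin_map_L_map)

lemma face_map: "1 \<le> n \<Longrightarrow> opmap Y (n - 1) n (coface n i) \<in>
    pointed_maps (cells Y n) (basept Y n) (cells Y (n - 1)) (basept Y (n - 1))"
  using Y coface_Delta_hom unfolding pointed_simplicial_finite_set_def by blast

lemma module_LY: "module CC (LY scale Y n)"
  by (simp add: LY_def module_zero_space G.module_ext)

lemma LY_nonneg: "0 \<le> n \<Longrightarrow> LY scale Y n = G.ext (cells Y (nat n)) (basept Y (nat n))"
  by (simp add: LY_def)

lemma lin_map_face: "1 \<le> n \<Longrightarrow> lin_map (LY scale Y n) (LY scale Y (n - 1)) (LY_face scale Y (nat n) i)"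
  using G.lin_map_ext_map[OF face_map[of "nat n" i]] by (simp add: LY_nonneg LY_face_def nat_diff_distrib)

sublocale B: graded_map "LY scale Y" "qb scale Y q" N
proof (rule graded_map.intro)
  show "module CC (LY scale Y n)" for n by (rule module_LY)
  show "lin_map (LY scale Y n) (LY scale Y (n - 1)) (qb scale Y q n)" for n
  proof (cases "n \<le> 0")
    case True
    then show ?thesis by (simp add: qb_def[abs_def] lin_map_const_zero[OF module_LY])
  next
    case False
    then have "lin_map (LY scale Y n) (LY scale Y (n - 1)) (\<lambda>x. \<Oplus>\<^bsub>LY scale Y (n - 1)\<^esub>i\<in>{0..nat n}.
        q ^ i \<odot>\<^bsub>LY scale Y (n - 1)\<^esub> LY_face scale Y (nat n) i x)"
      by (intro lin_map_lincomb[OF module_LY _ lin_map_face module_LY]) auto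
    then show ?thesis using False by (simp add: qb_def[abs_def])
  qed
qed

text \<open>
  The chain map given by an endomorphism of \<open>\<L>(A)\<close>. In negative degrees, where the space is zero, it
  is taken to be the identity.
\<close>

definition extend :: "(nat \<Rightarrow> ('a list \<Rightarrow>\<^sub>0 complex) set \<Rightarrow> ('a list \<Rightarrow>\<^sub>0 complex) set) \<Rightarrow>
    int \<Rightarrow> ('a, 'y) LY_elem \<Rightarrow> ('a, 'y) LY_elem" where
  "extend \<alpha> n = (if n < 0 then (\<lambda>x. x)
     else ext_endo (L_obj scale) (L_map scale) (cells Y (nat n)) (basept Y (nat n)) \<alpha>)"

lemma nat_endoD:
  assumes "nat_endo \<alpha>"
  shows "lin_map (L n) (L n) (\<alpha> n)"
    "\<theta> \<in> Gamma_hom m n \<Longrightarrow> x \<in> carrier (L m) \<Longrightarrow> \<alpha> n (L_map scale m n \<theta> x) = L_map scale m n \<theta> (\<alpha> m x)"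
  using assms by (simp_all add: nat_endo_def)

lemma lin_map_extend:
  assumes "nat_endo \<alpha>"
  shows "lin_map (LY scale Y n) (LY scale Y n) (extend \<alpha> n)"
  using G.lin_map_ext_endo[OF nat_endoD[OF assms], where T = "cells Y (nat n)" and t = "basept Y (nat n)"]
  by (simp add: extend_def LY_def lin_map_ident)

lemma chain_endo_extend:
  assumes \<alpha>: "nat_endo \<alpha>"
  shows "B.chain_endo (extend \<alpha>)"
  unfolding B.chain_endo_def
proof (intro conjI allI ballI)
  show "lin_map (LY scale Y n) (LY scale Y n) (extend \<alpha> n)" for n by (rule lin_map_extend[OF \<alpha>])
  fix n x assume x: "x \<in> carrier (LY scale Y n)"
  show "extend \<alpha> (n - 1) (qb scale Y q n x) = qb scale Y q n (extend \<alpha> n x)"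
  proof (cases "n \<le> 0")
    case True
    then show ?thesis by (simp add: qb_def extend_def)
  next
    case False
    then have n: "1 \<le> n" by simp
    interpret M: module CC "LY scale Y (n - 1)" by (rule module_LY)
    note e = lin_map_extend[OF \<alpha>]
    have face: "extend \<alpha> (n - 1) (LY_face scale Y (nat n) i x) = LY_face scale Y (nat n) i (extend \<alpha> n x)" for i
      using n x G.ext_endo_ext_map[OF nat_endoD[OF \<alpha>] face_map[of "nat n" i], of x]
      by (simp add: extend_def LY_face_def LY_nonneg nat_diff_distrib)
    note fc = lin_map_closed[OF lin_map_face[OF n] x]
    note fc' = lin_map_closed[OF lin_map_face[OF n] lin_map_closed[OF e x]]
    have "extend \<alpha> (n - 1) (\<Oplus>\<^bsub>LY scale Y (n - 1)\<^esub>i\<in>{0..nat n}. q ^ i \<odot>\<^bsub>LY scale Y (n - 1)\<^esub> LY_face scale Y (nat n) i x) =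
        (\<Oplus>\<^bsub>LY scale Y (n - 1)\<^esub>i\<in>{0..nat n}. extend \<alpha> (n - 1) (q ^ i \<odot>\<^bsub>LY scale Y (n - 1)\<^esub> LY_face scale Y (nat n) i x))"
      using fc M.smult_closed by (intro lin_map_finsum[OF module_LY module_LY e]) auto
    also have "\<dots> = (\<Oplus>\<^bsub>LY scale Y (n - 1)\<^esub>i\<in>{0..nat n}. q ^ i \<odot>\<^bsub>LY scale Y (n - 1)\<^esub> LY_face scale Y (nat n) i (extend \<alpha> n x))"
      using fc fc' M.smult_closed by (intro M.finsum_cong') (auto simp: lin_map_smult[OF e] face)
    finally show ?thesis using n by (simp add: qb_def)
  qed
qed

lemma qHH_total_eq: "qHH_total scale Y N q = B.tot"
  by (simp add: qHH_total_def qHH_def[abs_def])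

lemma qHH_endo_eq: "qHH_endo scale Y N q \<alpha> z = B.hmap (extend \<alpha>) z"
  by (simp add: qHH_endo_def B.hmap_def extend_def)

abbreviation "HH \<equiv> qHH_total scale Y N q"
abbreviation "\<Phi> \<equiv> qHH_endo scale Y N q"

lemma module_HH: "module CC HH"
  unfolding qHH_total_eq by (rule B.module_total)

lemma lin_map_\<Phi>: "nat_endo \<alpha> \<Longrightarrow> lin_map HH HH (\<Phi> \<alpha>)"
  unfolding qHH_total_eq qHH_endo_eq[abs_def] by (rule B.lin_map_hmap[OF chain_endo_extend])

text \<open>
  All relations between endomorphisms of \<open>\<L>(A)\<close> that are used are of the form
  \<open>\<alpha> = \<Sum>\<^sub>s c\<^sub>s \<beta>\<^sub>s \<gamma>\<^sub>s\<close>, and pass to homology.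
\<close>

lemma \<Phi>_lincomb:
  assumes S: "finite S" and \<alpha>: "nat_endo \<alpha>" and \<beta>: "\<And>s. s \<in> S \<Longrightarrow> nat_endo (\<beta> s)"
    and \<gamma>: "\<And>s. s \<in> S \<Longrightarrow> nat_endo (\<gamma> s)"
    and eq: "\<And>n X. X \<in> carrier (L n) \<Longrightarrow> \<alpha> n X = (\<Oplus>\<^bsub>L n\<^esub>s\<in>S. c s \<odot>\<^bsub>L n\<^esub> \<beta> s n (\<gamma> s n X))"
    and z: "z \<in> carrier HH"
  shows "\<Phi> \<alpha> z = (\<Oplus>\<^bsub>HH\<^esub>s\<in>S. c s \<odot>\<^bsub>HH\<^esub> \<Phi> (\<beta> s) (\<Phi> (\<gamma> s) z))"
  unfolding qHH_endo_eq qHH_total_eq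
proof (rule B.hmap_lincomb[OF S chain_endo_extend[OF \<alpha>] chain_endo_extend[OF \<beta>] chain_endo_extend[OF \<gamma>] _ z[unfolded qHH_total_eq]])
  fix n x assume x: "x \<in> carrier (LY scale Y (int n))"
  let ?T = "cells Y n" and ?t = "basept Y n"
  let ?E = "\<lambda>\<alpha>. ext_endo (L_obj scale) (L_map scale) ?T ?t \<alpha>"
  interpret E: module CC "G.ext ?T ?t" by (rule G.module_ext)
  have lin: "lin_map (G.ext ?T ?t) (G.ext ?T ?t) (?E \<alpha>)" if "nat_endo \<alpha>" for \<alpha>
    by (rule G.lin_map_ext_endo[OF nat_endoD[OF that]])
  have val: "?E \<alpha> (G.inc ?T ?t (m, \<phi>) X) = G.inc ?T ?t (m, \<phi>) (\<alpha> m X)"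
    if "nat_endo \<alpha>" "(m, \<phi>) \<in> over ?T ?t" "X \<in> carrier (L m)" for \<alpha> m \<phi> X
    by (rule G.ext_endo_inc[OF nat_endoD[OF that(1)] that(2,3)])
  have "?E \<alpha> x = (\<Oplus>\<^bsub>G.ext ?T ?t\<^esub>s\<in>S. c s \<odot>\<^bsub>G.ext ?T ?t\<^esub> ?E (\<beta> s) (?E (\<gamma> s) x))"
  proof (rule G.lin_map_eq_on_inc[OF G.module_ext lin[OF \<alpha>]])
    show "lin_map (G.ext ?T ?t) (G.ext ?T ?t) (\<lambda>x. \<Oplus>\<^bsub>G.ext ?T ?t\<^esub>s\<in>S. c s \<odot>\<^bsub>G.ext ?T ?t\<^esub> ?E (\<beta> s) (?E (\<gamma> s) x))"
      by (rule lin_map_lincomb[OF G.module_ext S lin_map_comp[OF lin[OF \<gamma>] lin[OF \<beta>]] G.module_ext])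
    show "x \<in> carrier (G.ext ?T ?t)" using x by (simp add: LY_nonneg)
    fix m \<phi> X assume o: "(m, \<phi>) \<in> over ?T ?t" and X: "X \<in> carrier (L m)"
    interpret Lm: module CC "L m" by (rule module_L)
    note inc = G.lin_map_inc[OF o]
    have \<gamma>c: "\<gamma> s m X \<in> carrier (L m)" if "s \<in> S" for s
      by (rule lin_map_closed[OF nat_endoD(1)[OF \<gamma>[OF that]] X])
    have \<beta>c: "\<beta> s m (\<gamma> s m X) \<in> carrier (L m)" if "s \<in> S" for s
      by (rule lin_map_closed[OF nat_endoD(1)[OF \<beta>[OF that]] \<gamma>c[OF that]])
    have "?E \<alpha> (G.inc ?T ?t (m, \<phi>) X) = G.inc ?T ?t (m, \<phi>) (\<Oplus>\<^bsub>L m\<^esub>s\<in>S. c s \<odot>\<^bsub>L m\<^esub> \<beta> s m (\<gamma> s m X))"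
      by (simp only: val[OF \<alpha> o X] eq[OF X])
    also have "\<dots> = (\<Oplus>\<^bsub>G.ext ?T ?t\<^esub>s\<in>S. G.inc ?T ?t (m, \<phi>) (c s \<odot>\<^bsub>L m\<^esub> \<beta> s m (\<gamma> s m X)))"
      using \<beta>c Lm.smult_closed by (intro lin_map_finsum[OF module_L G.module_ext inc S]) auto
    also have "\<dots> = (\<Oplus>\<^bsub>G.ext ?T ?t\<^esub>s\<in>S. c s \<odot>\<^bsub>G.ext ?T ?t\<^esub> ?E (\<beta> s) (?E (\<gamma> s) (G.inc ?T ?t (m, \<phi>) X)))"
      using lin_map_closed[OF inc \<beta>c] E.smult_closed
      by (intro E.finsum_cong')
        (auto simp: lin_map_smult[OF inc \<beta>c] val[OF \<gamma> o X] val[OF \<beta> o \<gamma>c])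
    finally show "?E \<alpha> (G.inc ?T ?t (m, \<phi>) X) = \<dots>" .
  qed
  then show "extend \<alpha> (int n) x = (\<Oplus>\<^bsub>LY scale Y (int n)\<^esub>s\<in>S. c s \<odot>\<^bsub>LY scale Y (int n)\<^esub>
      extend (\<beta> s) (int n) (extend (\<gamma> s) (int n) x))"
    by (simp add: extend_def LY_nonneg)
qed

lemma \<Phi>_ident:
  assumes \<alpha>: "nat_endo \<alpha>" and eq: "\<And>n X. X \<in> carrier (L n) \<Longrightarrow> \<alpha> n X = X" and z: "z \<in> carrier HH"
  shows "\<Phi> \<alpha> z = z"
proof (rule B.total_eqI[folded qHH_total_eq, OF lin_map_closed[OF lin_map_\<Phi>[OF \<alpha>] z] z])
  fix n i assume i: "i \<in> {1..N - 1}"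
  obtain x where x: "x \<in> N_ker (LY scale Y) (qb scale Y q) i (int n)"
    "z n i = B.im (int n) i +>\<^bsub>LY scale Y (int n)\<^esub> x"
    using B.total_component_cases[OF z[unfolded qHH_total_eq] i] .
  note xc = B.ker_carrier[OF x(1)]
  let ?T = "cells Y n" and ?t = "basept Y n"
  have "extend \<alpha> (int n) x = x"
  proof (rule G.lin_map_eq_on_inc[OF G.module_ext _ lin_map_ident])
    show "lin_map (G.ext ?T ?t) (G.ext ?T ?t) (extend \<alpha> (int n))"
      using lin_map_extend[OF \<alpha>, of "int n"] by (simp add: LY_nonneg)
    show "x \<in> carrier (G.ext ?T ?t)" using xc by (simp add: LY_nonneg)
    fix m \<phi> X assume "(m, \<phi>) \<in> over ?T ?t" "X \<in> carrier (L m)"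
    then show "extend \<alpha> (int n) (G.inc ?T ?t (m, \<phi>) X) = G.inc ?T ?t (m, \<phi>) X"
      using G.ext_endo_inc[OF nat_endoD[OF \<alpha>]] by (simp add: extend_def eq)
  qed
  then show "\<Phi> \<alpha> z n i = z n i"
    unfolding qHH_endo_eq using B.hmap_component[where z = z and n = n, OF chain_endo_extend[OF \<alpha>] i xc x(2)] x(2) by simp
qed

lemma Der_simps:
  "carrier (Der scale) = {d. derivation scale d}" "add (Der scale) = (\<lambda>d d' a. d a + d' a)"
  "smult (Der scale) = (\<lambda>c d a. scale c (d a))"
  by (simp_all add: Der_def)

lemma derivation_add: "derivation scale d \<Longrightarrow> derivation scale d' \<Longrightarrow> derivation scale (\<lambda>a. d a + d' a)"
  by (rule derivationI) (simp_all add: derivationD scale_right_distrib algebra_simps)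

lemma derivation_smult: "derivation scale d \<Longrightarrow> derivation scale (\<lambda>a. scale c (d a))"
  by (rule derivationI)
    (simp_all add: derivationD scale_right_distrib scale_mult_left scale_mult_right mult.commute)

lemma derivation_bracket: "derivation scale d \<Longrightarrow> derivation scale d' \<Longrightarrow> derivation scale (der_bracket d d')"
  by (rule derivationI) (simp_all add: der_bracket_def derivationD scale_right_diff_distrib algebra_simps)

sublocale R: lie_rep "Der scale" der_bracket HH "der_act scale Y N q"
proof (intro lie_rep.intro lie_ops.intro lie_rep_axioms.intro)
  interpret H: module CC HH by (rule module_HH)
  note ne = nat_endo_L_der
  note id = \<Phi>_ident[OF nat_endo_ident refl]
  have cl: "\<Phi> (L_der scale d) v \<in> carrier HH" if "derivation scale d" "v \<in> carrier HH" for d v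
    by (rule lin_map_closed[OF lin_map_\<Phi>[OF ne[OF that(1)]] that(2)])
  show "x \<oplus>\<^bsub>Der scale\<^esub> y \<in> carrier (Der scale)" if "x \<in> carrier (Der scale)" "y \<in> carrier (Der scale)" for x y
    using that by (simp add: Der_simps derivation_add)
  show "c \<odot>\<^bsub>Der scale\<^esub> x \<in> carrier (Der scale)" if "x \<in> carrier (Der scale)" for c x
    using that by (simp add: Der_simps derivation_smult)
  show "der_bracket x y \<in> carrier (Der scale)" if "x \<in> carrier (Der scale)" "y \<in> carrier (Der scale)" for x y
    using that by (simp add: Der_simps derivation_bracket)
  show "module CC HH" by (rule module_HH)
  show "lin_map HH HH (der_act scale Y N q x)" if "x \<in> carrier (Der scale)" for x
    unfolding der_act_def[abs_def] using that by (simp add: Der_simps lin_map_\<Phi> ne)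
  fix x v assume x: "x \<in> carrier (Der scale)" and v: "v \<in> carrier HH"
  have dx: "derivation scale x" using x by (simp add: Der_simps)
  have lincomb: "\<Phi> (L_der scale (\<lambda>a. \<Sum>s\<in>S. scale (c s) (\<delta> s a))) v = (\<Oplus>\<^bsub>HH\<^esub>s\<in>S. c s \<odot>\<^bsub>HH\<^esub> \<Phi> (L_der scale (\<delta> s)) v)"
    if S: "finite S" and \<delta>: "\<And>s. derivation scale (\<delta> s)" and d: "derivation scale (\<lambda>a. \<Sum>s\<in>S. scale (c s) (\<delta> s a))"
    for S :: "bool set" and c \<delta>
    using \<Phi>_lincomb[OF S ne[OF d] ne[OF \<delta>] nat_endo_ident L_der_lincomb[OF S \<delta> d] v] by (simp add: id[OF v])
  show "der_act scale Y N q (c \<odot>\<^bsub>Der scale\<^esub> x) v = c \<odot>\<^bsub>HH\<^esub> der_act scale Y N q x v" for c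
    using lincomb[of "{True}" "\<lambda>_. x" "\<lambda>_. c"] derivation_smult[OF dx] dx cl[OF dx v] H.smult_closed
    by (simp add: der_act_def Der_simps H.finsum_insert)
  fix y assume y: "y \<in> carrier (Der scale)"
  have dy: "derivation scale y" using y by (simp add: Der_simps)
  show "der_act scale Y N q (x \<oplus>\<^bsub>Der scale\<^esub> y) v = der_act scale Y N q x v \<oplus>\<^bsub>HH\<^esub> der_act scale Y N q y v"
    using lincomb[of "{True, False}" "\<lambda>s. if s then x else y" "\<lambda>_. 1"] derivation_add[OF dx dy] dx dy
      cl[OF dx v] cl[OF dy v]
    by (simp add: der_act_def Der_simps H.finsum_insert H.smult_one[simplified])
  show "der_act scale Y N q (der_bracket x y) v = der_act scale Y N q x (der_act scale Y N q y v)
      \<ominus>\<^bsub>HH\<^esub> der_act scale Y N q y (der_act scale Y N q x v)"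
  proof -
    let ?d = "\<lambda>s. if s then x else y" and ?c = "\<lambda>s. if s then 1 else - 1 :: complex"
    have "\<Phi> (L_der scale (der_bracket x y)) v =
        (\<Oplus>\<^bsub>HH\<^esub>s\<in>{True, False}. ?c s \<odot>\<^bsub>HH\<^esub> \<Phi> (L_der scale (?d s)) (\<Phi> (L_der scale (?d (\<not> s))) v))"
    proof (rule \<Phi>_lincomb[OF _ ne[OF derivation_bracket[OF dx dy]] _ _ _ v])
      show "nat_endo (L_der scale (?d s))" "nat_endo (L_der scale (?d (\<not> s)))" for s using ne dx dy by simp_all
      fix n X assume X: "X \<in> carrier (L n)"
      interpret Ln: module CC "L n" by (rule module_L)
      note cx = lin_map_closed[OF lin_map_L_der[OF dx]] and cy = lin_map_closed[OF lin_map_L_der[OF dy]]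
      show "L_der scale (der_bracket x y) n X = (\<Oplus>\<^bsub>L n\<^esub>s\<in>{True, False}. ?c s \<odot>\<^bsub>L n\<^esub>
          L_der scale (?d s) n (L_der scale (?d (\<not> s)) n X))"
        using cx[OF cy[OF X]] cy[OF cx[OF X]] Ln.smult_closed
        by (simp add: L_der_bracket[OF dx dy derivation_bracket[OF dx dy] X] Ln.finsum_insert
            Ln.smult_one[simplified] a_minus_def module_minus_eq_smult[OF module_L])
    qed simp
    then show ?thesis using cl[OF dx cl[OF dy v]] cl[OF dy cl[OF dx v]] H.smult_closed
      by (simp add: der_act_def H.finsum_insert H.smult_one[simplified] a_minus_def
          module_minus_eq_smult[OF module_HH])
  qed
qed

text \<open>
  Induction on \<open>k\<close>, comparing \<open>act_mirz_word_rec\<close> with the image of \<open>L_hder_rec\<close> in homology.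
\<close>

lemma U_act_hder_elem:
  assumes D: "higher_derivation scale D" and D0: "normalized D" and k: "1 \<le> k" and z: "z \<in> carrier HH"
  shows "U_act scale Y N q (hder_elem scale D k) z = hder_act scale Y N q D k z"
proof -
  let ?\<delta> = "mirz_seq scale D"
  have \<delta>: "derivation scale (?\<delta> r)" for r by (rule mirz_seq_rec(1)[OF D D0])
  have \<delta>': "?\<delta> r \<in> carrier (Der scale)" for r using \<delta> by (simp add: Der_simps)
  note facts = L_hder_rec[of D ?\<delta>, OF mirz_seq_rec(2)[OF D D0] \<delta> D0]
  have ne: "nat_endo (L_hder scale D k)" for k using facts[of k] by blast
  have eq: "R.act (R.mirz_word ?\<delta> k) z = \<Phi> (L_hder scale D k) z" for k
  proof (induct k rule: less_induct)
    case (less k)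
    show ?case
    proof (cases "k = 0")
      case True
      have "\<Phi> (L_hder scale D 0) z = z" by (rule \<Phi>_ident[OF ne _ z]) (use facts[of 0] in blast)
      then show ?thesis using True R.act_mirz_word_0[OF z] by simp
    next
      case False
      then have k: "1 \<le> k" by simp
      have "\<Phi> (L_hder scale D k) z =
          (\<Oplus>\<^bsub>HH\<^esub>r\<in>{1..k}. (1 / of_nat k) \<odot>\<^bsub>HH\<^esub> \<Phi> (L_der scale (?\<delta> r)) (\<Phi> (L_hder scale D (k - r)) z))"
        by (rule \<Phi>_lincomb[OF finite_atLeastAtMost ne nat_endo_L_der[OF \<delta>] ne _ z]) (use facts[of k] k in blast)
      also have "\<dots> = (\<Oplus>\<^bsub>HH\<^esub>r\<in>{1..k}. (1 / of_nat k) \<odot>\<^bsub>HH\<^esub> der_act scale Y N q (?\<delta> r) (R.act (R.mirz_word ?\<delta> (k - r)) z))"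
      proof (rule R.M.finsum_cong'[OF refl])
        have wc: "R.act (R.mirz_word ?\<delta> l) z \<in> carrier HH" for l
          by (rule lin_map_closed[OF R.act_lin[OF z] R.mirz_word_closed[OF \<delta>']])
        show "(\<lambda>r. (1 / of_nat k) \<odot>\<^bsub>HH\<^esub> der_act scale Y N q (?\<delta> r) (R.act (R.mirz_word ?\<delta> (k - r)) z))
            \<in> {1..k} \<rightarrow> carrier HH"
          using lin_map_closed[OF R.\<rho>_lin[OF \<delta>'] wc] R.M.smult_closed by simp
        fix r assume r: "r \<in> {1..k}"
        have "der_act scale Y N q (?\<delta> r) = \<Phi> (L_der scale (?\<delta> r))" by (simp add: der_act_def)
        moreover have "R.act (R.mirz_word ?\<delta> (k - r)) z = \<Phi> (L_hder scale D (k - r)) z"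
          using r by (intro less) simp
        ultimately show "(1 / of_nat k) \<odot>\<^bsub>HH\<^esub> \<Phi> (L_der scale (?\<delta> r)) (\<Phi> (L_hder scale D (k - r)) z) =
            (1 / of_nat k) \<odot>\<^bsub>HH\<^esub> der_act scale Y N q (?\<delta> r) (R.act (R.mirz_word ?\<delta> (k - r)) z)"
          by (simp only:)
      qed
      also note R.act_mirz_word_rec[OF \<delta>' k z, symmetric]
      finally show ?thesis by (rule sym)
    qed
  qed
  have "hder_elem scale D k = R.\<kappa> (R.mirz_word ?\<delta> k)"
    unfolding hder_elem_def by (rule R.mirz_word_image[OF \<delta>' k])
  then have "U_act scale Y N q (hder_elem scale D k) z
      = uea_action HH (der_act scale Y N q) (R.\<kappa> (R.mirz_word ?\<delta> k)) z"
    unfolding U_act_def by (rule arg_cong)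
  also have "\<dots> = R.act (R.mirz_word ?\<delta> k) z"
    by (rule R.uea_action_coset[OF R.mirz_word_closed[OF \<delta>'] z])
  also have "\<dots> = \<Phi> (L_hder scale D k) z" by (rule eq)
  finally show ?thesis unfolding hder_act_def .
qed

end

theorem theorem1p3:
  fixes scale :: "complex \<Rightarrow> 'a::{comm_ring, comm_monoid_mult} \<Rightarrow> 'a"
    and Y :: "'y simplicial_pset"
    and N k :: nat
    and q :: complex
    and D :: "nat \<Rightarrow> 'a \<Rightarrow> 'a"
  assumes "complex_comm_algebra scale"
    and "pointed_simplicial_finite_set Y"
    and "N \<ge> 2"
    and "primitive_root_of_unity N q"
    and "higher_derivation scale D"
    and "normalized D"
    and "k \<ge> 1"
  shows "\<forall>z \<in> carrier (qHH_total scale Y N q).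
    U_act scale Y N q (hder_elem scale D k) z = hder_act scale Y N q D k z"
proof -
  interpret hochschild scale Y N q
    using assms(1,2) by (simp add: hochschild_def hochschild_axioms_def)
  show ?thesis using U_act_hder_elem[OF assms(5-7)] by blast
qed

end
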